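(* Let $R$ be a right noetherian domain (not necessarily commutative). Then the ring of global sections $\mathcal{O}_R(\mathrm{InjSpec}(R))$ of the structure sheaf $\mathcal{O}_R$ of $\mathrm{InjSpec}(R)$ is precisely $R$ (that is, it is isomorphic to $R$ as a ring).
   Context: Rings are associative and unital; modules are unital right modules; $\mathrm{Mod}\text{-}R$ is the category of right $R$-modules and $\mathrm{mod}\text{-}R$ the full subcategory of finitely presented modules. $(L,M)$ denotes the group of morphisms $L\to M$. Injective spectrum: $\mathrm{InjSpec}(R)$ is the set of isomorphism classes of indecomposable injective right $R$-modules, with the (Zariski) topology having as basis of open sets the sets $[M]=\{E : (M,E)=0\}$ for $M\in\mathrm{mod}\text{-}R$. Torsion classes: a (hereditary) torsion class in a Grothendieck category $\mathcal{A}$ is a full subcategory $\mathcal{T}$ closed under subobjects, quotients, extensions and arbitrary coproducts. There is a quotient (localisation) category $\mathcal{A}/\mathcal{T}$ with an exact functor $Q_{\mathcal{T}}:\mathcal{A}\to\mathcal{A}/\mathcal{T}$ with kernel $\mathcal{T}$, universal in the sense that any exact functor from $\mathcal{A}$ to an abelian category which kills $\mathcal{T}$ factors through $Q_{\mathcal{T}}$ by a unique exact functor. For an object $M$, $\mathcal{T}(M)$ denotes the smallest torsion class containing $M$. Structure sheaf: for $M\in\mathrm{mod}\text{-}R$ write $Q_M$ for the quotient functor $\mathrm{Mod}\text{-}R\to(\mathrm{Mod}\text{-}R)/\mathcal{T}(M)$ and let $R_M$ be the endomorphism ring of $Q_M(R_R)$. The torsion class $\mathcal{T}(M)$ depends only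 on the set $[M]$ ($R$ being right noetherian). If $[N]\subseteq[M]$ then $\mathcal{T}(M)\subseteq\mathcal{T}(N)$, so there is a unique exact functor $Q_{M,N}$ with $Q_N=Q_{M,N}\circ Q_M$, and this induces a ring map $R_M\to R_N$. The assignment $[M]\mapsto R_M$ with these restriction maps is a presheaf of rings on the basis of open sets $[M]$; its sheafification, extended to all open sets, is the structure sheaf (sheaf of finite type localisations) $\mathcal{O}_R$. *)

theory Defs
  imports "HOL-Algebra.Module" "HOL-Algebra.QuotRing" "HOL-Analysis.Abstract_Topology"
begin

section \<open>Right modules\<close>

text \<open>
  The library locale \<^locale>\<open>module\<close> is restricted to commutative rings, so only its record type is
  reused (its multiplicative fields play no role). For a right module we read
  \<open>a \<odot>\<^bsub>M\<^esub> x\<close> as \<open>x a\<close>, whence the order of the factors in \<open>smult_assoc\<close>. The library locale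
  \<^locale>\<open>submodule\<close> makes no assumption on the ring and is used unchanged.
\<close>

locale right_module = R?: ring R + M?: abelian_group M
  for R :: "('a, 'r) ring_scheme" (structure) and M :: "('a, 'm) module" (structure) +
  assumes smult_closed: "\<lbrakk>a \<in> carrier R; x \<in> carrier M\<rbrakk> \<Longrightarrow> a \<odot>\<^bsub>M\<^esub> x \<in> carrier M"
    and smult_l_distr: "\<lbrakk>a \<in> carrier R; b \<in> carrier R; x \<in> carrier M\<rbrakk> \<Longrightarrow>
      (a \<oplus>\<^bsub>R\<^esub> b) \<odot>\<^bsub>M\<^esub> x = (a \<odot>\<^bsub>M\<^esub> x) \<oplus>\<^bsub>M\<^esub> (b \<odot>\<^bsub>M\<^esub> x)"
    and smult_r_distr: "\<lbrakk>a \<in> carrier R; x \<in> carrier M; y \<in> carrier M\<rbrakk> \<Longrightarrow>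
      a \<odot>\<^bsub>M\<^esub> (x \<oplus>\<^bsub>M\<^esub> y) = (a \<odot>\<^bsub>M\<^esub> x) \<oplus>\<^bsub>M\<^esub> (a \<odot>\<^bsub>M\<^esub> y)"
    and smult_assoc: "\<lbrakk>a \<in> carrier R; b \<in> carrier R; x \<in> carrier M\<rbrakk> \<Longrightarrow>
      (a \<otimes>\<^bsub>R\<^esub> b) \<odot>\<^bsub>M\<^esub> x = b \<odot>\<^bsub>M\<^esub> (a \<odot>\<^bsub>M\<^esub> x)"
    and smult_one: "x \<in> carrier M \<Longrightarrow> \<one>\<^bsub>R\<^esub> \<odot>\<^bsub>M\<^esub> x = x"

definition rmod_hom ::
    "('a, 'r) ring_scheme \<Rightarrow> ('a, 'm) module \<Rightarrow> ('a, 'n) module \<Rightarrow> ('m \<Rightarrow> 'n) set" where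
  "rmod_hom R M N = {h \<in> carrier M \<rightarrow> carrier N.
     (\<forall>x\<in>carrier M. \<forall>y\<in>carrier M. h (x \<oplus>\<^bsub>M\<^esub> y) = h x \<oplus>\<^bsub>N\<^esub> h y) \<and>
     (\<forall>a\<in>carrier R. \<forall>x\<in>carrier M. h (a \<odot>\<^bsub>M\<^esub> x) = a \<odot>\<^bsub>N\<^esub> h x)}"

definition rmod_mono ::
    "('a, 'r) ring_scheme \<Rightarrow> ('a, 'm) module \<Rightarrow> ('a, 'n) module \<Rightarrow> ('m \<Rightarrow> 'n) set" where
  "rmod_mono R M N = {h \<in> rmod_hom R M N. inj_on h (carrier M)}"

definition rmod_epi ::
    "('a, 'r) ring_scheme \<Rightarrow> ('a, 'm) module \<Rightarrow> ('a, 'n) module \<Rightarrow> ('m \<Rightarrow> 'n) set" where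
  "rmod_epi R M N = {h \<in> rmod_hom R M N. h ` carrier M = carrier N}"

definition rmod_iso ::
    "('a, 'r) ring_scheme \<Rightarrow> ('a, 'm) module \<Rightarrow> ('a, 'n) module \<Rightarrow> bool" where
  "rmod_iso R M N \<longleftrightarrow> (\<exists>h \<in> rmod_hom R M N. bij_betw h (carrier M) (carrier N))"

definition hom_trivial ::
    "('a, 'r) ring_scheme \<Rightarrow> ('a, 'm) module \<Rightarrow> ('a, 'n) module \<Rightarrow> bool" where
  "hom_trivial R M N \<longleftrightarrow> (\<forall>h \<in> rmod_hom R M N. \<forall>x \<in> carrier M. h x = \<zero>\<^bsub>N\<^esub>)"

definition regular_rmod :: "('a, 'r) ring_scheme \<Rightarrow> ('a, 'a) module" where
  "regular_rmod R = \<lparr>carrier = carrier R, mult = mult R, one = one R, zero = zero R,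
     add = add R, smult = (\<lambda>a x. x \<otimes>\<^bsub>R\<^esub> a)\<rparr>"

abbreviation submod :: "('a, 'm) module \<Rightarrow> 'm set \<Rightarrow> ('a, 'm) module" where
  "submod M A \<equiv> M\<lparr>carrier := A\<rparr>"

text \<open>\<open>M/A\<close>, with cosets as elements; the scalar action is \<open>(A + x) a = A + x a\<close>.\<close>

definition quot_rmod :: "('a, 'm) module \<Rightarrow> 'm set \<Rightarrow> ('a, 'm set) module" where
  "quot_rmod M A = \<lparr>carrier = A_RCOSETS M A, mult = undefined, one = undefined, zero = A,
     add = set_add M, smult = (\<lambda>a C. \<Union>x\<in>C. a_r_coset M A (a \<odot>\<^bsub>M\<^esub> x))\<rparr>"

definition direct_sum :: "'i set \<Rightarrow> ('i \<Rightarrow> ('a, 'm) module) \<Rightarrow> ('a, 'i \<Rightarrow> 'm) module" where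
  "direct_sum I F =
    \<lparr>carrier = {x \<in> (\<Pi>\<^sub>E i\<in>I. carrier (F i)). finite {i \<in> I. x i \<noteq> \<zero>\<^bsub>F i\<^esub>}},
     mult = undefined, one = undefined,
     zero = (\<lambda>i\<in>I. \<zero>\<^bsub>F i\<^esub>),
     add = (\<lambda>x y. \<lambda>i\<in>I. x i \<oplus>\<^bsub>F i\<^esub> y i),
     smult = (\<lambda>a x. \<lambda>i\<in>I. a \<odot>\<^bsub>F i\<^esub> x i)\<rparr>"

definition fin_gen_submodule :: "('a, 'r) ring_scheme \<Rightarrow> ('a, 'm) module \<Rightarrow> 'm set \<Rightarrow> bool" where
  "fin_gen_submodule R M N \<longleftrightarrow>
     (\<exists>S. finite S \<and> S \<subseteq> carrier M \<and> N = \<Inter>{K. submodule K R M \<and> S \<subseteq> K})"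

definition fin_presented :: "('a, 'r) ring_scheme \<Rightarrow> ('a, 'm) module \<Rightarrow> bool" where
  "fin_presented R M \<longleftrightarrow> right_module R M \<and>
     (\<exists>(n::nat) h. let L = direct_sum {..<n} (\<lambda>_. regular_rmod R) in
        h \<in> rmod_epi R L M \<and> fin_gen_submodule R L (a_kernel L M h))"

definition right_noetherian :: "('a, 'r) ring_scheme \<Rightarrow> bool" where
  "right_noetherian R \<longleftrightarrow> ring R \<and>
     (\<forall>I. submodule I R (regular_rmod R) \<longrightarrow> fin_gen_submodule R (regular_rmod R) I)"

text \<open>The library locale \<^locale>\<open>domain\<close> includes commutativity.\<close>

definition noncomm_domain :: "('a, 'r) ring_scheme \<Rightarrow> bool" where
  "noncomm_domain R \<longleftrightarrow> ring R \<and> \<one>\<^bsub>R\<^esub> \<noteq> \<zero>\<^bsub>R\<^esub> \<and>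
     (\<forall>a\<in>carrier R. \<forall>b\<in>carrier R. a \<otimes>\<^bsub>R\<^esub> b = \<zero>\<^bsub>R\<^esub> \<longrightarrow> a = \<zero>\<^bsub>R\<^esub> \<or> b = \<zero>\<^bsub>R\<^esub>)"


section \<open>The injective spectrum\<close>

text \<open>
  The category of right \<open>R\<close>-modules is represented by the right modules whose carrier is a set of
  elements of a fixed type \<open>'u\<close> (the universe). A universe is adequate if it is large enough compared
  with \<open>R\<close>; the bound below is \<open>2\<close> to the power \<open>max |R| \<aleph>\<^sub>0\<close>. Such a universe contains copies of all
  finitely generated modules and, \<open>R\<close> being right noetherian, of all indecomposable injectives, and
  injectivity and membership in the torsion classes generated by these modules do not depend on the
  choice of an adequate universe.
\<close>

definition adequate_universe :: "('a, 'r) ring_scheme \<Rightarrow> 'u itself \<Rightarrow> bool" where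
  "adequate_universe R (_ :: 'u itself) \<longleftrightarrow>
     (\<exists>code :: 'a list set \<Rightarrow> 'u. inj_on code (Pow (lists (carrier R))))"

definition injective_rmod :: "('a, 'r) ring_scheme \<Rightarrow> ('a, 'u) module \<Rightarrow> bool" where
  "injective_rmod R E \<longleftrightarrow> right_module R E \<and>
     (\<forall>(A :: ('a, 'u) module) (B :: ('a, 'u) module). right_module R A \<longrightarrow> right_module R B \<longrightarrow>
        (\<forall>i \<in> rmod_mono R A B. \<forall>f \<in> rmod_hom R A E.
           \<exists>g \<in> rmod_hom R B E. \<forall>x \<in> carrier A. g (i x) = f x))"

definition indecomposable_rmod :: "('a, 'r) ring_scheme \<Rightarrow> ('a, 'u) module \<Rightarrow> bool" where
  "indecomposable_rmod R E \<longleftrightarrow> right_module R E \<and> carrier E \<noteq> {\<zero>\<^bsub>E\<^esub>} \<and>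
     (\<forall>A B. submodule A R E \<longrightarrow> submodule B R E \<longrightarrow>
        A \<inter> B = {\<zero>\<^bsub>E\<^esub>} \<longrightarrow> A <+>\<^bsub>E\<^esub> B = carrier E \<longrightarrow> A = {\<zero>\<^bsub>E\<^esub>} \<or> B = {\<zero>\<^bsub>E\<^esub>})"

definition indec_injectives :: "('a, 'r) ring_scheme \<Rightarrow> ('a, 'u) module set" where
  "indec_injectives R = {E. injective_rmod R E \<and> indecomposable_rmod R E}"

definition spec_points :: "('a, 'r) ring_scheme \<Rightarrow> ('a, 'u) module set set" where
  "spec_points R = indec_injectives R //
     {(E, F). E \<in> indec_injectives R \<and> F \<in> indec_injectives R \<and> rmod_iso R E F}"

definition basic_open ::
    "('a, 'r) ring_scheme \<Rightarrow> ('a, 'u) module \<Rightarrow> ('a, 'u) module set set" where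
  "basic_open R M = {p \<in> spec_points R. \<forall>E \<in> p. hom_trivial R M E}"

definition basic_opens :: "('a, 'r) ring_scheme \<Rightarrow> ('a, 'u) module set set set" where
  "basic_opens R = {basic_open R M | M. fin_presented R M}"

definition InjSpec :: "('a, 'r) ring_scheme \<Rightarrow> ('a, 'u) module set topology" where
  "InjSpec R = topology_generated_by (basic_opens R)"

lemma topspace_InjSpec:
  assumes "ring R"
  shows "topspace (InjSpec R :: ('a, 'u) module set topology) = spec_points R"
proof -
  define z :: 'u where "z = undefined"
  define Z :: "('a, 'u) module" where
    "Z = \<lparr>carrier = {z}, mult = undefined, one = undefined, zero = z,
           add = (\<lambda>_ _. z), smult = (\<lambda>_ _. z)\<rparr>"
  interpret R: ring R by fact
  have "abelian_group Z"
    by (rule abelian_groupI) (auto simp: Z_def)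
  then have Z: "right_module R Z"
    by (intro right_module.intro right_module_axioms.intro \<open>ring R\<close>) (auto simp: Z_def)
  define L where "L = direct_sum {..<0::nat} (\<lambda>_. regular_rmod R)"
  have L: "carrier L = {\<zero>\<^bsub>L\<^esub>}"
    by (auto simp: L_def direct_sum_def)
  have add_L: "x \<oplus>\<^bsub>L\<^esub> y = \<zero>\<^bsub>L\<^esub>" and smult_L: "a \<odot>\<^bsub>L\<^esub> x = \<zero>\<^bsub>L\<^esub>" for a x y
    by (auto simp: L_def direct_sum_def)
  have "abelian_group L"
    by (rule abelian_groupI) (auto simp: L add_L)
  then have "subgroup {\<zero>\<^bsub>L\<^esub>} (add_monoid L)"
    using group.triv_subgroup[OF abelian_group.a_group] by fastforce
  then have "submodule {\<zero>\<^bsub>L\<^esub>} R L"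
    by (intro submodule.intro submodule_axioms.intro) (auto simp: smult_L)
  moreover have "\<zero>\<^bsub>L\<^esub> \<in> K" if "submodule K R L" for K
    using subgroup.one_closed[OF submodule.axioms(1)[OF that]] by simp
  ultimately have "{\<zero>\<^bsub>L\<^esub>} = \<Inter>{K. submodule K R L \<and> {} \<subseteq> K}"
    by blast
  moreover have "a_kernel L Z (\<lambda>_. z) = {\<zero>\<^bsub>L\<^esub>}"
    by (auto simp: a_kernel_def' L Z_def)
  ultimately have "fin_gen_submodule R L (a_kernel L Z (\<lambda>_. z))"
    unfolding fin_gen_submodule_def by (intro exI[of _ "{}"]) auto
  moreover have "(\<lambda>_. z) \<in> rmod_epi R L Z"
    by (auto simp: rmod_epi_def rmod_hom_def Z_def L)
  ultimately have "fin_presented R Z"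
    unfolding fin_presented_def Let_def using Z L_def by blast
  moreover have "basic_open R Z = spec_points R"
  proof -
    have "hom_trivial R Z E" if "abelian_group E" for E :: "('a, 'u) module"
    proof -
      interpret E: abelian_group E by fact
      have "h z = \<zero>\<^bsub>E\<^esub>" if "h \<in> rmod_hom R Z E" for h
      proof -
        have "h z \<in> carrier E" "h z \<oplus>\<^bsub>E\<^esub> h z = h z"
          using that by (auto simp: rmod_hom_def Z_def)
        then show ?thesis
          by (metis E.add.l_cancel_one')
      qed
      then show ?thesis by (simp add: hom_trivial_def Z_def)
    qed
    moreover have "abelian_group E" if "p \<in> spec_points R" "E \<in> p" for p and E :: "('a, 'u) module"
      using that by (auto simp: spec_points_def quotient_def indec_injectives_def
          injective_rmod_def right_module_def)
    ultimately show ?thesis by (auto simp: basic_open_def)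
  qed
  ultimately have "spec_points R \<in> (basic_opens R :: ('a, 'u) module set set set)"
    unfolding basic_opens_def by blast
  then show ?thesis
    by (auto simp: InjSpec_def basic_opens_def basic_open_def)
qed


section \<open>Torsion classes and localisation\<close>

text \<open>
  Closure under coproducts: index sets in the universe suffice, since a family has, up to zero
  summands, at most as many members as its coproduct has elements.
\<close>

definition torsion_class :: "('a, 'r) ring_scheme \<Rightarrow> ('a, 'u) module set \<Rightarrow> bool" where
  "torsion_class R T \<longleftrightarrow> T \<subseteq> {X. right_module R X} \<and>
     (\<forall>X Y. right_module R X \<longrightarrow> Y \<in> T \<longrightarrow> rmod_mono R X Y \<noteq> {} \<longrightarrow> X \<in> T) \<and>
     (\<forall>X Y. right_module R Y \<longrightarrow> X \<in> T \<longrightarrow> rmod_epi R X Y \<noteq> {} \<longrightarrow> Y \<in> T) \<and>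
     (\<forall>X Y Z. right_module R Y \<longrightarrow> X \<in> T \<longrightarrow> Z \<in> T \<longrightarrow>
        (\<exists>f \<in> rmod_mono R X Y. \<exists>g \<in> rmod_epi R Y Z. a_kernel Y Z g = f ` carrier X) \<longrightarrow> Y \<in> T) \<and>
     (\<forall>(I :: 'u set) F Y. (\<forall>i\<in>I. F i \<in> T) \<longrightarrow> right_module R Y \<longrightarrow>
        rmod_iso R (direct_sum I F) Y \<longrightarrow> Y \<in> T)"

definition generated_torsion_class ::
    "('a, 'r) ring_scheme \<Rightarrow> ('a, 'u) module \<Rightarrow> ('a, 'u) module set" where
  "generated_torsion_class R M = \<Inter>{T. torsion_class R T \<and> M \<in> T}"

text \<open>Membership, up to isomorphism, of a module whose carrier need not lie in the universe.\<close>

definition belongs_to ::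
    "('a, 'r) ring_scheme \<Rightarrow> ('a, 'u) module set \<Rightarrow> ('a, 'm) module \<Rightarrow> bool" where
  "belongs_to R T X \<longleftrightarrow> (\<exists>Z \<in> T. rmod_iso R Z X)"

text \<open>
  The quotient category of the category of right modules by \<open>T\<close> is Gabriel's: its objects are the
  right modules, and the group of morphisms from \<open>X\<close> to \<open>Y\<close> is the filtered colimit of the groups
  \<open>(A, Y/B)\<close> over the submodules \<open>A\<close> of \<open>X\<close> with \<open>X/A\<close> in \<open>T\<close> and the submodules \<open>B\<close> of \<open>Y\<close> with
  \<open>B\<close> in \<open>T\<close>. A morphism is an equivalence class of triples \<open>(A, B, f)\<close>; two triples are identified
  if they agree after shrinking \<open>A\<close> and enlarging \<open>B\<close>. The values of \<open>f\<close> outside \<open>A\<close> are irrelevant,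
  and cosets are sets, so \<open>f a <+> B'\<close> is the image of \<open>f a\<close> in \<open>Y/B'\<close> when \<open>B \<subseteq> B'\<close>.
\<close>

type_synonym ('x, 'y) fraction = "'x set \<times> 'y set \<times> ('x \<Rightarrow> 'y set)"

definition fractions :: "('a, 'r) ring_scheme \<Rightarrow> ('a, 'u) module set \<Rightarrow>
    ('a, 'x) module \<Rightarrow> ('a, 'y) module \<Rightarrow> ('x, 'y) fraction set" where
  "fractions R T X Y = {(A, B, f).
     submodule A R X \<and> belongs_to R T (quot_rmod X A) \<and>
     submodule B R Y \<and> belongs_to R T (submod Y B) \<and>
     f \<in> rmod_hom R (submod X A) (quot_rmod Y B)}"

definition fraction_rel :: "('a, 'r) ring_scheme \<Rightarrow> ('a, 'u) module set \<Rightarrow>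
    ('a, 'x) module \<Rightarrow> ('a, 'y) module \<Rightarrow> (('x, 'y) fraction \<times> ('x, 'y) fraction) set" where
  "fraction_rel R T X Y = {((A, B, f), (A', B', f')).
     (A, B, f) \<in> fractions R T X Y \<and> (A', B', f') \<in> fractions R T X Y \<and>
     (\<exists>C D. submodule C R X \<and> C \<subseteq> A \<inter> A' \<and> belongs_to R T (quot_rmod X C) \<and>
            submodule D R Y \<and> B \<union> B' \<subseteq> D \<and> belongs_to R T (submod Y D) \<and>
            (\<forall>x\<in>C. f x <+>\<^bsub>Y\<^esub> D = f' x <+>\<^bsub>Y\<^esub> D))}"

definition quot_hom :: "('a, 'r) ring_scheme \<Rightarrow> ('a, 'u) module set \<Rightarrow>
    ('a, 'x) module \<Rightarrow> ('a, 'y) module \<Rightarrow> ('x, 'y) fraction set set" where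
  "quot_hom R T X Y = fractions R T X Y // fraction_rel R T X Y"

text \<open>The image under the quotient functor of a module homomorphism \<open>h\<close> from \<open>X\<close> to \<open>Y\<close>.\<close>

definition quot_functor :: "('a, 'r) ring_scheme \<Rightarrow> ('a, 'u) module set \<Rightarrow>
    ('a, 'x) module \<Rightarrow> ('a, 'y) module \<Rightarrow> ('x \<Rightarrow> 'y) \<Rightarrow> ('x, 'y) fraction set" where
  "quot_functor R T X Y h = fraction_rel R T X Y `` {(carrier X, {\<zero>\<^bsub>Y\<^esub>}, \<lambda>x. {h x})}"

definition fraction_add ::
    "('a, 'y) module \<Rightarrow> ('x, 'y) fraction \<Rightarrow> ('x, 'y) fraction \<Rightarrow> ('x, 'y) fraction" where
  "fraction_add Y = (\<lambda>(A, B, f) (A', B', f'). (A \<inter> A', B <+>\<^bsub>Y\<^esub> B', \<lambda>x. f x <+>\<^bsub>Y\<^esub> f' x))"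

text \<open>
  \<open>g \<circ> f\<close> for \<open>f : A \<rightarrow> Y/B\<close> and \<open>g : A' \<rightarrow> Z/B'\<close>. It is defined on the preimage under \<open>f\<close> of
  \<open>(A' + B)/B\<close>, i.e. on the \<open>x\<close> whose coset \<open>f x\<close> meets \<open>A'\<close>, and takes values in \<open>Z/D\<close> with
  \<open>D/B' = g(A' \<inter> B)\<close>; since \<open>f x \<inter> A'\<close> is a coset of \<open>A' \<inter> B\<close>, the union of the cosets \<open>g y\<close> over
  all \<open>y \<in> f x \<inter> A'\<close> is a coset of \<open>D\<close>.
\<close>

definition fraction_comp ::
    "('y, 'z) fraction \<Rightarrow> ('x, 'y) fraction \<Rightarrow> ('x, 'z) fraction" where
  "fraction_comp = (\<lambda>(A', B', g) (A, B, f).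
     ({x \<in> A. f x \<inter> A' \<noteq> {}}, \<Union>(g ` (A' \<inter> B)), \<lambda>x. \<Union>(g ` (A' \<inter> f x))))"

definition quot_add :: "('a, 'r) ring_scheme \<Rightarrow> ('a, 'u) module set \<Rightarrow>
    ('a, 'x) module \<Rightarrow> ('a, 'y) module \<Rightarrow>
    ('x, 'y) fraction set \<Rightarrow> ('x, 'y) fraction set \<Rightarrow> ('x, 'y) fraction set" where
  "quot_add R T X Y \<phi> \<psi> = fraction_rel R T X Y `` {fraction_add Y f g | f g. f \<in> \<phi> \<and> g \<in> \<psi>}"

definition quot_comp :: "('a, 'r) ring_scheme \<Rightarrow> ('a, 'u) module set \<Rightarrow>
    ('a, 'x) module \<Rightarrow> ('a, 'z) module \<Rightarrow>
    ('y, 'z) fraction set \<Rightarrow> ('x, 'y) fraction set \<Rightarrow> ('x, 'z) fraction set" where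
  "quot_comp R T X Z \<psi> \<phi> = fraction_rel R T X Z `` {fraction_comp g f | g f. g \<in> \<psi> \<and> f \<in> \<phi>}"

definition quot_End :: "('a, 'r) ring_scheme \<Rightarrow> ('a, 'u) module set \<Rightarrow>
    ('a, 'x) module \<Rightarrow> ('x, 'x) fraction set ring" where
  "quot_End R T X =
    \<lparr>carrier = quot_hom R T X X,
     mult = quot_comp R T X X,
     one = quot_functor R T X X (\<lambda>x. x),
     zero = quot_functor R T X X (\<lambda>x. \<zero>\<^bsub>X\<^esub>),
     add = quot_add R T X X\<rparr>"

text \<open>
  For \<open>T \<subseteq> T'\<close> the induced functor between the quotient categories sends the class of a triple
  with respect to \<open>T\<close> to its class with respect to \<open>T'\<close>: the class of \<open>(A, B, f)\<close> is the composite
  of the image of \<open>f\<close> with the inverses of the images of the inclusion of \<open>A\<close> in \<open>X\<close> and of the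
  projection of \<open>Y\<close> onto \<open>Y/B\<close>.
\<close>

definition quot_change :: "('a, 'r) ring_scheme \<Rightarrow> ('a, 'u) module set \<Rightarrow>
    ('a, 'x) module \<Rightarrow> ('a, 'y) module \<Rightarrow> ('x, 'y) fraction set \<Rightarrow> ('x, 'y) fraction set" where
  "quot_change R T' X Y \<phi> = fraction_rel R T' X Y `` \<phi>"


section \<open>Sheafification of a presheaf of rings on a basis of open sets\<close>

text \<open>
  \<open>\<B>\<close> is the basis, \<open>F U\<close> the ring on \<open>U \<in> \<B>\<close> and \<open>\<rho> U V\<close> the restriction map from \<open>F U\<close> to
  \<open>F V\<close> for \<open>V \<subseteq> U\<close>. Stalks are filtered colimits over the basic neighbourhoods of a point, and a
  section over an open set is a family of germs which is locally given by elements of the \<open>F V\<close>.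
\<close>

definition germ :: "'p set set \<Rightarrow> ('p set \<Rightarrow> 's ring) \<Rightarrow> ('p set \<Rightarrow> 'p set \<Rightarrow> 's \<Rightarrow> 's) \<Rightarrow>
    'p \<Rightarrow> 'p set \<Rightarrow> 's \<Rightarrow> ('p set \<times> 's) set" where
  "germ \<B> F \<rho> p U s = {(V, t). V \<in> \<B> \<and> p \<in> V \<and> t \<in> carrier (F V) \<and>
     (\<exists>W\<in>\<B>. p \<in> W \<and> W \<subseteq> U \<inter> V \<and> \<rho> U W s = \<rho> V W t)}"

definition stalk :: "'p set set \<Rightarrow> ('p set \<Rightarrow> 's ring) \<Rightarrow> ('p set \<Rightarrow> 'p set \<Rightarrow> 's \<Rightarrow> 's) \<Rightarrow>
    'p \<Rightarrow> ('p set \<times> 's) set ring" where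
  "stalk \<B> F \<rho> p =
    \<lparr>carrier = {germ \<B> F \<rho> p U s | U s. U \<in> \<B> \<and> p \<in> U \<and> s \<in> carrier (F U)},
     mult = (\<lambda>x y. THE z. \<exists>U\<in>\<B>. p \<in> U \<and> (\<exists>s\<in>carrier (F U). \<exists>t\<in>carrier (F U).
       x = germ \<B> F \<rho> p U s \<and> y = germ \<B> F \<rho> p U t \<and> z = germ \<B> F \<rho> p U (s \<otimes>\<^bsub>F U\<^esub> t))),
     one = (THE z. \<exists>U\<in>\<B>. p \<in> U \<and> z = germ \<B> F \<rho> p U \<one>\<^bsub>F U\<^esub>),
     zero = (THE z. \<exists>U\<in>\<B>. p \<in> U \<and> z = germ \<B> F \<rho> p U \<zero>\<^bsub>F U\<^esub>),
     add = (\<lambda>x y. THE z. \<exists>U\<in>\<B>. p \<in> U \<and> (\<exists>s\<in>carrier (F U). \<exists>t\<in>carrier (F U).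
       x = germ \<B> F \<rho> p U s \<and> y = germ \<B> F \<rho> p U t \<and> z = germ \<B> F \<rho> p U (s \<oplus>\<^bsub>F U\<^esub> t)))\<rparr>"

definition sheafification :: "'p set set \<Rightarrow> ('p set \<Rightarrow> 's ring) \<Rightarrow>
    ('p set \<Rightarrow> 'p set \<Rightarrow> 's \<Rightarrow> 's) \<Rightarrow> 'p set \<Rightarrow> ('p \<Rightarrow> ('p set \<times> 's) set) ring" where
  "sheafification \<B> F \<rho> U =
    \<lparr>carrier = {\<sigma> \<in> (\<Pi>\<^sub>E p\<in>U. carrier (stalk \<B> F \<rho> p)).
       \<forall>p\<in>U. \<exists>V\<in>\<B>. p \<in> V \<and> V \<subseteq> U \<and> (\<exists>s\<in>carrier (F V). \<forall>q\<in>V. \<sigma> q = germ \<B> F \<rho> q V s)},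
     mult = (\<lambda>\<sigma> \<tau>. \<lambda>p\<in>U. \<sigma> p \<otimes>\<^bsub>stalk \<B> F \<rho> p\<^esub> \<tau> p),
     one = (\<lambda>p\<in>U. \<one>\<^bsub>stalk \<B> F \<rho> p\<^esub>),
     zero = (\<lambda>p\<in>U. \<zero>\<^bsub>stalk \<B> F \<rho> p\<^esub>),
     add = (\<lambda>\<sigma> \<tau>. \<lambda>p\<in>U. \<sigma> p \<oplus>\<^bsub>stalk \<B> F \<rho> p\<^esub> \<tau> p)\<rparr>"


section \<open>The structure sheaf\<close>

text \<open>
  The torsion class \<open>\<T>(M)\<close> attached to the basic open set \<open>U = [M]\<close>; for right noetherian \<open>R\<close> it does
  not depend on the choice of \<open>M\<close>.
\<close>

definition torsion_class_of ::
    "('a, 'r) ring_scheme \<Rightarrow> ('a, 'u) module set set \<Rightarrow> ('a, 'u) module set" where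
  "torsion_class_of R U =
     generated_torsion_class R (SOME M. fin_presented R M \<and> basic_open R M = U)"

definition loc_ring ::
    "('a, 'r) ring_scheme \<Rightarrow> ('a, 'u) module set set \<Rightarrow> ('a, 'a) fraction set ring" where
  "loc_ring R U = quot_End R (torsion_class_of R U) (regular_rmod R)"

definition loc_restrict :: "('a, 'r) ring_scheme \<Rightarrow>
    ('a, 'u) module set set \<Rightarrow> ('a, 'u) module set set \<Rightarrow>
    ('a, 'a) fraction set \<Rightarrow> ('a, 'a) fraction set" where
  "loc_restrict R U V = quot_change R (torsion_class_of R V) (regular_rmod R) (regular_rmod R)"

definition structure_sheaf :: "('a, 'r) ring_scheme \<Rightarrow> ('a, 'u) module set set \<Rightarrow>
    (('a, 'u) module set \<Rightarrow> (('a, 'u) module set set \<times> ('a, 'a) fraction set) set) ring" where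
  "structure_sheaf R = sheafification (basic_opens R) (loc_ring R) (loc_restrict R)"

end

theory Submission
  imports Defs
begin

text \<open>
  Every nonempty basic open set contains the injective hull of \<open>R\<close>, so all the rings \<open>R\<^sub>M\<close> lie in the
  division ring of quotients of \<open>R\<close> and a global section is an element \<open>d\<close> of it. Suppose that
  \<open>I = {r. d r \<in> R}\<close> is proper, and let \<open>E\<close> be the injective hull of \<open>R/K\<close> for a maximal right ideal
  \<open>K \<supseteq> I\<close>. Near \<open>E\<close>, \<open>d\<close> is given by a homomorphism \<open>A \<rightarrow> R\<close> on a right ideal \<open>A \<subseteq> I\<close> with
  \<open>R/A\<close> torsion, so \<open>(R/A, E) = 0\<close>; but \<open>R/A \<rightarrow> R/K \<rightarrow> E\<close> is nonzero. Hence \<open>d \<in> R\<close>.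

  A right ideal \<open>A\<close> has \<open>R/A \<in> \<T>(M)\<close> iff no nonzero element of a point of \<open>[M]\<close> is annihilated by
  \<open>A\<close>. This makes the restriction maps well behaved, and with the Ore condition it shows that a
  fraction which agrees somewhere with left multiplication by an element of \<open>R\<close> is that multiplication.
\<close>

section \<open>Right modules\<close>

text \<open>The main cost lies in the universe. Torsion classes see only modules over the type
  \<open>'u\<close>, whereas cosets, direct sums and injective hulls arise in other types and have
  to be copied into \<open>'u\<close>. For hulls this needs a bound on their size, and it comes from
  an explicit injective module: families, indexed by \<open>R\<close>, of characters of
  \<open>R\<close> with values in the nonzero complex numbers. There are at most 2 to the power
  \<open>max |R| \<aleph>\<close> such families, with \<open>\<aleph>\<close> countable, which is
  the bound in \<open>adequate_universe\<close>.

  The division ring is never built. Over a nonempty basic open set a fraction is a homomorphism from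
  a right ideal to \<open>R\<close>, and two fractions are compared on a nonzero right ideal; the
  Ore condition makes any two of these meet. Over the empty set the localisation is zero, so a point
  of the set is carried along as a premise.

  Stalks are not shown to be rings either. The operations are computed only on germs of sections
  given by elements of \<open>R\<close>, and the ring structure of the global sections is
  transported from \<open>R\<close>.\<close>

lemma rmod_hom_closed: "h \<in> rmod_hom R M N \<Longrightarrow> x \<in> carrier M \<Longrightarrow> h x \<in> carrier N"
  by (auto simp: rmod_hom_def)

lemma rmod_hom_add: "h \<in> rmod_hom R M N \<Longrightarrow> x \<in> carrier M \<Longrightarrow> y \<in> carrier M \<Longrightarrow>
    h (x \<oplus>\<^bsub>M\<^esub> y) = h x \<oplus>\<^bsub>N\<^esub> h y"
  by (auto simp: rmod_hom_def)

lemma rmod_hom_smult: "h \<in> rmod_hom R M N \<Longrightarrow> a \<in> carrier R \<Longrightarrow> x \<in> carrier M \<Longrightarrow>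
    h (a \<odot>\<^bsub>M\<^esub> x) = a \<odot>\<^bsub>N\<^esub> h x"
  by (auto simp: rmod_hom_def)

lemma rmod_homI:
  assumes "\<And>x. x \<in> carrier M \<Longrightarrow> h x \<in> carrier N"
    and "\<And>x y. x \<in> carrier M \<Longrightarrow> y \<in> carrier M \<Longrightarrow> h (x \<oplus>\<^bsub>M\<^esub> y) = h x \<oplus>\<^bsub>N\<^esub> h y"
    and "\<And>a x. a \<in> carrier R \<Longrightarrow> x \<in> carrier M \<Longrightarrow> h (a \<odot>\<^bsub>M\<^esub> x) = a \<odot>\<^bsub>N\<^esub> h x"
  shows "h \<in> rmod_hom R M N"
  using assms by (auto simp: rmod_hom_def)

lemma rmod_hom_comp:
  assumes "f \<in> rmod_hom R L M" "g \<in> rmod_hom R M N"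
  shows "(\<lambda>x. g (f x)) \<in> rmod_hom R L N"
  using assms by (auto simp: rmod_hom_def Pi_def)

lemma rmod_monoD: "h \<in> rmod_mono R M N \<Longrightarrow> h \<in> rmod_hom R M N"
  and rmod_epiD: "h \<in> rmod_epi R M N \<Longrightarrow> h \<in> rmod_hom R M N"
  by (auto simp: rmod_mono_def rmod_epi_def)

lemma rmod_epi_surj:
  assumes "h \<in> rmod_epi R M N" "y \<in> carrier N"
  obtains x where "x \<in> carrier M" "h x = y"
proof -
  have "y \<in> h ` carrier M" using assms(1,2) by (simp add: rmod_epi_def)
  then show ?thesis using that by blast
qed

lemma rmod_epiI:
  assumes "h \<in> rmod_hom R M N" "\<And>y. y \<in> carrier N \<Longrightarrow> \<exists>x\<in>carrier M. h x = y"
  shows "h \<in> rmod_epi R M N"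
proof -
  have "h ` carrier M = carrier N"
  proof
    show "h ` carrier M \<subseteq> carrier N" using rmod_hom_closed[OF assms(1)] by auto
    show "carrier N \<subseteq> h ` carrier M" using assms(2) by (auto simp: image_iff dest: sym)
  qed
  with assms(1) show ?thesis by (simp add: rmod_epi_def)
qed

lemma rmod_epi_cancel:
  assumes "h \<in> rmod_hom R Z Y" "\<pi> \<in> rmod_hom R X Z" "f \<in> rmod_epi R X Y"
    and "\<And>x. x \<in> carrier X \<Longrightarrow> h (\<pi> x) = f x"
  shows "h \<in> rmod_epi R Z Y"
proof (rule rmod_epiI[OF assms(1)])
  fix y assume "y \<in> carrier Y"
  then obtain x where "x \<in> carrier X" "f x = y" by (rule rmod_epi_surj[OF assms(3)])
  then show "\<exists>z\<in>carrier Z. h z = y"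
    using assms(4) rmod_hom_closed[OF assms(2)] by (intro bexI[of _ "\<pi> x"]) auto
qed

lemma rmod_epi_comp:
  assumes "f \<in> rmod_epi R L M" "g \<in> rmod_epi R M N"
  shows "(\<lambda>x. g (f x)) \<in> rmod_epi R L N"
  using assms rmod_hom_comp[OF rmod_epiD rmod_epiD, OF assms]
  unfolding rmod_epi_def by (simp add: image_image[symmetric])

lemma regular_rmod_simps [simp]:
  "carrier (regular_rmod R) = carrier R" "add (regular_rmod R) = add R"
  "zero (regular_rmod R) = zero R" "a \<odot>\<^bsub>regular_rmod R\<^esub> x = x \<otimes>\<^bsub>R\<^esub> a"
  by (simp_all add: regular_rmod_def)

lemma (in ring) right_module_regular: "right_module R (regular_rmod R)"
proof (intro right_module.intro right_module_axioms.intro ring_axioms)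
  show "abelian_group (regular_rmod R)"
    by (rule abelian_groupI) (auto simp: a_ac intro: l_neg)
qed (auto simp: l_distr r_distr m_assoc)

context right_module
begin

lemma smult_r_zero: "a \<in> carrier R \<Longrightarrow> a \<odot>\<^bsub>M\<^esub> \<zero>\<^bsub>M\<^esub> = \<zero>\<^bsub>M\<^esub>"
  by (metis M.add.l_cancel_one' M.l_zero M.zero_closed smult_closed smult_r_distr)

lemma smult_l_zero: "x \<in> carrier M \<Longrightarrow> \<zero>\<^bsub>R\<^esub> \<odot>\<^bsub>M\<^esub> x = \<zero>\<^bsub>M\<^esub>"
  by (metis M.add.l_cancel_one' R.l_zero R.zero_closed smult_closed smult_l_distr)

lemma smult_l_minus: "a \<in> carrier R \<Longrightarrow> x \<in> carrier M \<Longrightarrow> (\<ominus>\<^bsub>R\<^esub> a) \<odot>\<^bsub>M\<^esub> x = \<ominus>\<^bsub>M\<^esub> (a \<odot>\<^bsub>M\<^esub> x)"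
  by (metis M.minus_equality R.a_inv_closed R.l_neg smult_closed smult_l_distr smult_l_zero)

lemma smult_r_minus: "a \<in> carrier R \<Longrightarrow> x \<in> carrier M \<Longrightarrow> a \<odot>\<^bsub>M\<^esub> (\<ominus>\<^bsub>M\<^esub> x) = \<ominus>\<^bsub>M\<^esub> (a \<odot>\<^bsub>M\<^esub> x)"
  by (metis M.minus_equality M.a_inv_closed M.l_neg smult_closed smult_r_distr smult_r_zero)

text \<open>Negatives come for free: \<open>\<ominus> x\<close> is the action of
  \<open>\<ominus> \<one>\<close> on \<open>x\<close>.\<close>

lemma submoduleI:
  assumes "H \<subseteq> carrier M" "\<zero>\<^bsub>M\<^esub> \<in> H"
    and add: "\<And>x y. x \<in> H \<Longrightarrow> y \<in> H \<Longrightarrow> x \<oplus>\<^bsub>M\<^esub> y \<in> H"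
    and smult: "\<And>a x. a \<in> carrier R \<Longrightarrow> x \<in> H \<Longrightarrow> a \<odot>\<^bsub>M\<^esub> x \<in> H"
  shows "submodule H R M"
proof (intro submodule.intro submodule_axioms.intro subgroup.intro)
  fix x assume x: "x \<in> H"
  have "\<ominus>\<^bsub>M\<^esub> x = (\<ominus>\<^bsub>R\<^esub> \<one>\<^bsub>R\<^esub>) \<odot>\<^bsub>M\<^esub> x"
    using x assms(1) by (subst smult_l_minus) (auto simp: smult_one)
  then have "\<ominus>\<^bsub>M\<^esub> x \<in> H" using smult[of "\<ominus>\<^bsub>R\<^esub> \<one>\<^bsub>R\<^esub>" x] x by simp
  then show "inv\<^bsub>add_monoid M\<^esub> x \<in> H" by (simp add: a_inv_def)
qed (use assms in auto)

end

lemma submodule_subset: "submodule H R M \<Longrightarrow> H \<subseteq> carrier M"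
  using subgroup.subset[OF submodule.axioms(1)] by fastforce

lemma submodule_mem: "submodule H R M \<Longrightarrow> x \<in> H \<Longrightarrow> x \<in> carrier M"
  using submodule_subset by blast

lemma submodule_zero: "submodule H R M \<Longrightarrow> \<zero>\<^bsub>M\<^esub> \<in> H"
  using subgroup.one_closed[OF submodule.axioms(1)] by fastforce

lemma submodule_add: "submodule H R M \<Longrightarrow> x \<in> H \<Longrightarrow> y \<in> H \<Longrightarrow> x \<oplus>\<^bsub>M\<^esub> y \<in> H"
  using subgroup.m_closed[OF submodule.axioms(1), of H R M x y] by simp

lemma submodule_smult: "submodule H R M \<Longrightarrow> a \<in> carrier R \<Longrightarrow> x \<in> H \<Longrightarrow> a \<odot>\<^bsub>M\<^esub> x \<in> H"
  by (rule submodule.smult_closed)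

lemma submodule_minus: "submodule H R M \<Longrightarrow> x \<in> H \<Longrightarrow> \<ominus>\<^bsub>M\<^esub> x \<in> H"
  using subgroup.m_inv_closed[OF submodule.axioms(1), of H R M x] by (simp add: a_inv_def)

lemma submodule_diff: "submodule H R M \<Longrightarrow> x \<in> H \<Longrightarrow> y \<in> H \<Longrightarrow> x \<ominus>\<^bsub>M\<^esub> y \<in> H"
  by (simp add: a_minus_def submodule_add submodule_minus)

context right_module
begin

lemma submodule_carrier: "submodule (carrier M) R M"
  by (rule submoduleI) (auto simp: smult_closed)

lemma submodule_zero_set: "submodule {\<zero>\<^bsub>M\<^esub>} R M"
  by (rule submoduleI) (auto simp: smult_r_zero)

lemma submodule_Int: "submodule A R M \<Longrightarrow> submodule B R M \<Longrightarrow> submodule (A \<inter> B) R M"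
  by (rule submoduleI) (auto simp: submodule_zero submodule_add submodule_smult submodule_mem)

lemma submodule_Inter:
  assumes "\<And>A. A \<in> \<A> \<Longrightarrow> submodule A R M" "\<A> \<noteq> {}"
  shows "submodule (\<Inter>\<A>) R M"
proof (rule submoduleI)
  show "\<Inter>\<A> \<subseteq> carrier M"
    using assms submodule_subset[OF assms(1)] by blast
qed (auto intro: submodule_zero[OF assms(1)] submodule_add[OF assms(1)]
    submodule_smult[OF assms(1)])

lemma submodule_Union_chain:
  assumes "\<And>A. A \<in> \<A> \<Longrightarrow> submodule A R M" "\<A> \<noteq> {}"
    and chain: "\<And>A B. A \<in> \<A> \<Longrightarrow> B \<in> \<A> \<Longrightarrow> A \<subseteq> B \<or> B \<subseteq> A"
  shows "submodule (\<Union>\<A>) R M"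
proof (rule submoduleI)
  fix x y assume "x \<in> \<Union>\<A>" "y \<in> \<Union>\<A>"
  then obtain A B where AB: "A \<in> \<A>" "B \<in> \<A>" "x \<in> A" "y \<in> B" by blast
  show "x \<oplus>\<^bsub>M\<^esub> y \<in> \<Union>\<A>"
    using chain[OF AB(1,2)] AB assms(1)[OF AB(1)] assms(1)[OF AB(2)] by (meson UnionI in_mono submodule_add)
next
  show "\<Union>\<A> \<subseteq> carrier M"
    using submodule_subset[OF assms(1)] by blast
  show "\<zero>\<^bsub>M\<^esub> \<in> \<Union>\<A>"
    using submodule_zero[OF assms(1)] assms(2) by blast
qed (auto intro: submodule_smult[OF assms(1)])

lemma submodule_sum:
  assumes A: "submodule A R M" and B: "submodule B R M"
  shows "submodule {x \<oplus>\<^bsub>M\<^esub> y | x y. x \<in> A \<and> y \<in> B} R M"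
proof (rule submoduleI)
  show "{x \<oplus>\<^bsub>M\<^esub> y | x y. x \<in> A \<and> y \<in> B} \<subseteq> carrier M"
    using submodule_mem[OF A] submodule_mem[OF B] by auto
  show "\<zero>\<^bsub>M\<^esub> \<in> {x \<oplus>\<^bsub>M\<^esub> y | x y. x \<in> A \<and> y \<in> B}"
    using submodule_zero[OF A] submodule_zero[OF B] by force
next
  fix u v assume "u \<in> {x \<oplus>\<^bsub>M\<^esub> y | x y. x \<in> A \<and> y \<in> B}" "v \<in> {x \<oplus>\<^bsub>M\<^esub> y | x y. x \<in> A \<and> y \<in> B}"
  then obtain x y x' y' where xy: "x \<in> A" "y \<in> B" "x' \<in> A" "y' \<in> B"
    "u = x \<oplus>\<^bsub>M\<^esub> y" "v = x' \<oplus>\<^bsub>M\<^esub> y'" by blast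
  then have "u \<oplus>\<^bsub>M\<^esub> v = (x \<oplus>\<^bsub>M\<^esub> x') \<oplus>\<^bsub>M\<^esub> (y \<oplus>\<^bsub>M\<^esub> y')"
    using submodule_mem[OF A] submodule_mem[OF B] by (simp add: M.a_ac)
  with xy show "u \<oplus>\<^bsub>M\<^esub> v \<in> {x \<oplus>\<^bsub>M\<^esub> y | x y. x \<in> A \<and> y \<in> B}"
    using submodule_add[OF A] submodule_add[OF B] by blast
next
  fix a u assume a: "a \<in> carrier R" and "u \<in> {x \<oplus>\<^bsub>M\<^esub> y | x y. x \<in> A \<and> y \<in> B}"
  then obtain x y where xy: "x \<in> A" "y \<in> B" "u = x \<oplus>\<^bsub>M\<^esub> y" by blast
  then have "a \<odot>\<^bsub>M\<^esub> u = a \<odot>\<^bsub>M\<^esub> x \<oplus>\<^bsub>M\<^esub> a \<odot>\<^bsub>M\<^esub> y"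
    using a submodule_mem[OF A] submodule_mem[OF B] by (simp add: smult_r_distr)
  with a xy show "a \<odot>\<^bsub>M\<^esub> u \<in> {x \<oplus>\<^bsub>M\<^esub> y | x y. x \<in> A \<and> y \<in> B}"
    using submodule_smult[OF A] submodule_smult[OF B] by blast
qed

lemma submodule_cyclic:
  assumes x: "x \<in> carrier M"
  shows "submodule ((\<lambda>a. a \<odot>\<^bsub>M\<^esub> x) ` carrier R) R M"
proof (rule submoduleI)
  show "\<zero>\<^bsub>M\<^esub> \<in> (\<lambda>a. a \<odot>\<^bsub>M\<^esub> x) ` carrier R"
    using smult_l_zero[OF x] by force
qed (use x in \<open>auto simp: smult_closed smult_l_distr[symmetric] smult_assoc[symmetric]\<close>)

lemma right_module_submod:
  assumes "submodule H R M"
  shows "right_module R (submod M H)"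
proof (intro right_module.intro right_module_axioms.intro R.ring_axioms)
  note H = submodule_mem[OF assms] submodule_zero[OF assms] submodule_add[OF assms]
    submodule_minus[OF assms]
  show "abelian_group (submod M H)"
  proof (rule abelian_groupI)
    fix x assume "x \<in> carrier (submod M H)"
    then show "\<exists>y\<in>carrier (submod M H). y \<oplus>\<^bsub>submod M H\<^esub> x = \<zero>\<^bsub>submod M H\<^esub>"
      using H M.l_neg by (intro bexI[of _ "\<ominus>\<^bsub>M\<^esub> x"]) auto
  qed (use H in \<open>auto simp: M.a_ac\<close>)
qed (use submodule_mem[OF assms] submodule_smult[OF assms] in
      \<open>auto simp: smult_l_distr smult_r_distr smult_assoc smult_one\<close>)

lemma minus_eq_zero_iff:
  "x \<in> carrier M \<Longrightarrow> y \<in> carrier M \<Longrightarrow> x \<ominus>\<^bsub>M\<^esub> y = \<zero>\<^bsub>M\<^esub> \<longleftrightarrow> x = y"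
  by (metis a_minus_def M.minus_equality M.minus_minus M.a_inv_closed M.r_neg)

lemma cyclic_hom:
  assumes "x \<in> carrier M"
  shows "(\<lambda>r. r \<odot>\<^bsub>M\<^esub> x) \<in> rmod_hom R (regular_rmod R) M"
  using assms by (intro rmod_homI) (auto simp: smult_closed smult_l_distr smult_assoc)

end

section \<open>Factorisation of homomorphisms and models of quotients in a given type\<close>

lemma rmod_hom_zero:
  assumes "right_module R M" "right_module R N" "h \<in> rmod_hom R M N"
  shows "h \<zero>\<^bsub>M\<^esub> = \<zero>\<^bsub>N\<^esub>"
proof -
  interpret M: right_module R M by fact
  interpret N: right_module R N by fact
  show ?thesis
    by (metis M.M.zero_closed M.smult_l_zero N.smult_l_zero M.R.zero_closed assms(3)
        rmod_hom_closed rmod_hom_smult)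
qed

lemma rmod_hom_minus:
  assumes "right_module R M" "right_module R N" "h \<in> rmod_hom R M N" "x \<in> carrier M"
  shows "h (\<ominus>\<^bsub>M\<^esub> x) = \<ominus>\<^bsub>N\<^esub> h x"
proof -
  interpret M: right_module R M by fact
  interpret N: right_module R N by fact
  have "h (\<ominus>\<^bsub>M\<^esub> x) \<oplus>\<^bsub>N\<^esub> h x = \<zero>\<^bsub>N\<^esub>"
    using rmod_hom_add[OF assms(3), of "\<ominus>\<^bsub>M\<^esub> x" x] assms(4) M.M.l_neg[OF assms(4)]
      rmod_hom_zero[OF assms(1-3)] by simp
  then show ?thesis
    using rmod_hom_closed[OF assms(3)] assms(4) by (metis M.M.a_inv_closed N.M.minus_equality)
qed

lemma rmod_hom_diff:
  assumes "right_module R M" "right_module R N" "h \<in> rmod_hom R M N"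
    "x \<in> carrier M" "y \<in> carrier M"
  shows "h (x \<ominus>\<^bsub>M\<^esub> y) = h x \<ominus>\<^bsub>N\<^esub> h y"
proof -
  interpret M: right_module R M by fact
  show ?thesis
    using assms rmod_hom_add[OF assms(3), of x "\<ominus>\<^bsub>M\<^esub> y"] rmod_hom_minus[OF assms(1-3,5)]
    by (simp add: a_minus_def)
qed

lemma rmod_hom_inj_iff:
  assumes "right_module R M" "right_module R N" "h \<in> rmod_hom R M N"
  shows "inj_on h (carrier M) \<longleftrightarrow> (\<forall>x\<in>carrier M. h x = \<zero>\<^bsub>N\<^esub> \<longrightarrow> x = \<zero>\<^bsub>M\<^esub>)"
proof -
  interpret M: right_module R M by fact
  interpret N: right_module R N by fact
  show ?thesis
  proof
    assume "inj_on h (carrier M)"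
    then show "\<forall>x\<in>carrier M. h x = \<zero>\<^bsub>N\<^esub> \<longrightarrow> x = \<zero>\<^bsub>M\<^esub>"
      using rmod_hom_zero[OF assms] by (metis M.M.zero_closed inj_onD)
  next
    assume *: "\<forall>x\<in>carrier M. h x = \<zero>\<^bsub>N\<^esub> \<longrightarrow> x = \<zero>\<^bsub>M\<^esub>"
    show "inj_on h (carrier M)"
    proof (rule inj_onI)
      fix x y assume xy: "x \<in> carrier M" "y \<in> carrier M" "h x = h y"
      then have "h (x \<ominus>\<^bsub>M\<^esub> y) = \<zero>\<^bsub>N\<^esub>"
        using rmod_hom_diff[OF assms] rmod_hom_closed[OF assms(3)] N.minus_eq_zero_iff by simp
      then show "x = y" using * xy M.minus_eq_zero_iff by auto
    qed
  qed
qed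

text \<open>Constancy on the fibres of an epimorphism is all that descent needs. No kernel occurs,
  so the lemma also yields inverses of bijective homomorphisms.\<close>

lemma rmod_hom_factor:
  assumes "right_module R X" and \<pi>: "\<pi> \<in> rmod_epi R X Z" and f: "f \<in> rmod_hom R X Y"
    and fib: "\<And>x y. x \<in> carrier X \<Longrightarrow> y \<in> carrier X \<Longrightarrow> \<pi> x = \<pi> y \<Longrightarrow> f x = f y"
  obtains h where "h \<in> rmod_hom R Z Y" "\<And>x. x \<in> carrier X \<Longrightarrow> h (\<pi> x) = f x"
proof -
  interpret X: right_module R X by fact
  define h where "h z = f (SOME x. x \<in> carrier X \<and> \<pi> x = z)" for z
  have h: "h (\<pi> x) = f x" if "x \<in> carrier X" for x
  proof -
    have "\<exists>y. y \<in> carrier X \<and> \<pi> y = \<pi> x" using that by blast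
    from someI_ex[OF this] show ?thesis unfolding h_def using fib that by blast
  qed
  note p = rmod_epiD[OF \<pi>]
  have "h \<in> rmod_hom R Z Y"
  proof (rule rmod_homI)
    fix z assume "z \<in> carrier Z"
    then show "h z \<in> carrier Y" using rmod_epi_surj[OF \<pi>] h rmod_hom_closed[OF f] by metis
  next
    fix z w assume "z \<in> carrier Z" "w \<in> carrier Z"
    then obtain x y where "x \<in> carrier X" "\<pi> x = z" "y \<in> carrier X" "\<pi> y = w"
      using rmod_epi_surj[OF \<pi>] by metis
    then show "h (z \<oplus>\<^bsub>Z\<^esub> w) = h z \<oplus>\<^bsub>Y\<^esub> h w"
      using h[of x] h[of y] h[of "x \<oplus>\<^bsub>X\<^esub> y"] rmod_hom_add[OF p] rmod_hom_add[OF f] by simp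
  next
    fix a z assume "a \<in> carrier R" "z \<in> carrier Z"
    moreover then obtain x where "x \<in> carrier X" "\<pi> x = z"
      using rmod_epi_surj[OF \<pi>] by metis
    ultimately show "h (a \<odot>\<^bsub>Z\<^esub> z) = a \<odot>\<^bsub>Y\<^esub> h z"
      using h[of x] h[of "a \<odot>\<^bsub>X\<^esub> x"] rmod_hom_smult[OF p] rmod_hom_smult[OF f] X.smult_closed
      by simp
  qed
  with h show ?thesis using that by blast
qed

lemma rmod_iso_sym:
  assumes "right_module R X" "rmod_iso R X Y" shows "rmod_iso R Y X"
proof -
  obtain h where h: "h \<in> rmod_hom R X Y" "bij_betw h (carrier X) (carrier Y)"
    using assms(2) by (auto simp: rmod_iso_def)
  have e: "h \<in> rmod_epi R X Y" using h by (auto simp: rmod_epi_def bij_betw_def)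
  \<comment> \<open>The inverse is the identity factored through \<open>h\<close>.\<close>
  obtain g where g: "g \<in> rmod_hom R Y X" "\<And>x. x \<in> carrier X \<Longrightarrow> g (h x) = x"
    by (rule rmod_hom_factor[OF assms(1) e, of "\<lambda>x. x" X])
       (use h in \<open>auto simp: rmod_hom_def bij_betw_def inj_on_def\<close>)
  have "bij_betw g (carrier Y) (carrier X)"
  proof (rule bij_betw_byWitness[of _ h])
    show "\<forall>y\<in>carrier Y. h (g y) = y" using rmod_epi_surj[OF e] g(2) by metis
  qed (use g h in \<open>auto simp: rmod_hom_def\<close>)
  with g show ?thesis by (auto simp: rmod_iso_def)
qed

text \<open>Any map \<open>g\<close> whose fibres are the cosets of \<open>A\<close> turns its own
  image into a model of \<open>X/A\<close>, with operations computed on chosen preimages. The type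
  of the image is free, which allows the quotient to be placed in the universe, where
  \<open>quot_rmod\<close> would leave it.\<close>

lemma quotient_realization:
  fixes R :: "('a, 'r) ring_scheme" and X :: "('a, 'x) module" and g :: "'x \<Rightarrow> 'd"
  assumes "right_module R X" and A: "submodule A R X"
    and g: "\<And>x y. x \<in> carrier X \<Longrightarrow> y \<in> carrier X \<Longrightarrow> g x = g y \<longleftrightarrow> x \<ominus>\<^bsub>X\<^esub> y \<in> A"
  obtains Z where "right_module R Z" "g \<in> rmod_epi R X Z"
proof -
  interpret X: right_module R X by fact
  define s where "s = inv_into (carrier X) g"
  define Z :: "('a, 'd) module" where
    "Z = \<lparr>carrier = g ` carrier X, mult = undefined, one = undefined, zero = g \<zero>\<^bsub>X\<^esub>,
      add = (\<lambda>u v. g (s u \<oplus>\<^bsub>X\<^esub> s v)), smult = (\<lambda>a u. g (a \<odot>\<^bsub>X\<^esub> s u))\<rparr>"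
  have s: "s (g x) \<in> carrier X" "g (s (g x)) = g x" if "x \<in> carrier X" for x
    using that by (auto simp: s_def intro: inv_into_into f_inv_into_f)
  have add: "g (s (g x) \<oplus>\<^bsub>X\<^esub> s (g y)) = g (x \<oplus>\<^bsub>X\<^esub> y)" if xy: "x \<in> carrier X" "y \<in> carrier X" for x y
  proof -
    \<comment> \<open>Independence of the chosen preimages: both differences lie in
      \<open>A\<close>, hence so does their sum.\<close>
    have "(s (g x) \<ominus>\<^bsub>X\<^esub> x) \<oplus>\<^bsub>X\<^esub> (s (g y) \<ominus>\<^bsub>X\<^esub> y) \<in> A"
      using s xy g by (intro submodule_add[OF A]) blast+
    also have "(s (g x) \<ominus>\<^bsub>X\<^esub> x) \<oplus>\<^bsub>X\<^esub> (s (g y) \<ominus>\<^bsub>X\<^esub> y) = (s (g x) \<oplus>\<^bsub>X\<^esub> s (g y)) \<ominus>\<^bsub>X\<^esub> (x \<oplus>\<^bsub>X\<^esub> y)"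
      using s xy by (simp add: a_minus_def X.M.minus_add X.M.a_ac)
    finally show ?thesis using g s xy by simp
  qed
  have sm: "g (a \<odot>\<^bsub>X\<^esub> s (g x)) = g (a \<odot>\<^bsub>X\<^esub> x)" if "x \<in> carrier X" "a \<in> carrier R" for x a
  proof -
    have "a \<odot>\<^bsub>X\<^esub> (s (g x) \<ominus>\<^bsub>X\<^esub> x) \<in> A"
      using s that g by (intro submodule_smult[OF A]) blast+
    also have "a \<odot>\<^bsub>X\<^esub> (s (g x) \<ominus>\<^bsub>X\<^esub> x) = a \<odot>\<^bsub>X\<^esub> s (g x) \<ominus>\<^bsub>X\<^esub> a \<odot>\<^bsub>X\<^esub> x"
      using s that by (simp add: a_minus_def X.smult_r_distr X.smult_r_minus)
    finally show ?thesis using g s that X.smult_closed by simp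
  qed
  have ab: "abelian_group Z"
  proof (rule abelian_groupI)
    fix u assume "u \<in> carrier Z"
    then obtain x where x: "x \<in> carrier X" "u = g x" by (auto simp: Z_def)
    then show "\<exists>v\<in>carrier Z. v \<oplus>\<^bsub>Z\<^esub> u = \<zero>\<^bsub>Z\<^esub>"
      using add[of "\<ominus>\<^bsub>X\<^esub> x" x] X.M.l_neg by (intro bexI[of _ "g (\<ominus>\<^bsub>X\<^esub> x)"]) (auto simp: Z_def)
  qed (auto simp: Z_def add X.M.a_assoc s intro: X.M.a_comm[THEN arg_cong])
  have "right_module R Z"
    by (intro right_module.intro right_module_axioms.intro ab X.R.ring_axioms)
       (auto simp: Z_def sm add X.smult_closed X.smult_l_distr X.smult_r_distr X.smult_assoc
         X.smult_one)
  moreover have "g \<in> rmod_epi R X Z"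
    by (auto simp: rmod_epi_def rmod_hom_def Z_def add sm)
  ultimately show ?thesis using that by blast
qed

text \<open>The case \<open>A = 0\<close> of the preceding construction, used to copy a module along
  an injection into another type.\<close>

lemma transport_rmod:
  assumes "right_module R X" "inj_on g (carrier X)"
  obtains Z where "right_module R Z" "g \<in> rmod_hom R X Z" "bij_betw g (carrier X) (carrier Z)"
proof -
  interpret X: right_module R X by fact
  have "g x = g y \<longleftrightarrow> x \<ominus>\<^bsub>X\<^esub> y \<in> {\<zero>\<^bsub>X\<^esub>}" if "x \<in> carrier X" "y \<in> carrier X" for x y
    using that assms(2) X.minus_eq_zero_iff by (auto simp: inj_on_def)
  from quotient_realization[OF assms(1) X.submodule_zero_set this]
  obtain Z where "right_module R Z" "g \<in> rmod_epi R X Z" by blast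
  then show ?thesis using that assms(2) by (auto simp: rmod_epi_def bij_betw_def)
qed

text \<open>Connects the coset model with the fibre condition of
  \<open>quotient_realization\<close>. From here on \<open>quot_rmod\<close> enters only through its
  projection and the fibres of that projection.\<close>

lemma quot_rmod_epi:
  assumes "right_module R X" and A: "submodule A R X"
  shows "a_r_coset X A \<in> rmod_epi R X (quot_rmod X A)"
    and "\<And>x y. x \<in> carrier X \<Longrightarrow> y \<in> carrier X \<Longrightarrow>
      a_r_coset X A x = a_r_coset X A y \<longleftrightarrow> x \<ominus>\<^bsub>X\<^esub> y \<in> A"
proof -
  interpret X: right_module R X by fact
  have sg: "subgroup A (add_monoid X)" using A by (simp add: submodule_def)
  interpret A: abelian_subgroup A X
    by (rule abelian_subgroupI3) (auto intro: sg additive_subgroup.intro X.M.abelian_group_axioms)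
  have sub: "a_r_coset X A x \<subseteq> a_r_coset X A y"
    if "x \<in> carrier X" "y \<in> carrier X" "x \<ominus>\<^bsub>X\<^esub> y \<in> A" for x y
  proof
    fix u assume "u \<in> a_r_coset X A x"
    then obtain k where k: "k \<in> A" "u = k \<oplus>\<^bsub>X\<^esub> x" by (auto simp: a_r_coset_def')
    have "x = (x \<ominus>\<^bsub>X\<^esub> y) \<oplus>\<^bsub>X\<^esub> y"
      using that by (simp add: a_minus_def X.M.a_assoc X.M.l_neg)
    then have "u = (k \<oplus>\<^bsub>X\<^esub> (x \<ominus>\<^bsub>X\<^esub> y)) \<oplus>\<^bsub>X\<^esub> y"
      using k that submodule_mem[OF A] by (metis X.M.a_assoc)
    then show "u \<in> a_r_coset X A y"
      using submodule_add[OF A k(1) that(3)] by (auto simp: a_r_coset_def')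
  qed
  show eq: "a_r_coset X A x = a_r_coset X A y \<longleftrightarrow> x \<ominus>\<^bsub>X\<^esub> y \<in> A"
    if xy: "x \<in> carrier X" "y \<in> carrier X" for x y
  proof
    assume "a_r_coset X A x = a_r_coset X A y"
    then have "x \<in> a_r_coset X A y" using A.a_rcos_self xy by blast
    then obtain k where "k \<in> A" "x = k \<oplus>\<^bsub>X\<^esub> y" by (auto simp: a_r_coset_def')
    then show "x \<ominus>\<^bsub>X\<^esub> y \<in> A"
      using xy submodule_mem[OF A] by (simp add: a_minus_def X.M.a_assoc X.M.r_neg)
  next
    assume *: "x \<ominus>\<^bsub>X\<^esub> y \<in> A"
    have "y \<ominus>\<^bsub>X\<^esub> x = \<ominus>\<^bsub>X\<^esub> (x \<ominus>\<^bsub>X\<^esub> y)"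
      using xy by (simp add: a_minus_def X.M.minus_add X.M.a_comm)
    then have "y \<ominus>\<^bsub>X\<^esub> x \<in> A" using submodule_minus[OF A *] by simp
    with * show "a_r_coset X A x = a_r_coset X A y" using sub xy by blast
  qed
  have "(\<Union>z\<in>a_r_coset X A x. a_r_coset X A (a \<odot>\<^bsub>X\<^esub> z)) = a_r_coset X A (a \<odot>\<^bsub>X\<^esub> x)"
    if "x \<in> carrier X" "a \<in> carrier R" for x a
  proof -
    have "a_r_coset X A (a \<odot>\<^bsub>X\<^esub> z) = a_r_coset X A (a \<odot>\<^bsub>X\<^esub> x)" if z: "z \<in> a_r_coset X A x" for z
    proof -
      have zc: "z \<in> carrier X"
        using z \<open>x \<in> carrier X\<close> submodule_mem[OF A] by (auto simp: a_r_coset_def')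
      have "z \<ominus>\<^bsub>X\<^esub> x \<in> A"
        using z \<open>x \<in> carrier X\<close> submodule_mem[OF A]
        by (auto simp: a_r_coset_def' a_minus_def X.M.a_assoc X.M.r_neg)
      then have "a \<odot>\<^bsub>X\<^esub> (z \<ominus>\<^bsub>X\<^esub> x) \<in> A" using \<open>a \<in> carrier R\<close> submodule_smult[OF A] by blast
      also have "a \<odot>\<^bsub>X\<^esub> (z \<ominus>\<^bsub>X\<^esub> x) = a \<odot>\<^bsub>X\<^esub> z \<ominus>\<^bsub>X\<^esub> a \<odot>\<^bsub>X\<^esub> x"
        using zc \<open>x \<in> carrier X\<close> \<open>a \<in> carrier R\<close>
        by (simp add: a_minus_def X.smult_r_distr X.smult_r_minus)
      finally show ?thesis
        using eq zc \<open>x \<in> carrier X\<close> \<open>a \<in> carrier R\<close> X.smult_closed by simp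
    qed
    moreover have "x \<in> a_r_coset X A x" using A.a_rcos_self that by blast
    ultimately show ?thesis by blast
  qed
  then show "a_r_coset X A \<in> rmod_epi R X (quot_rmod X A)"
    by (auto simp: rmod_epi_def rmod_hom_def quot_rmod_def A_RCOSETS_def' A.a_rcos_sum)
qed

section \<open>Torsion classes and their Gabriel filters\<close>

lemma rmod_epi_ex: "h \<in> rmod_epi R M N \<Longrightarrow> y \<in> carrier N \<Longrightarrow> \<exists>x. x \<in> carrier M \<and> h x = y"
  by (metis rmod_epi_surj)

text \<open>A model of \<open>X/A\<close> in an arbitrary type, given by its projection. Torsion
  classes contain only modules over the universe, so \<open>R/A\<close> is represented by such
  models rather than by cosets.\<close>

definition is_quotient :: "('a, 'r) ring_scheme \<Rightarrow> ('a, 'm) module \<Rightarrow> 'm set \<Rightarrow>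
    ('a, 'n) module \<Rightarrow> ('m \<Rightarrow> 'n) \<Rightarrow> bool" where
  "is_quotient R X A Z \<pi> \<longleftrightarrow> right_module R Z \<and> \<pi> \<in> rmod_epi R X Z \<and>
     (\<forall>x\<in>carrier X. \<pi> x = \<zero>\<^bsub>Z\<^esub> \<longleftrightarrow> x \<in> A)"

lemma is_quotientD:
  assumes "is_quotient R X A Z \<pi>"
  shows "right_module R Z" "\<pi> \<in> rmod_epi R X Z" "\<pi> \<in> rmod_hom R X Z"
    "\<And>x. x \<in> carrier X \<Longrightarrow> \<pi> x = \<zero>\<^bsub>Z\<^esub> \<longleftrightarrow> x \<in> A"
proof -
  note a = assms[unfolded is_quotient_def]
  note q = conjunct1[OF a] conjunct1[OF conjunct2[OF a]] conjunct2[OF conjunct2[OF a]]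
  show "right_module R Z" "\<pi> \<in> rmod_epi R X Z" "\<pi> \<in> rmod_hom R X Z"
    by (rule q(1), rule q(2), rule rmod_epiD[OF q(2)])
  show "\<And>x. x \<in> carrier X \<Longrightarrow> \<pi> x = \<zero>\<^bsub>Z\<^esub> \<longleftrightarrow> x \<in> A"
    using q(3) by (rule bspec)
qed

lemma is_quotient_fibre:
  assumes "right_module R X" "is_quotient R X A Z \<pi>" "x \<in> carrier X" "y \<in> carrier X"
  shows "\<pi> x = \<pi> y \<longleftrightarrow> x \<ominus>\<^bsub>X\<^esub> y \<in> A"
proof -
  interpret X: right_module R X by fact
  note q = is_quotientD[OF assms(2)]
  interpret Z: right_module R Z by (rule q)
  have "\<pi> (x \<ominus>\<^bsub>X\<^esub> y) = \<pi> x \<ominus>\<^bsub>Z\<^esub> \<pi> y"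
    by (rule rmod_hom_diff[OF assms(1) q(1,3) assms(3,4)])
  then show ?thesis
    using q(4)[of "x \<ominus>\<^bsub>X\<^esub> y"] assms(3,4) Z.minus_eq_zero_iff rmod_hom_closed[OF q(3)] by auto
qed

lemma is_quotient_hom:
  assumes "right_module R X" "right_module R Y" "is_quotient R X A Z \<pi>"
    and f: "f \<in> rmod_hom R X Y" and "\<And>x. x \<in> carrier X \<Longrightarrow> x \<in> A \<Longrightarrow> f x = \<zero>\<^bsub>Y\<^esub>"
  obtains h where "h \<in> rmod_hom R Z Y" "\<And>x. x \<in> carrier X \<Longrightarrow> h (\<pi> x) = f x"
proof -
  interpret X: right_module R X by fact
  interpret Y: right_module R Y by fact
  have "f x = f y" if "x \<in> carrier X" "y \<in> carrier X" "\<pi> x = \<pi> y" for x y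
  proof -
    have "f x \<ominus>\<^bsub>Y\<^esub> f y = \<zero>\<^bsub>Y\<^esub>"
      using that is_quotient_fibre[OF assms(1,3)] assms(5)[of "x \<ominus>\<^bsub>X\<^esub> y"]
        rmod_hom_diff[OF assms(1,2) f] by simp
    then show ?thesis using Y.minus_eq_zero_iff that rmod_hom_closed[OF f] by blast
  qed
  from rmod_hom_factor[OF assms(1) is_quotientD(2)[OF assms(3)] f this]
  show ?thesis using that by blast
qed

text \<open>With \<open>f\<close> the map \<open>r \<mapsto> n r\<close> and \<open>A\<close> the
  annihilator of \<open>n\<close>, this embeds \<open>R/A\<close> as the cyclic module
  \<open>nR\<close>, so that closure of torsion classes under submodules applies.\<close>

lemma is_quotient_mono:
  assumes "right_module R X" "right_module R Y" "is_quotient R X A Z \<pi>"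
    and f: "f \<in> rmod_hom R X Y" and f0: "\<And>x. x \<in> carrier X \<Longrightarrow> f x = \<zero>\<^bsub>Y\<^esub> \<longleftrightarrow> x \<in> A"
  obtains h where "h \<in> rmod_mono R Z Y" "\<And>x. x \<in> carrier X \<Longrightarrow> h (\<pi> x) = f x"
proof -
  obtain h where h: "h \<in> rmod_hom R Z Y" "\<And>x. x \<in> carrier X \<Longrightarrow> h (\<pi> x) = f x"
    by (rule is_quotient_hom[OF assms(1-4)]) (use f0 in auto)
  note q = is_quotientD[OF assms(3)]
  have "z = \<zero>\<^bsub>Z\<^esub>" if z: "z \<in> carrier Z" "h z = \<zero>\<^bsub>Y\<^esub>" for z
  proof -
    obtain x where "x \<in> carrier X" "\<pi> x = z" using rmod_epi_ex[OF q(2) z(1)] by blast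
    then show ?thesis using h(2)[of x] f0[of x] q(4)[of x] z by simp
  qed
  then have "h \<in> rmod_mono R Z Y"
    using rmod_hom_inj_iff[OF q(1) assms(2) h(1)] h(1) by (auto simp: rmod_mono_def)
  with h show ?thesis using that by blast
qed

lemma is_quotientI:
  assumes "right_module R X" "submodule A R X"
    and g: "\<And>x y. x \<in> carrier X \<Longrightarrow> y \<in> carrier X \<Longrightarrow> g x = g y \<longleftrightarrow> x \<ominus>\<^bsub>X\<^esub> y \<in> A"
  obtains Z where "is_quotient R X A Z g"
proof -
  interpret X: right_module R X by fact
  obtain Z where Z: "right_module R Z" "g \<in> rmod_epi R X Z"
    using quotient_realization[OF assms] by blast
  have m: "\<ominus>\<^bsub>X\<^esub> \<zero>\<^bsub>X\<^esub> = \<zero>\<^bsub>X\<^esub>"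
    by (rule X.M.minus_equality) auto
  have "g x = \<zero>\<^bsub>Z\<^esub> \<longleftrightarrow> x \<in> A" if x: "x \<in> carrier X" for x
  proof -
    have "x \<ominus>\<^bsub>X\<^esub> \<zero>\<^bsub>X\<^esub> = x"
      unfolding a_minus_def m using x by (rule X.M.r_zero)
    then show ?thesis
      using rmod_hom_zero[OF assms(1) Z(1) rmod_epiD[OF Z(2)]] g[OF x X.M.zero_closed] by simp
  qed
  with Z show ?thesis using that by (auto simp: is_quotient_def)
qed

section \<open>Right ideals with torsion quotient\<close>

lemma torsion_classD:
  assumes "torsion_class R T"
  shows "X \<in> T \<Longrightarrow> right_module R X"
    and "right_module R X \<Longrightarrow> Y \<in> T \<Longrightarrow> f \<in> rmod_mono R X Y \<Longrightarrow> X \<in> T"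
    and "right_module R Y \<Longrightarrow> X \<in> T \<Longrightarrow> f \<in> rmod_epi R X Y \<Longrightarrow> Y \<in> T"
    and "right_module R Y \<Longrightarrow> X \<in> T \<Longrightarrow> Z \<in> T \<Longrightarrow> f \<in> rmod_mono R X Y \<Longrightarrow> g \<in> rmod_epi R Y Z \<Longrightarrow>
      a_kernel Y Z g = f ` carrier X \<Longrightarrow> Y \<in> T"
proof -
  note t = assms[unfolded torsion_class_def]
  show "X \<in> T \<Longrightarrow> right_module R X" using t by auto
  have "\<forall>X Y. right_module R X \<longrightarrow> Y \<in> T \<longrightarrow> rmod_mono R X Y \<noteq> {} \<longrightarrow> X \<in> T"
    using t by (elim conjE)
  then show "right_module R X \<Longrightarrow> Y \<in> T \<Longrightarrow> f \<in> rmod_mono R X Y \<Longrightarrow> X \<in> T"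
    by auto
  have "\<forall>X Y. right_module R Y \<longrightarrow> X \<in> T \<longrightarrow> rmod_epi R X Y \<noteq> {} \<longrightarrow> Y \<in> T"
    using t by (elim conjE)
  then show "right_module R Y \<Longrightarrow> X \<in> T \<Longrightarrow> f \<in> rmod_epi R X Y \<Longrightarrow> Y \<in> T"
    by auto
  have "\<forall>X Y Z. right_module R Y \<longrightarrow> X \<in> T \<longrightarrow> Z \<in> T \<longrightarrow>
        (\<exists>f \<in> rmod_mono R X Y. \<exists>g \<in> rmod_epi R Y Z. a_kernel Y Z g = f ` carrier X) \<longrightarrow> Y \<in> T"
    using t by (elim conjE)
  note e = this[rule_format, of Y X Z]
  show "right_module R Y \<Longrightarrow> X \<in> T \<Longrightarrow> Z \<in> T \<Longrightarrow> f \<in> rmod_mono R X Y \<Longrightarrow> g \<in> rmod_epi R Y Z \<Longrightarrow>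
      a_kernel Y Z g = f ` carrier X \<Longrightarrow> Y \<in> T"
    by (rule e) (assumption | rule bexI)+
qed

text \<open>The Gabriel filter (or topology) of \<open>T\<close>; its members are the possible
  domains of fractions of the regular module.\<close>

definition gabriel :: "('a, 'r) ring_scheme \<Rightarrow> ('a, 'u) module set \<Rightarrow> 'a set set" where
  "gabriel R T = {A. submodule A R (regular_rmod R) \<and>
     belongs_to R T (quot_rmod (regular_rmod R) A)}"

text \<open>The right ideal \<open>(A : x)\<close>, the annihilator of the coset of \<open>x\<close>
  in \<open>R/A\<close>.\<close>

definition colon :: "('a, 'r) ring_scheme \<Rightarrow> 'a set \<Rightarrow> 'a \<Rightarrow> 'a set" where
  "colon R A x = {r \<in> carrier R. x \<otimes>\<^bsub>R\<^esub> r \<in> A}"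

definition adjoin :: "('a, 'r) ring_scheme \<Rightarrow> 'a set \<Rightarrow> 'a \<Rightarrow> 'a set" where
  "adjoin R A x = {a \<oplus>\<^bsub>R\<^esub> x \<otimes>\<^bsub>R\<^esub> r | a r. a \<in> A \<and> r \<in> carrier R}"

abbreviation right_ideal :: "'a set \<Rightarrow> ('a, 'r) ring_scheme \<Rightarrow> bool" where
  "right_ideal A R \<equiv> submodule A R (regular_rmod R)"

context ring
begin

lemma right_idealI:
  assumes "A \<subseteq> carrier R" "\<zero> \<in> A" "\<And>x y. x \<in> A \<Longrightarrow> y \<in> A \<Longrightarrow> x \<oplus> y \<in> A"
    and "\<And>x r. x \<in> A \<Longrightarrow> r \<in> carrier R \<Longrightarrow> x \<otimes> r \<in> A"
  shows "right_ideal A R"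
  by (rule right_module.submoduleI[OF right_module_regular]) (use assms in auto)

lemma right_ideal_mem: "right_ideal A R \<Longrightarrow> x \<in> A \<Longrightarrow> x \<in> carrier R"
  using submodule_mem by fastforce

lemma right_ideal_zero: "right_ideal A R \<Longrightarrow> \<zero> \<in> A"
  using submodule_zero by fastforce

lemma right_ideal_add: "right_ideal A R \<Longrightarrow> x \<in> A \<Longrightarrow> y \<in> A \<Longrightarrow> x \<oplus> y \<in> A"
  using submodule_add by fastforce

lemma right_ideal_mult: "right_ideal A R \<Longrightarrow> x \<in> A \<Longrightarrow> r \<in> carrier R \<Longrightarrow> x \<otimes> r \<in> A"
  using submodule_smult by fastforce

lemma a_minus_regular: "x \<in> carrier R \<Longrightarrow> y \<in> carrier R \<Longrightarrow> x \<ominus>\<^bsub>regular_rmod R\<^esub> y = x \<ominus> y"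
  by (simp add: a_minus_def a_inv_def m_inv_def)

lemma right_ideal_carrier: "right_ideal (carrier R) R"
  by (rule right_idealI) auto

lemma right_ideal_zero_set: "right_ideal {\<zero>} R"
  by (rule right_idealI) auto

lemma right_ideal_Int: "right_ideal A R \<Longrightarrow> right_ideal B R \<Longrightarrow> right_ideal (A \<inter> B) R"
  using right_module.submodule_Int[OF right_module_regular] .

lemma right_ideal_eq_carrier: "right_ideal A R \<Longrightarrow> \<one> \<in> A \<Longrightarrow> A = carrier R"
  using right_ideal_mult[of A \<one>] right_ideal_mem by fastforce

lemma right_ideal_colon:
  assumes A: "right_ideal A R" and x: "x \<in> carrier R"
  shows "right_ideal (colon R A x) R"
proof (rule right_idealI)
  fix y r assume "y \<in> colon R A x" "r \<in> carrier R"
  then show "y \<otimes> r \<in> colon R A x"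
    using right_ideal_mult[OF A, of "x \<otimes> y" r] x by (auto simp: colon_def m_assoc)
qed (use right_ideal_zero[OF A] right_ideal_add[OF A] x in \<open>auto simp: colon_def r_distr\<close>)

lemma adjoinI: "a \<in> A \<Longrightarrow> r \<in> carrier R \<Longrightarrow> a \<oplus> x \<otimes> r \<in> adjoin R A x"
  by (auto simp: adjoin_def)

lemma right_ideal_adjoin:
  assumes A: "right_ideal A R" and x: "x \<in> carrier R"
  shows "right_ideal (adjoin R A x) R" "A \<subseteq> adjoin R A x" "x \<in> adjoin R A x"
proof -
  show "A \<subseteq> adjoin R A x"
  proof
    fix a assume "a \<in> A"
    then show "a \<in> adjoin R A x"
      using adjoinI[of a A \<zero> x] right_ideal_mem[OF A] x by simp
  qed
  show "x \<in> adjoin R A x"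
    using adjoinI[of \<zero> A \<one> x] right_ideal_zero[OF A] x by simp
  have "adjoin R A x = {u \<oplus> v | u v. u \<in> A \<and> v \<in> (\<lambda>r. x \<otimes> r) ` carrier R}"
    by (auto simp: adjoin_def)
  moreover have "right_ideal ((\<lambda>r. x \<otimes> r) ` carrier R) R"
    using right_module.submodule_cyclic[OF right_module_regular, of x] x by simp
  ultimately show "right_ideal (adjoin R A x) R"
    using right_module.submodule_sum[OF right_module_regular A] by simp
qed

lemma mult_left_hom:
  assumes "x \<in> carrier R"
  shows "(\<lambda>r. x \<otimes> r) \<in> rmod_hom R (regular_rmod R) (regular_rmod R)"
  using assms by (intro rmod_homI) (auto simp: r_distr m_assoc)

text \<open>Torsion classes are closed under isomorphism, so the coset model in
  \<open>gabriel\<close> may be exchanged for any model \<open>Z\<close> in the universe. From the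
  torsion copy \<open>Z'\<close> to \<open>Z\<close> an epimorphism is enough, by closure under
  quotients.\<close>

lemma gabriel_iff:
  assumes A: "right_ideal A R" and Z: "is_quotient R (regular_rmod R) A Z \<pi>" and T: "torsion_class R T"
  shows "A \<in> gabriel R T \<longleftrightarrow> Z \<in> T"
proof -
  let ?S = "regular_rmod R" and ?c = "a_r_coset (regular_rmod R) A"
  note S = right_module_regular
  note q = is_quotientD[OF Z]
  note c = quot_rmod_epi[OF S A]
  have fib: "\<pi> x = \<pi> y \<longleftrightarrow> ?c x = ?c y" if "x \<in> carrier ?S" "y \<in> carrier ?S" for x y
    using that is_quotient_fibre[OF S Z] c(2) by blast
  show ?thesis
  proof
    assume "A \<in> gabriel R T"
    then obtain Z' h where Z': "Z' \<in> T" "h \<in> rmod_hom R Z' (quot_rmod ?S A)"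
      "bij_betw h (carrier Z') (carrier (quot_rmod ?S A))"
      by (auto simp: gabriel_def belongs_to_def rmod_iso_def)
    have h: "h \<in> rmod_epi R Z' (quot_rmod ?S A)"
      using Z' by (auto simp: rmod_epi_def bij_betw_def)
    obtain k where k: "k \<in> rmod_hom R (quot_rmod ?S A) Z" "\<And>x. x \<in> carrier ?S \<Longrightarrow> k (?c x) = \<pi> x"
      using rmod_hom_factor[OF S c(1) q(3)] fib by blast
    have "k \<in> rmod_epi R (quot_rmod ?S A) Z"
      using rmod_epi_cancel[OF k(1) rmod_epiD[OF c(1)] q(2) k(2)] .
    from rmod_epi_comp[OF h this] show "Z \<in> T"
      using torsion_classD(3)[OF T q(1) Z'(1)] by blast
  next
    assume "Z \<in> T"
    obtain k where k: "k \<in> rmod_hom R Z (quot_rmod ?S A)" "\<And>x. x \<in> carrier ?S \<Longrightarrow> k (\<pi> x) = ?c x"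
      using rmod_hom_factor[OF S q(2) rmod_epiD[OF c(1)]] fib by blast
    have "bij_betw k (carrier Z) (carrier (quot_rmod ?S A))"
    proof (rule bij_betwI')
      fix z w assume "z \<in> carrier Z" "w \<in> carrier Z"
      then obtain x y where "x \<in> carrier ?S" "\<pi> x = z" "y \<in> carrier ?S" "\<pi> y = w"
        using rmod_epi_ex[OF q(2)] by blast
      then show "k z = k w \<longleftrightarrow> z = w" using k(2) fib by metis
    next
      fix w assume "w \<in> carrier (quot_rmod ?S A)"
      then obtain x where "x \<in> carrier ?S" "?c x = w" using rmod_epi_ex[OF c(1)] by blast
      then show "\<exists>z\<in>carrier Z. w = k z"
        using k(2) rmod_hom_closed[OF q(3)] by (intro bexI[of _ "\<pi> x"]) auto
    qed (use rmod_hom_closed[OF k(1)] in auto)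
    then show "A \<in> gabriel R T"
      using A \<open>Z \<in> T\<close> k(1) by (auto simp: gabriel_def belongs_to_def rmod_iso_def)
  qed
qed

end

locale universe_ring = ring R for R :: "('a, 'r) ring_scheme" (structure) +
  fixes U :: "'u itself"
  assumes adequate: "adequate_universe R U"
begin

abbreviation S where "S \<equiv> regular_rmod R"

text \<open>A coset is a subset of \<open>R\<close>, so there are few enough of them to be coded in
  the universe.\<close>

lemma cyclic_realization:
  assumes A: "right_ideal A R"
  obtains Z :: "('a, 'u) module" and \<pi> where "is_quotient R S A Z \<pi>"
proof -
  obtain code :: "'a list set \<Rightarrow> 'u" where code: "inj_on code (Pow (lists (carrier R)))"
    using adequate by (auto simp: adequate_universe_def)
  let ?c = "a_r_coset S A"
  \<comment> \<open>\<open>code\<close> expects sets of words; an element of \<open>R\<close>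
    becomes a word of length one.\<close>
  let ?g = "\<lambda>x. code ((\<lambda>y. [y]) ` ?c x)"
  have "?g x = ?g y \<longleftrightarrow> x \<ominus>\<^bsub>S\<^esub> y \<in> A" if "x \<in> carrier S" "y \<in> carrier S" for x y
  proof -
    have c: "?c z \<subseteq> carrier R" if "z \<in> carrier R" for z
      using that right_ideal_mem[OF A] by (auto simp: a_r_coset_def')
    have "(\<lambda>y. [y]) ` ?c z \<in> Pow (lists (carrier R))" if "z \<in> carrier R" for z
      using c[OF that] by auto
    then have "?g x = ?g y \<longleftrightarrow> (\<lambda>y. [y]) ` ?c x = (\<lambda>y. [y]) ` ?c y"
      using that by (intro inj_on_eq_iff[OF code]) auto
    also have "\<dots> \<longleftrightarrow> ?c x = ?c y" by (intro inj_image_eq_iff) (simp add: inj_def)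
    finally show ?thesis using quot_rmod_epi(2)[OF right_module_regular A] that by simp
  qed
  from is_quotientI[OF right_module_regular A this] show ?thesis using that by blast
qed

context
  fixes T :: "('a, 'u) module set"
  assumes T: "torsion_class R T"
begin

lemma gabriel_right_ideal: "A \<in> gabriel R T \<Longrightarrow> right_ideal A R"
  by (simp add: gabriel_def)

text \<open>\<open>R/B\<close> is a quotient of the torsion module \<open>R/A\<close>.\<close>

lemma gabriel_mono:
  assumes A: "A \<in> gabriel R T" and B: "right_ideal B R" and "A \<subseteq> B"
  shows "B \<in> gabriel R T"
proof -
  note S = right_module_regular and A' = gabriel_right_ideal[OF A]
  obtain X :: "('a, 'u) module" and p where X: "is_quotient R S A X p"
    using cyclic_realization[OF A'] .
  obtain Y :: "('a, 'u) module" and q where Y: "is_quotient R S B Y q"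
    using cyclic_realization[OF B] .
  note x = is_quotientD[OF X] and y = is_quotientD[OF Y]
  obtain h where h: "h \<in> rmod_hom R X Y" "\<And>r. r \<in> carrier S \<Longrightarrow> h (p r) = q r"
    using is_quotient_hom[OF S y(1) X y(3)] y(4) \<open>A \<subseteq> B\<close> by blast
  have "h \<in> rmod_epi R X Y"
    using rmod_epi_cancel[OF h(1) x(3) y(2) h(2)] .
  then show ?thesis
    using gabriel_iff[OF A' X T] gabriel_iff[OF B Y T] A torsion_classD(3)[OF T y(1)] by blast
qed

text \<open>The quotient of \<open>R\<close> by the annihilator of \<open>n\<close> embeds in
  \<open>N\<close> as \<open>nR\<close>.\<close>

lemma gabriel_annihilator:
  assumes "N \<in> T" "n \<in> carrier N"
  shows "{r \<in> carrier R. r \<odot>\<^bsub>N\<^esub> n = \<zero>\<^bsub>N\<^esub>} \<in> gabriel R T"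
proof -
  note S = right_module_regular and N = torsion_classD(1)[OF T assms(1)]
  interpret N: right_module R N by (rule N)
  let ?A = "{r \<in> carrier R. r \<odot>\<^bsub>N\<^esub> n = \<zero>\<^bsub>N\<^esub>}"
  have A: "right_ideal ?A R"
    using assms N.smult_r_zero by (intro right_idealI) (auto simp: N.smult_l_distr N.smult_assoc N.smult_l_zero)
  obtain X :: "('a, 'u) module" and p where X: "is_quotient R S ?A X p"
    using cyclic_realization[OF A] .
  obtain h where "h \<in> rmod_mono R X N"
    using is_quotient_mono[OF S N X N.cyclic_hom[OF assms(2)]] by auto
  then show ?thesis
    using gabriel_iff[OF A X T] torsion_classD(2)[OF T is_quotientD(1)[OF X] assms(1)] by blast
qed

text \<open>\<open>(A : x)\<close> is the annihilator of an element of the torsion module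
  \<open>R/A\<close>.\<close>

lemma gabriel_colon:
  assumes A: "A \<in> gabriel R T" and x: "x \<in> carrier R"
  shows "colon R A x \<in> gabriel R T"
proof -
  note S = right_module_regular and A' = gabriel_right_ideal[OF A]
  obtain X :: "('a, 'u) module" and p where X: "is_quotient R S A X p"
    using cyclic_realization[OF A'] .
  note q = is_quotientD[OF X]
  have "colon R A x = {r \<in> carrier R. r \<odot>\<^bsub>X\<^esub> p x = \<zero>\<^bsub>X\<^esub>}"
  proof -
    have "r \<odot>\<^bsub>X\<^esub> p x = \<zero>\<^bsub>X\<^esub> \<longleftrightarrow> x \<otimes> r \<in> A" if "r \<in> carrier R" for r
      using that x q(4)[of "x \<otimes> r"] rmod_hom_smult[OF q(3), of r x] by simp
    then show ?thesis by (auto simp: colon_def)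
  qed
  then show ?thesis
    using gabriel_annihilator[of X "p x"] gabriel_iff[OF A' X T] A rmod_hom_closed[OF q(3)] x by simp
qed

text \<open>Closure under extensions, applied to the exact sequence \<open>0 \<rightarrow> R/(A : x)
  \<rightarrow> R/A \<rightarrow> R/(A + xR) \<rightarrow> 0\<close>, whose first map is induced by
  left multiplication by \<open>x\<close>.\<close>

lemma gabriel_extension:
  assumes A: "right_ideal A R" and x: "x \<in> carrier R"
    and "adjoin R A x \<in> gabriel R T" "colon R A x \<in> gabriel R T"
  shows "A \<in> gabriel R T"
proof -
  note S = right_module_regular
  let ?C = "colon R A x" and ?B = "adjoin R A x"
  note C = right_ideal_colon[OF A x] and B = right_ideal_adjoin[OF A x]
  obtain X :: "('a, 'u) module" and p where X: "is_quotient R S ?C X p"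
    using cyclic_realization[OF C] .
  obtain Y :: "('a, 'u) module" and q where Y: "is_quotient R S A Y q"
    using cyclic_realization[OF A] .
  obtain Z :: "('a, 'u) module" and w where Z: "is_quotient R S ?B Z w"
    using cyclic_realization[OF B(1)] .
  note X' = is_quotientD[OF X] and Y' = is_quotientD[OF Y] and Z' = is_quotientD[OF Z]
  interpret Y: right_module R Y by (rule Y')
  interpret S: right_module R S by (rule S)
  have "(\<lambda>r. q (x \<otimes> r)) \<in> rmod_hom R S Y"
    using rmod_hom_comp[OF mult_left_hom[OF x] Y'(3)] .
  from is_quotient_mono[OF S Y'(1) X this]
  obtain f where f: "f \<in> rmod_mono R X Y" "\<And>r. r \<in> carrier S \<Longrightarrow> f (p r) = q (x \<otimes> r)"
    using Y'(4) x by (auto simp: colon_def)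
  obtain g where g: "g \<in> rmod_hom R Y Z" "\<And>r. r \<in> carrier S \<Longrightarrow> g (q r) = w r"
    using is_quotient_hom[OF S Z'(1) Y Z'(3)] Z'(4) B(2) by blast
  have ge: "g \<in> rmod_epi R Y Z"
    using rmod_epi_cancel[OF g(1) Y'(3) Z'(2) g(2)] .
  have "a_kernel Y Z g = f ` carrier X"
  proof (intro Set.set_eqI iffI)
    fix y assume "y \<in> a_kernel Y Z g"
    then have y: "y \<in> carrier Y" "g y = \<zero>\<^bsub>Z\<^esub>" by (auto simp: a_kernel_def')
    then obtain r where r: "r \<in> carrier S" "q r = y" using rmod_epi_ex[OF Y'(2)] by blast
    have "r \<in> ?B" using y g(2)[OF r(1)] Z'(4)[OF r(1)] r(2) by simp
    then obtain a s where as: "a \<in> A" "s \<in> carrier R" "r = a \<oplus> x \<otimes> s" by (auto simp: adjoin_def)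
    have "q r = q a \<oplus>\<^bsub>Y\<^esub> q (x \<otimes> s)"
      using rmod_hom_add[OF Y'(3), of a "x \<otimes> s"] as x right_ideal_mem[OF A] by simp
    also have "q a = \<zero>\<^bsub>Y\<^esub>" using as Y'(4) right_ideal_mem[OF A] by simp
    finally have "y = f (p s)"
      using f(2)[of s] as r rmod_hom_closed[OF Y'(3), of "x \<otimes> s"] x by simp
    then show "y \<in> f ` carrier X" using as rmod_hom_closed[OF X'(3)] by simp
  next
    fix y assume "y \<in> f ` carrier X"
    then obtain z where "z \<in> carrier X" "y = f z" by blast
    then obtain r where r: "r \<in> carrier S" "y = f (p r)" using rmod_epi_ex[OF X'(2)] by blast
    then have "g y = w (x \<otimes> r)" "y \<in> carrier Y"
      using f(2) g(2)[of "x \<otimes> r"] x rmod_hom_closed[OF Y'(3), of "x \<otimes> r"] by auto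
    moreover have "x \<otimes> r \<in> ?B"
      using right_ideal_mult[OF B(1,3)] r by simp
    ultimately show "y \<in> a_kernel Y Z g"
      using Z'(4)[of "x \<otimes> r"] x r by (simp add: a_kernel_def')
  qed
  then have "Y \<in> T"
    using torsion_classD(4)[OF T Y'(1) _ _ f(1) ge] gabriel_iff[OF C X T] gabriel_iff[OF B(1) Z T]
      assms by blast
  then show ?thesis using gabriel_iff[OF A Y T] by blast
qed

end

end

section \<open>Torsion classes of modules without nonzero maps to an injective module\<close>

lemma hom_trivialD: "hom_trivial R M N \<Longrightarrow> h \<in> rmod_hom R M N \<Longrightarrow> x \<in> carrier M \<Longrightarrow> h x = \<zero>\<^bsub>N\<^esub>"
  by (simp add: hom_trivial_def)

text \<open>A finitely supported family is a finite sum of its components, and the restriction of a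
  homomorphism to each summand vanishes.\<close>

lemma hom_trivial_direct_sum:
  assumes E: "right_module R E" and F: "\<And>i. i \<in> I \<Longrightarrow> right_module R (F i)"
    and triv: "\<And>i. i \<in> I \<Longrightarrow> hom_trivial R (F i) E"
  shows "hom_trivial R (direct_sum I F) E"
  unfolding hom_trivial_def
proof (intro ballI)
  interpret E: right_module R E by fact
  define D where "D = direct_sum I F"
  fix k x assume k: "k \<in> rmod_hom R (direct_sum I F) E" and x: "x \<in> carrier (direct_sum I F)"
  have ag: "abelian_group (F i)" if "i \<in> I" for i
    using F[OF that] by (simp add: right_module_def)
  have memD: "x \<in> carrier D \<longleftrightarrow> x \<in> (\<Pi>\<^sub>E i\<in>I. carrier (F i)) \<and> finite {i \<in> I. x i \<noteq> \<zero>\<^bsub>F i\<^esub>}" for x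
    by (simp add: D_def direct_sum_def)
  have addD: "x \<oplus>\<^bsub>D\<^esub> y = (\<lambda>i\<in>I. x i \<oplus>\<^bsub>F i\<^esub> y i)" for x y
    by (simp add: D_def direct_sum_def)
  have smD: "a \<odot>\<^bsub>D\<^esub> x = (\<lambda>i\<in>I. a \<odot>\<^bsub>F i\<^esub> x i)" for a x
    by (simp add: D_def direct_sum_def)
  have kD: "k \<in> rmod_hom R D E" using k by (simp add: D_def)
  define single where "single j u = (\<lambda>i\<in>I. if i = j then u else \<zero>\<^bsub>F i\<^esub>)" for j u
  have single_in: "single j u \<in> carrier D" if j: "j \<in> I" "u \<in> carrier (F j)" for j u
  proof -
    have "{i \<in> I. single j u i \<noteq> \<zero>\<^bsub>F i\<^esub>} \<subseteq> {j}" by (auto simp: single_def)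
    then have "finite {i \<in> I. single j u i \<noteq> \<zero>\<^bsub>F i\<^esub>}" by (rule finite_subset) simp
    then show ?thesis
      using j abelian_monoid.zero_closed[OF abelian_group.axioms(1)[OF ag]]
      by (auto simp: memD single_def)
  qed
  have single_0: "k (single j u) = \<zero>\<^bsub>E\<^esub>" if j: "j \<in> I" and u: "u \<in> carrier (F j)" for j u
  proof (rule hom_trivialD[OF triv[OF j] _ u, where h = "\<lambda>u. k (single j u)"], rule rmod_homI)
    fix u v assume uv: "u \<in> carrier (F j)" "v \<in> carrier (F j)"
    have "single j (u \<oplus>\<^bsub>F j\<^esub> v) = single j u \<oplus>\<^bsub>D\<^esub> single j v"
      using abelian_monoid.l_zero[OF abelian_group.axioms(1)[OF ag]]
        abelian_monoid.zero_closed[OF abelian_group.axioms(1)[OF ag]]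
      by (auto simp: addD single_def fun_eq_iff)
    then show "k (single j (u \<oplus>\<^bsub>F j\<^esub> v)) = k (single j u) \<oplus>\<^bsub>E\<^esub> k (single j v)"
      using rmod_hom_add[OF kD] single_in[OF j] uv by simp
  next
    fix a u assume a: "a \<in> carrier R" and u: "u \<in> carrier (F j)"
    have "single j (a \<odot>\<^bsub>F j\<^esub> u) = a \<odot>\<^bsub>D\<^esub> single j u"
      using right_module.smult_r_zero[OF F a] by (auto simp: smD single_def fun_eq_iff)
    then show "k (single j (a \<odot>\<^bsub>F j\<^esub> u)) = a \<odot>\<^bsub>E\<^esub> k (single j u)"
      using rmod_hom_smult[OF kD a] single_in[OF j u] by simp
  qed (use rmod_hom_closed[OF kD] single_in[OF j] in blast)
  \<comment> \<open>\<open>J\<close> only has to contain the support, so that one component can be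
    removed at a time.\<close>
  have "k x = \<zero>\<^bsub>E\<^esub>" if "finite J" "x \<in> carrier D" "{i \<in> I. x i \<noteq> \<zero>\<^bsub>F i\<^esub>} \<subseteq> J" for J x
    using that
  proof (induction J arbitrary: x rule: finite_induct)
    case empty
    have x: "x i = (if i \<in> I then \<zero>\<^bsub>F i\<^esub> else undefined)" for i
      using empty by (auto simp: memD PiE_def extensional_def)
    \<comment> \<open>From \<open>x + x = x\<close> follows \<open>k x = 0\<close>, without appeal
      to module axioms for the direct sum.\<close>
    have xx: "x \<oplus>\<^bsub>D\<^esub> x = x"
      using abelian_monoid.l_zero[OF abelian_group.axioms(1)[OF ag]]
        abelian_monoid.zero_closed[OF abelian_group.axioms(1)[OF ag]]
      by (auto simp: addD fun_eq_iff x)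
    have "k x \<oplus>\<^bsub>E\<^esub> k x = k x"
      using rmod_hom_add[OF kD empty(1,1)] unfolding xx by (rule sym)
    then show ?case
      using rmod_hom_closed[OF kD empty(1)] E.M.add.l_cancel_one[of "k x" "k x"] by simp
  next
    case (insert j J)
    show ?case
    proof (cases "j \<in> I")
      case False
      then show ?thesis using insert by blast
    next
      case True
      define y where "y = (\<lambda>i\<in>I. if i = j then \<zero>\<^bsub>F i\<^esub> else x i)"
      have xi: "x i \<in> carrier (F i)" if "i \<in> I" for i
        using insert.prems(1) that by (auto simp: memD)
      have sub: "{i \<in> I. y i \<noteq> \<zero>\<^bsub>F i\<^esub>} \<subseteq> {i \<in> I. x i \<noteq> \<zero>\<^bsub>F i\<^esub>}" "{i \<in> I. y i \<noteq> \<zero>\<^bsub>F i\<^esub>} \<subseteq> J"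
        using insert.prems(2) by (auto simp: y_def split: if_splits)
      have "finite {i \<in> I. x i \<noteq> \<zero>\<^bsub>F i\<^esub>}" using insert.prems(1) by (simp add: memD)
      then have "finite {i \<in> I. y i \<noteq> \<zero>\<^bsub>F i\<^esub>}" by (rule finite_subset[OF sub(1)])
      moreover have "y \<in> (\<Pi>\<^sub>E i\<in>I. carrier (F i))"
        using xi abelian_monoid.zero_closed[OF abelian_group.axioms(1)[OF ag]] by (simp add: y_def)
      ultimately have yD: "y \<in> carrier D" by (simp add: memD)
      have "x \<in> extensional I" using insert.prems(1) by (simp add: memD PiE_def)
      then have "x = single j (x j) \<oplus>\<^bsub>D\<^esub> y"
        using xi abelian_monoid.l_zero[OF abelian_group.axioms(1)[OF ag]]
          abelian_monoid.r_zero[OF abelian_group.axioms(1)[OF ag]]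
        by (auto simp: addD single_def y_def fun_eq_iff extensional_def)
      then have "k x = k (single j (x j)) \<oplus>\<^bsub>E\<^esub> k y"
        using rmod_hom_add[OF kD single_in[OF True xi[OF True]] yD] by metis
      also have "k y = \<zero>\<^bsub>E\<^esub>" using insert.IH[OF yD sub(2)] .
      finally show ?thesis using single_0[OF True xi[OF True]] by simp
    qed
  qed
  from this[of "{i \<in> I. x i \<noteq> \<zero>\<^bsub>F i\<^esub>}" x] show "k x = \<zero>\<^bsub>E\<^esub>"
    using x by (simp add: D_def[symmetric] memD)
qed

lemma torsion_classI:
  assumes "\<And>X. X \<in> T \<Longrightarrow> right_module R X"
    and "\<And>X Y f. right_module R X \<Longrightarrow> Y \<in> T \<Longrightarrow> f \<in> rmod_mono R X Y \<Longrightarrow> X \<in> T"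
    and "\<And>X Y f. right_module R Y \<Longrightarrow> X \<in> T \<Longrightarrow> f \<in> rmod_epi R X Y \<Longrightarrow> Y \<in> T"
    and "\<And>X Y Z f g. right_module R Y \<Longrightarrow> X \<in> T \<Longrightarrow> Z \<in> T \<Longrightarrow> f \<in> rmod_mono R X Y \<Longrightarrow>
      g \<in> rmod_epi R Y Z \<Longrightarrow> a_kernel Y Z g = f ` carrier X \<Longrightarrow> Y \<in> T"
    and "\<And>(I :: 'u set) F Y. (\<And>i. i \<in> I \<Longrightarrow> F i \<in> T) \<Longrightarrow> right_module R Y \<Longrightarrow>
      rmod_iso R (direct_sum I F) Y \<Longrightarrow> Y \<in> T"
  shows "torsion_class R (T :: ('a, 'u) module set)"
  unfolding torsion_class_def
proof (intro conjI allI impI)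
  show "T \<subseteq> {X. right_module R X}" using assms(1) by (rule subsetI[OF CollectI])
next
  fix X Y :: "('a, 'u) module" assume *: "right_module R X" "Y \<in> T" "rmod_mono R X Y \<noteq> {}"
  from *(3) obtain f where f: "f \<in> rmod_mono R X Y" by auto
  show "X \<in> T" by (rule assms(2)[OF *(1,2) f])
next
  fix X Y :: "('a, 'u) module" assume *: "right_module R Y" "X \<in> T" "rmod_epi R X Y \<noteq> {}"
  from *(3) obtain f where f: "f \<in> rmod_epi R X Y" by auto
  show "Y \<in> T" by (rule assms(3)[OF *(1,2) f])
next
  fix X Y Z :: "('a, 'u) module"
  assume *: "right_module R Y" "X \<in> T" "Z \<in> T"
    "\<exists>f\<in>rmod_mono R X Y. \<exists>g\<in>rmod_epi R Y Z. a_kernel Y Z g = f ` carrier X"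
  from *(4) obtain f g where fg: "f \<in> rmod_mono R X Y" "g \<in> rmod_epi R Y Z" "a_kernel Y Z g = f ` carrier X"
    by (elim bexE)
  show "Y \<in> T" by (rule assms(4)[OF *(1-3) fg])
next
  fix I :: "'u set" and F and Y :: "('a, 'u) module"
  assume *: "\<forall>i\<in>I. F i \<in> T" "right_module R Y" "rmod_iso R (direct_sum I F) Y"
  show "Y \<in> T" by (rule assms(5)[OF bspec[OF *(1)] *(2,3)])
qed

lemma torsion_class_coproduct:
  fixes I :: "'u set" and T :: "('a, 'u) module set"
  assumes "torsion_class R T" "\<And>i. i \<in> I \<Longrightarrow> F i \<in> T" "right_module R Y" "rmod_iso R (direct_sum I F) Y"
  shows "Y \<in> T"
proof -
  have "\<forall>(I :: 'u set) F Y. (\<forall>i\<in>I. F i \<in> T) \<longrightarrow> right_module R Y \<longrightarrow> rmod_iso R (direct_sum I F) Y \<longrightarrow> Y \<in> T"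
    using assms(1)[unfolded torsion_class_def] by (elim conjE)
  from this[rule_format, of I F Y, OF assms(2-4)] show ?thesis by simp
qed

lemma torsion_class_all: "torsion_class R {X :: ('a, 'u) module. right_module R X}"
  by (rule torsion_classI) simp_all

lemma torsion_class_Inter:
  fixes \<T> :: "('a, 'u) module set set"
  assumes t: "\<And>T. T \<in> \<T> \<Longrightarrow> torsion_class R T" and "\<T> \<noteq> {}"
  shows "torsion_class R (\<Inter>\<T>)"
proof (rule torsion_classI)
  fix X :: "('a, 'u) module" assume "X \<in> \<Inter>\<T>"
  with \<open>\<T> \<noteq> {}\<close> obtain T where "T \<in> \<T>" "X \<in> T" by auto
  then show "right_module R X" using torsion_classD(1)[OF t] by simp
next
  fix X Y :: "('a, 'u) module" and f assume *: "right_module R X" "Y \<in> \<Inter>\<T>" "f \<in> rmod_mono R X Y"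
  show "X \<in> \<Inter>\<T>"
    by (rule InterI, rule torsion_classD(2)[OF t *(1) _ *(3)]) (use * in auto)
next
  fix X Y :: "('a, 'u) module" and f assume *: "right_module R Y" "X \<in> \<Inter>\<T>" "f \<in> rmod_epi R X Y"
  show "Y \<in> \<Inter>\<T>"
    by (rule InterI, rule torsion_classD(3)[OF t *(1) _ *(3)]) (use * in auto)
next
  fix X Y Z :: "('a, 'u) module" and f g
  assume *: "right_module R Y" "X \<in> \<Inter>\<T>" "Z \<in> \<Inter>\<T>" "f \<in> rmod_mono R X Y" "g \<in> rmod_epi R Y Z"
    "a_kernel Y Z g = f ` carrier X"
  show "Y \<in> \<Inter>\<T>"
    by (rule InterI, rule torsion_classD(4)[OF t *(1) _ _ *(4-6)]) (use * in auto)
next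
  fix I :: "'u set" and F and Y :: "('a, 'u) module"
  assume *: "\<And>i. i \<in> I \<Longrightarrow> F i \<in> \<Inter>\<T>" "right_module R Y" "rmod_iso R (direct_sum I F) Y"
  show "Y \<in> \<Inter>\<T>"
    by (rule InterI, rule torsion_class_coproduct[OF t _ *(2,3)]) (use * in auto)
qed

lemma torsion_class_generated:
  assumes "right_module R M"
  shows "torsion_class R (generated_torsion_class R M)" "M \<in> generated_torsion_class R M"
proof -
  show "torsion_class R (generated_torsion_class R M)"
    unfolding generated_torsion_class_def
  proof (rule torsion_class_Inter)
    \<comment> \<open>The class of all modules shows that the intersection is not over the empty
      family.\<close>
    have "{X. right_module R X} \<in> {T. torsion_class R T \<and> M \<in> T}"
      using torsion_class_all[of R] assms by simp
    then show "{T. torsion_class R T \<and> M \<in> T} \<noteq> {}" by auto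
  qed simp
  show "M \<in> generated_torsion_class R M" by (simp add: generated_torsion_class_def)
qed

lemma injective_rmod_extend:
  fixes E :: "('a, 'u) module" and A B :: "('a, 'u) module"
  assumes "injective_rmod R E" "right_module R A" "right_module R B"
    and "i \<in> rmod_mono R A B" "f \<in> rmod_hom R A E"
  obtains g where "g \<in> rmod_hom R B E" "\<And>x. x \<in> carrier A \<Longrightarrow> g (i x) = f x"
proof -
  have "\<exists>g\<in>rmod_hom R B E. \<forall>x\<in>carrier A. g (i x) = f x"
    using conjunct2[OF assms(1)[unfolded injective_rmod_def], rule_format, OF assms(2-5)] .
  then show ?thesis using that by auto
qed

text \<open>Injectivity enters through closure under submodules: a map on a submodule extends, and
  the extension is zero. The other closure properties hold for vanishing of maps into any fixed
  module.\<close>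

lemma torsion_class_orthogonal:
  fixes E :: "('a, 'u) module"
  assumes "injective_rmod R E"
  shows "torsion_class R {X :: ('a, 'u) module. right_module R X \<and> hom_trivial R X E}"
proof (rule torsion_classI; (elim CollectE conjE)?; (intro CollectI conjI)?)
  have E: "right_module R E" using assms by (simp add: injective_rmod_def)
  fix X Y :: "('a, 'u) module" and f assume *: "right_module R X" "right_module R Y" "hom_trivial R Y E" "f \<in> rmod_mono R X Y"
  show "hom_trivial R X E"
    unfolding hom_trivial_def
  proof (intro ballI)
    fix h x assume h: "h \<in> rmod_hom R X E" "x \<in> carrier X"
    obtain g where g: "g \<in> rmod_hom R Y E" "\<And>x. x \<in> carrier X \<Longrightarrow> g (f x) = h x"
      using injective_rmod_extend[OF assms *(1,2,4) h(1)] by blast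
    then show "h x = \<zero>\<^bsub>E\<^esub>"
      using hom_trivialD[OF *(3) g(1)] rmod_hom_closed[OF rmod_monoD[OF *(4)] h(2)] h(2) by metis
  qed
next
  fix X Y :: "('a, 'u) module" and f assume *: "right_module R Y" "right_module R X" "hom_trivial R X E" "f \<in> rmod_epi R X Y"
  show "hom_trivial R Y E"
    unfolding hom_trivial_def
  proof (intro ballI)
    fix h y assume h: "h \<in> rmod_hom R Y E" "y \<in> carrier Y"
    obtain x where "x \<in> carrier X" "f x = y" using rmod_epi_ex[OF *(4) h(2)] by blast
    then show "h y = \<zero>\<^bsub>E\<^esub>"
      using hom_trivialD[OF *(3) rmod_hom_comp[OF rmod_epiD[OF *(4)] h(1)]] by metis
  qed
next
  have E: "right_module R E" using assms by (simp add: injective_rmod_def)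
  fix X Y Z :: "('a, 'u) module" and f g
  assume *: "right_module R Y" "f \<in> rmod_mono R X Y" "g \<in> rmod_epi R Y Z"
    "a_kernel Y Z g = f ` carrier X" "right_module R X" "hom_trivial R X E"
    "right_module R Z" "hom_trivial R Z E"
  show "hom_trivial R Y E"
    unfolding hom_trivial_def
  proof (intro ballI)
    fix h y assume h: "h \<in> rmod_hom R Y E" "y \<in> carrier Y"
    \<comment> \<open>Exactness presents \<open>Z\<close> as the quotient of \<open>Y\<close> by the
      image of \<open>X\<close>; a map that kills this image factors through
      \<open>Z\<close>.\<close>
    have q: "is_quotient R Y (f ` carrier X) Z g"
      using *(1,3,7) unfolding is_quotient_def *(4)[symmetric] by (simp add: a_kernel_def')
    have "h (f x) = \<zero>\<^bsub>E\<^esub>" if "x \<in> carrier X" for x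
      using hom_trivialD[OF *(6) rmod_hom_comp[OF rmod_monoD[OF *(2)] h(1)]] that by metis
    then have "\<And>y. y \<in> carrier Y \<Longrightarrow> y \<in> f ` carrier X \<Longrightarrow> h y = \<zero>\<^bsub>E\<^esub>" by auto
    from is_quotient_hom[OF *(1) E q h(1) this]
    obtain k where k: "k \<in> rmod_hom R Z E" "\<And>y. y \<in> carrier Y \<Longrightarrow> k (g y) = h y" by blast
    show "h y = \<zero>\<^bsub>E\<^esub>"
      using hom_trivialD[OF *(8) k(1)] k(2)[OF h(2)] rmod_hom_closed[OF rmod_epiD[OF *(3)] h(2)] by metis
  qed
next
  have E: "right_module R E" using assms by (simp add: injective_rmod_def)
  fix I :: "'u set" and F and Y :: "('a, 'u) module"
  assume *: "\<And>i. i \<in> I \<Longrightarrow> F i \<in> {X. right_module R X \<and> hom_trivial R X E}" "right_module R Y"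
    "rmod_iso R (direct_sum I F) Y"
  obtain p where p: "p \<in> rmod_hom R (direct_sum I F) Y" "bij_betw p (carrier (direct_sum I F)) (carrier Y)"
    using *(3) unfolding rmod_iso_def by blast
  have triv: "hom_trivial R (direct_sum I F) E"
    using *(1) by (intro hom_trivial_direct_sum E) simp_all
  show "hom_trivial R Y E"
    unfolding hom_trivial_def
  proof (intro ballI)
    fix h y assume h: "h \<in> rmod_hom R Y E" "y \<in> carrier Y"
    then obtain x where "x \<in> carrier (direct_sum I F)" "p x = y"
      using p(2) by (metis bij_betw_imp_surj_on imageE)
    then show "h y = \<zero>\<^bsub>E\<^esub>"
      using hom_trivialD[OF triv rmod_hom_comp[OF p(1) h(1)]] by metis
  qed
qed

lemma generated_torsion_class_orthogonal:
  fixes E M X :: "('a, 'u) module"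
  assumes "injective_rmod R E" "right_module R M" "hom_trivial R M E" "X \<in> generated_torsion_class R M"
  shows "hom_trivial R X E"
proof -
  have "generated_torsion_class R M \<subseteq> {X. right_module R X \<and> hom_trivial R X E}"
    unfolding generated_torsion_class_def
    using torsion_class_orthogonal[OF assms(1)] assms(2,3) by (intro Inter_lower) simp
  then show ?thesis using assms(4) by (auto dest: subsetD)
qed

section \<open>Injective hulls of cyclic modules\<close>

text \<open>A character with values in the divisible group of nonzero complex numbers, defined on a
  subgroup of \<open>G\<close> and given by its graph; chains of such graphs have their unions as upper bounds.\<close>

definition partial_char :: "('b, 'm) ring_scheme \<Rightarrow> ('b \<times> complex) set \<Rightarrow> bool" where
  "partial_char G P \<longleftrightarrow> P \<subseteq> carrier G \<times> - {0} \<and> (\<zero>\<^bsub>G\<^esub>, 1) \<in> P \<and>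
     (\<forall>x c y d. (x, c) \<in> P \<longrightarrow> (y, d) \<in> P \<longrightarrow> (x \<oplus>\<^bsub>G\<^esub> y, c * d) \<in> P) \<and>
     (\<forall>x c. (x, c) \<in> P \<longrightarrow> (\<ominus>\<^bsub>G\<^esub> x, inverse c) \<in> P) \<and>
     (\<forall>c. (\<zero>\<^bsub>G\<^esub>, c) \<in> P \<longrightarrow> c = 1)"

text \<open>There are \<open>k \<ge> 2\<close> roots, so they cannot all be 1. Avoiding 1 is what
  will make characters separate points.\<close>

lemma ex_root_neq_1:
  assumes "c \<noteq> 0" "k \<ge> 2"
  obtains w :: complex where "w ^ k = c" "w \<noteq> 1" "w \<noteq> 0"
proof -
  have "card {z. z ^ k = c} = k" using assms by (intro card_nth_roots) auto
  then have "\<not> {z. z ^ k = c} \<subseteq> {1}"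
    using assms(2) card_mono[of "{1::complex}" "{z. z ^ k = c}"] by auto
  then obtain w where "w ^ k = c" "w \<noteq> 1" by auto
  moreover have "w \<noteq> 0" using \<open>w ^ k = c\<close> assms by (auto simp: power_0_left)
  ultimately show ?thesis using that by blast
qed

section \<open>Extending characters of abelian groups\<close>

context abelian_group
begin

lemma add_pow_0_int: "add_pow G (0::int) x = \<zero>"
  by (simp add: add_pow_def)

lemma partial_charD:
  assumes "partial_char G P"
  shows "(x, c) \<in> P \<Longrightarrow> x \<in> carrier G" "(x, c) \<in> P \<Longrightarrow> c \<noteq> 0" "(\<zero>, 1) \<in> P"
    "(x, c) \<in> P \<Longrightarrow> (y, d) \<in> P \<Longrightarrow> (x \<oplus> y, c * d) \<in> P"
    "(x, c) \<in> P \<Longrightarrow> (\<ominus> x, inverse c) \<in> P" "(\<zero>, c) \<in> P \<Longrightarrow> c = 1"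
  using assms unfolding partial_char_def by auto

text \<open>Two values at \<open>x\<close> differ by a value at \<open>\<zero>\<close>, which the
  last clause of \<open>partial_char\<close> forces to be 1.\<close>

lemma partial_char_unique:
  assumes P: "partial_char G P" and xc: "(x, c) \<in> P" and xd: "(x, d) \<in> P"
  shows "c = d"
proof -
  have "(x \<oplus> \<ominus> x, c * inverse d) \<in> P"
    using partial_charD(4)[OF P xc partial_charD(5)[OF P xd]] .
  then have "c * inverse d = 1"
    using partial_charD(6)[OF P] partial_charD(1)[OF P xc] by (simp add: r_neg)
  then show ?thesis using partial_charD(2)[OF P xd] by (simp add: field_simps)
qed

lemma partial_char_powi:
  assumes P: "partial_char G P" and xc: "(x, c) \<in> P"
  shows "(add_pow G (n::int) x, c powi n) \<in> P"
proof -
  have x: "x \<in> carrier G" and c: "c \<noteq> 0" using partial_charD(1,2)[OF P xc] .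
  have nat: "(add_pow G (int m) x, c powi int m) \<in> P" for m
  proof (induction m)
    case 0
    then show ?case using partial_charD(3)[OF P] by (simp add: add_pow_0_int)
  next
    case (Suc m)
    have "add_pow G (int (Suc m)) x = add_pow G (int m) x \<oplus> x"
      using x add.int_pow_mult[of x "int m" 1] by (simp add: algebra_simps)
    moreover have "c powi int (Suc m) = c powi int m * c" by (simp add: power_int_def nat_add_distrib)
    ultimately show ?case using partial_charD(4)[OF P Suc xc] by simp
  qed
  show ?thesis
  proof (cases "n \<ge> 0")
    case True
    then show ?thesis using nat[of "nat n"] by simp
  next
    case False
    have "add_pow G (n) x = \<ominus> (add_pow G (int (nat (- n))) x)"
      using False x add.int_pow_neg[of x "- n"] by simp
    moreover have "c powi n = inverse (c powi int (nat (- n)))"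
      using False by (simp add: power_int_minus[symmetric])
    ultimately show ?thesis using partial_charD(5)[OF P nat[of "nat (- n)"]] by simp
  qed
qed

text \<open>The value at \<open>b\<close> is free unless a positive multiple of \<open>b\<close>
  already lies in the domain; then it must be a \<open>k\<close>-th root of the value at
  \<open>k b\<close>, for the least such \<open>k\<close>. In both cases a value other than 1 is
  available, and it is recorded for the separation of points.\<close>

lemma partial_char_extend_step:
  assumes P: "partial_char G P" and b: "b \<in> carrier G" and nb: "\<And>c. (b, c) \<notin> P"
  obtains Q w where "partial_char G Q" "P \<subseteq> Q" "(b, w) \<in> Q" "w \<noteq> 1"
proof -
  have ex: "\<exists>w. w \<noteq> 0 \<and> w \<noteq> 1 \<and> (\<forall>n::int. \<forall>d. (add_pow G (n) b, d) \<in> P \<longrightarrow> d = w powi n)"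
  proof (cases "\<exists>m::nat. m > 0 \<and> (\<exists>d. (add_pow G (int m) b, d) \<in> P)")
    case False
    have "d = 2 powi n" if d: "(add_pow G (n) b, d) \<in> P" for n :: int and d
    proof -
      have "(add_pow G (int m) b, e) \<notin> P" if "m > 0" for m e using False that by blast
      moreover have "n > 0 \<Longrightarrow> (add_pow G (int (nat n)) b, d) \<in> P" using d by simp
      moreover have "n < 0 \<Longrightarrow> (add_pow G (int (nat (- n))) b, inverse d) \<in> P"
        using partial_charD(5)[OF P d] b add.int_pow_neg[of b n] by simp
      ultimately have "n = 0" by (metis linorder_neqE_linordered_idom neg_0_less_iff_less zero_less_nat_eq)
      then show ?thesis using d partial_charD(6)[OF P] by (simp add: add_pow_0_int)
    qed
    \<comment> \<open>Only the multiple by 0 lies in the domain, so 2 stands for any number other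
      than 0 and 1.\<close>
    then show ?thesis by (intro exI[of _ 2]) auto
  next
    case True
    define k where "k = (LEAST m::nat. m > 0 \<and> (\<exists>d. (add_pow G (int m) b, d) \<in> P))"
    have k: "k > 0 \<and> (\<exists>d. (add_pow G (int k) b, d) \<in> P)"
      unfolding k_def by (rule LeastI_ex[OF True])
    then obtain c where c: "(add_pow G (int k) b, c) \<in> P" by blast
    \<comment> \<open>\<open>k = 1\<close> would put \<open>b\<close> itself in the domain;
      \<open>k \<ge> 2\<close> is what leaves a choice of roots.\<close>
    have "k \<noteq> 1"
      using c nb b by auto
    with k have "k \<ge> 2" by simp
    then obtain w where w: "w ^ k = c" "w \<noteq> 1" "w \<noteq> 0"
      using ex_root_neq_1 partial_charD(2)[OF P c] by blast
    have "d = w powi n" if d: "(add_pow G (n) b, d) \<in> P" for n d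
    proof -
      \<comment> \<open>Division with remainder: a positive remainder \<open>r\<close> would give a
        multiple of \<open>b\<close> in the domain that is smaller than \<open>k b\<close>.\<close>
      define q r where "q = n div int k" and "r = n mod int k"
      have n: "n = int k * q + r" by (simp add: q_def r_def)
      have r: "0 \<le> r" "r < int k" using k by (simp_all add: r_def)
      have kq: "(add_pow G (int k * q) b, c powi q) \<in> P"
        using partial_char_powi[OF P c, of q] add.int_pow_pow[OF b, of q "int k"] by (simp add: mult.commute)
      have "add_pow G (n) b \<oplus> \<ominus> (add_pow G (int k * q) b) = add_pow G (r) b"
        using b by (simp add: n add.int_pow_mult[symmetric] add.int_pow_neg[symmetric])
      then have "(add_pow G (r) b, d * inverse (c powi q)) \<in> P"
        using partial_charD(4)[OF P d partial_charD(5)[OF P kq]] by simp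
      then have "nat r = 0"
        using r not_less_Least[of "nat r" "\<lambda>m. m > 0 \<and> (\<exists>d. (add_pow G (int m) b, d) \<in> P)"]
        by (auto simp: k_def[symmetric] nat_less_iff)
      with r have "n = int k * q" using n by simp
      then have "d = c powi q" using partial_char_unique[OF P d] kq by simp
      also have "c powi q = w powi n"
        using w \<open>n = int k * q\<close> by (simp add: power_int_mult)
      finally show ?thesis .
    qed
    then show ?thesis using w by blast
  qed
  then obtain w where w: "w \<noteq> 0" "w \<noteq> 1" "\<And>n d. (add_pow G (n::int) b, d) \<in> P \<Longrightarrow> d = w powi n" by blast
  define Q where "Q = {(x \<oplus> add_pow G (n) b, c * w powi n) | x c (n::int). (x, c) \<in> P}"
  have QI: "(x \<oplus> add_pow G (n) b, c * w powi n) \<in> Q" if "(x, c) \<in> P" for x c and n :: int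
    using that by (auto simp: Q_def)
  have PQ: "P \<subseteq> Q"
    using QI[of _ _ 0] partial_charD(1)[OF P] b by (auto simp: add_pow_0_int)
  have "partial_char G Q"
    unfolding partial_char_def
  proof (intro conjI allI impI)
    show "Q \<subseteq> carrier G \<times> - {0}"
      using partial_charD(1,2)[OF P] b w by (auto simp: Q_def)
    show "(\<zero>, 1) \<in> Q" using PQ partial_charD(3)[OF P] by blast
  next
    fix x c y d assume "(x, c) \<in> Q" "(y, d) \<in> Q"
    then obtain x' c' m y' d' n where *: "(x', c') \<in> P" "(y', d') \<in> P"
      "x = x' \<oplus> add_pow G (m::int) b" "c = c' * w powi m" "y = y' \<oplus> add_pow G (n::int) b" "d = d' * w powi n"
      by (auto simp: Q_def)
    have "x \<oplus> y = (x' \<oplus> y') \<oplus> add_pow G (m + n) b"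
      using * b partial_charD(1)[OF P] by (simp add: add.int_pow_mult a_ac)
    moreover have "c * d = (c' * d') * w powi (m + n)"
      using * w by (simp add: power_int_add)
    ultimately show "(x \<oplus> y, c * d) \<in> Q"
      using QI[OF partial_charD(4)[OF P *(1,2)]] by simp
  next
    fix x c assume "(x, c) \<in> Q"
    then obtain x' c' m where *: "(x', c') \<in> P" "x = x' \<oplus> add_pow G (m::int) b" "c = c' * w powi m"
      by (auto simp: Q_def)
    have "\<ominus> x = \<ominus> x' \<oplus> add_pow G (- m) b"
      using * b partial_charD(1)[OF P] by (simp add: minus_add add.int_pow_neg)
    moreover have "inverse c = inverse c' * w powi (- m)"
      using * w by (simp add: power_int_minus)
    ultimately show "(\<ominus> x, inverse c) \<in> Q"
      using QI[OF partial_charD(5)[OF P *(1)]] by simp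
  next
    fix c assume "(\<zero>, c) \<in> Q"
    then obtain x' c' m where *: "(x', c') \<in> P" "\<zero> = x' \<oplus> add_pow G (m::int) b" "c = c' * w powi m"
      by (auto simp: Q_def)
    have x': "x' \<in> carrier G" using * partial_charD(1)[OF P] by blast
    \<comment> \<open>A relation \<open>0 = x' + m b\<close> puts \<open>m b\<close> in the domain
      of \<open>P\<close>, where \<open>w\<close> was chosen compatibly.\<close>
    have "\<ominus> x' = add_pow G (m) b"
      using *(2) x' b by (metis add.int_pow_closed minus_equality a_comm)
    then have "inverse c' = w powi m"
      using w(3) partial_charD(5)[OF P *(1)] by simp
    then show "c = 1"
      using * partial_charD(2)[OF P *(1)] by (metis right_inverse)
  qed
  moreover have "(b, w) \<in> Q"
    using QI[OF partial_charD(3)[OF P], of 1] b by simp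
  ultimately show ?thesis using that PQ w(2) by blast
qed

text \<open>Zorn's lemma for graphs under inclusion; a maximal graph that missed a point could be
  enlarged by the previous lemma.\<close>

lemma partial_char_extend:
  assumes P: "partial_char G P"
  obtains Q where "partial_char G Q" "P \<subseteq> Q" "\<And>x. x \<in> carrier G \<Longrightarrow> \<exists>c. (x, c) \<in> Q"
proof -
  define \<A> where "\<A> = {Q. partial_char G Q \<and> P \<subseteq> Q}"
  have "\<exists>M\<in>\<A>. \<forall>X\<in>\<A>. M \<subseteq> X \<longrightarrow> X = M"
  proof (rule subset_Zorn_nonempty)
    show "\<A> \<noteq> {}" using P by (auto simp: \<A>_def)
  next
    fix \<C> assume \<C>: "\<C> \<noteq> {}" "subset.chain \<A> \<C>"
    then have pc: "\<And>Q. Q \<in> \<C> \<Longrightarrow> partial_char G Q" "\<And>Q. Q \<in> \<C> \<Longrightarrow> P \<subseteq> Q"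
      by (auto simp: \<A>_def subset.chain_def)
    have ch: "Q \<subseteq> Q' \<or> Q' \<subseteq> Q" if "Q \<in> \<C>" "Q' \<in> \<C>" for Q Q'
      using \<C>(2) that by (auto simp: subset.chain_def)
    have "partial_char G (\<Union>\<C>)"
      unfolding partial_char_def
    proof (intro conjI allI impI)
      show "\<Union>\<C> \<subseteq> carrier G \<times> - {0}"
        using partial_charD(1,2)[OF pc(1)] by fast
      show "(\<zero>, 1) \<in> \<Union>\<C>"
        using \<C>(1) partial_charD(3)[OF pc(1)] by auto
    next
      fix x c y d assume "(x, c) \<in> \<Union>\<C>" "(y, d) \<in> \<Union>\<C>"
      then obtain Q Q' where Q: "Q \<in> \<C>" "Q' \<in> \<C>" "(x, c) \<in> Q" "(y, d) \<in> Q'" by auto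
      with ch[OF Q(1,2)] obtain Q'' where "Q'' \<in> \<C>" "(x, c) \<in> Q''" "(y, d) \<in> Q''" by blast
      then show "(x \<oplus> y, c * d) \<in> \<Union>\<C>"
        using partial_charD(4)[OF pc(1)] by blast
    next
      fix x c assume "(x, c) \<in> \<Union>\<C>"
      then show "(\<ominus> x, inverse c) \<in> \<Union>\<C>"
        using partial_charD(5)[OF pc(1)] by auto
    next
      fix c assume "(\<zero>, c) \<in> \<Union>\<C>"
      then show "c = 1" using partial_charD(6)[OF pc(1)] by auto
    qed
    then show "\<Union>\<C> \<in> \<A>" using pc(2) \<C>(1) by (auto simp: \<A>_def)
  qed
  then obtain Q where Q: "partial_char G Q" "P \<subseteq> Q" and
    max: "\<And>X. partial_char G X \<Longrightarrow> P \<subseteq> X \<Longrightarrow> Q \<subseteq> X \<Longrightarrow> X = Q"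
    by (auto simp: \<A>_def)
  have "\<exists>c. (x, c) \<in> Q" if x: "x \<in> carrier G" for x
  proof (rule ccontr)
    assume no: "\<nexists>c. (x, c) \<in> Q"
    then obtain X w where "partial_char G X" "Q \<subseteq> X" "(x, w) \<in> X"
      using partial_char_extend_step[OF Q(1) x] by metis
    with max[of X] Q(2) no show False by blast
  qed
  with Q show ?thesis using that by blast
qed

end

text \<open>Nonzero values are enough for a homomorphism to the multiplicative group:
  \<open>\<chi> 0 = 1\<close> follows when \<open>A\<close> is a submodule.\<close>

definition character :: "('b, 'm) ring_scheme \<Rightarrow> 'b set \<Rightarrow> ('b \<Rightarrow> complex) \<Rightarrow> bool" where
  "character G A \<chi> \<longleftrightarrow> (\<forall>x\<in>A. \<forall>y\<in>A. \<chi> (x \<oplus>\<^bsub>G\<^esub> y) = \<chi> x * \<chi> y) \<and> (\<forall>x\<in>A. \<chi> x \<noteq> 0)"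

lemma partial_char_graph:
  assumes "right_module R M" and A: "submodule A R M" and \<chi>: "character M A \<chi>"
  shows "partial_char M {(x, \<chi> x) | x. x \<in> A}"
proof -
  interpret M: right_module R M by fact
  note A' = submodule_mem[OF A] submodule_zero[OF A] submodule_add[OF A] submodule_minus[OF A]
  have add: "\<chi> (x \<oplus>\<^bsub>M\<^esub> y) = \<chi> x * \<chi> y" if "x \<in> A" "y \<in> A" for x y
    using \<chi> that by (simp add: character_def)
  have nz: "\<chi> x \<noteq> 0" if "x \<in> A" for x
    using \<chi> that by (simp add: character_def)
  have "\<chi> \<zero>\<^bsub>M\<^esub> * \<chi> \<zero>\<^bsub>M\<^esub> = \<chi> \<zero>\<^bsub>M\<^esub>" using add[OF A'(2,2)] by simp
  then have 0: "\<chi> \<zero>\<^bsub>M\<^esub> = 1" using nz[OF A'(2)] by simp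
  have inv: "\<chi> (\<ominus>\<^bsub>M\<^esub> x) = inverse (\<chi> x)" if "x \<in> A" for x
    using add[OF that A'(4)[OF that]] 0 that A'(1) nz[OF that]
    by (simp add: M.M.r_neg inverse_unique)
  show ?thesis
    unfolding partial_char_def using A' nz add 0 inv by auto
qed

text \<open>Two extensions in a row: one to the single further point \<open>b\<close>, forcing a
  value other than 1 there, and one to the whole group, which cannot change that value.\<close>

lemma character_extend:
  assumes "right_module R M" and A: "submodule A R M" and \<chi>: "character M A \<chi>"
  obtains \<psi> where "character M (carrier M) \<psi>" "\<And>x. x \<in> A \<Longrightarrow> \<psi> x = \<chi> x"
    "b \<in> carrier M \<Longrightarrow> b \<notin> A \<Longrightarrow> \<psi> b \<noteq> 1"
proof -
  interpret M: right_module R M by fact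
  define P where "P = {(x, \<chi> x) | x. x \<in> A}"
  have P: "partial_char M P" unfolding P_def by (rule partial_char_graph[OF assms])
  have "\<exists>Q. partial_char M Q \<and> P \<subseteq> Q \<and> (b \<in> carrier M \<longrightarrow> b \<notin> A \<longrightarrow> (\<exists>w. (b, w) \<in> Q \<and> w \<noteq> 1))"
  proof (cases "b \<in> carrier M \<and> b \<notin> A")
    case True
    then have "\<And>c. (b, c) \<notin> P" by (auto simp: P_def)
    from M.M.partial_char_extend_step[OF P conjunct1[OF True] this] show ?thesis by metis
  qed (use P in blast)
  then obtain Q where Q: "partial_char M Q" "P \<subseteq> Q"
    and Qb: "b \<in> carrier M \<Longrightarrow> b \<notin> A \<Longrightarrow> \<exists>w. (b, w) \<in> Q \<and> w \<noteq> 1" by blast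
  obtain Q' where Q': "partial_char M Q'" "Q \<subseteq> Q'" "\<And>x. x \<in> carrier M \<Longrightarrow> \<exists>c. (x, c) \<in> Q'"
    using M.M.partial_char_extend[OF Q(1)] by metis
  define \<psi> where "\<psi> x = (SOME c. (x, c) \<in> Q')" for x
  have \<psi>: "\<psi> x = c" if "(x, c) \<in> Q'" for x c
    using M.M.partial_char_unique[OF Q'(1) _ that] that unfolding \<psi>_def by (metis someI)
  have "character M (carrier M) \<psi>"
    unfolding character_def
  proof (intro conjI ballI)
    fix x y assume "x \<in> carrier M" "y \<in> carrier M"
    then obtain c d where "(x, c) \<in> Q'" "(y, d) \<in> Q'" using Q'(3) by metis
    then show "\<psi> (x \<oplus>\<^bsub>M\<^esub> y) = \<psi> x * \<psi> y"
      using \<psi> M.M.partial_charD(4)[OF Q'(1)] by metis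
  next
    fix x assume "x \<in> carrier M"
    then obtain c where "(x, c) \<in> Q'" using Q'(3) by metis
    then show "\<psi> x \<noteq> 0" using \<psi> M.M.partial_charD(2)[OF Q'(1)] by metis
  qed
  moreover have "\<psi> x = \<chi> x" if "x \<in> A" for x
    using that Q(2) Q'(2) by (intro \<psi>) (auto simp: P_def)
  moreover have "\<psi> b \<noteq> 1" if "b \<in> carrier M" "b \<notin> A"
    using Qb[OF that] Q'(2) \<psi> by blast
  ultimately show ?thesis using that by blast
qed

text \<open>The injective module of all families, indexed by \<open>R\<close>, of characters of the additive group of
  \<open>R\<close>; the second argument is the one on which the characters are defined.\<close>

definition char_module :: "('a, 'r) ring_scheme \<Rightarrow> ('a, 'a \<times> 'a \<Rightarrow> complex) module" where
  "char_module R =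
    \<lparr>carrier = {\<phi>. (\<forall>p. p \<notin> carrier R \<times> carrier R \<longrightarrow> \<phi> p = 1) \<and>
       (\<forall>i\<in>carrier R. character R (carrier R) (\<lambda>r. \<phi> (i, r)))},
     mult = undefined, one = undefined, zero = (\<lambda>_. 1), add = (\<lambda>\<phi> \<psi> p. \<phi> p * \<psi> p),
     smult = (\<lambda>a \<phi> p. if p \<in> carrier R \<times> carrier R then \<phi> (fst p, a \<otimes>\<^bsub>R\<^esub> snd p) else 1)\<rparr>"

section \<open>Injectivity of the character module\<close>

lemma char_module_simps:
  "\<phi> \<in> carrier (char_module R) \<longleftrightarrow> (\<forall>p. p \<notin> carrier R \<times> carrier R \<longrightarrow> \<phi> p = 1) \<and>
     (\<forall>i\<in>carrier R. character R (carrier R) (\<lambda>r. \<phi> (i, r)))"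
  "\<zero>\<^bsub>char_module R\<^esub> = (\<lambda>_. 1)" "\<phi> \<oplus>\<^bsub>char_module R\<^esub> \<psi> = (\<lambda>p. \<phi> p * \<psi> p)"
  "a \<odot>\<^bsub>char_module R\<^esub> \<phi> =
    (\<lambda>p. if p \<in> carrier R \<times> carrier R then \<phi> (fst p, a \<otimes>\<^bsub>R\<^esub> snd p) else 1)"
  by (simp_all add: char_module_def)

lemma character_add: "character G A \<chi> \<Longrightarrow> x \<in> A \<Longrightarrow> y \<in> A \<Longrightarrow> \<chi> (x \<oplus>\<^bsub>G\<^esub> y) = \<chi> x * \<chi> y"
  and character_nz: "character G A \<chi> \<Longrightarrow> x \<in> A \<Longrightarrow> \<chi> x \<noteq> 0"
  by (simp_all add: character_def)

lemma (in ring) char_module_outside: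
  "\<phi> \<in> carrier (char_module R) \<Longrightarrow> p \<notin> carrier R \<times> carrier R \<Longrightarrow> \<phi> p = 1"
  unfolding char_module_simps by blast

lemma (in ring) char_module_character:
  "\<phi> \<in> carrier (char_module R) \<Longrightarrow> i \<in> carrier R \<Longrightarrow> character R (carrier R) (\<lambda>r. \<phi> (i, r))"
  by (simp add: char_module_simps)

text \<open>Scalars act by precomposition with left multiplications, which reverses the order of
  composition; hence a right module.\<close>

lemma (in ring) right_module_char_module: "right_module R (char_module R)"
proof (intro right_module.intro right_module_axioms.intro ring_axioms)
  let ?M = "char_module R"
  note add = character_add[OF char_module_character] and nz = character_nz[OF char_module_character]
  note out = char_module_outside
  show "abelian_group ?M"
  proof (rule abelian_groupI)
    fix \<phi> assume \<phi>: "\<phi> \<in> carrier ?M"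
    have nz': "\<phi> p \<noteq> 0" for p
    proof (cases "p \<in> carrier R \<times> carrier R")
      case True
      then show ?thesis using nz[OF \<phi>, of "fst p" "snd p"] by auto
    qed (use out[OF \<phi>] in simp)
    have "(\<lambda>p. inverse (\<phi> p)) \<in> carrier ?M"
      using out[OF \<phi>] add[OF \<phi>] nz' by (auto simp: char_module_simps character_def)
    then show "\<exists>\<psi>\<in>carrier ?M. \<psi> \<oplus>\<^bsub>?M\<^esub> \<phi> = \<zero>\<^bsub>?M\<^esub>"
      using nz' by (intro bexI[of _ "\<lambda>p. inverse (\<phi> p)"]) (auto simp: char_module_simps)
  qed (auto simp: char_module_simps character_def)
  show "a \<odot>\<^bsub>?M\<^esub> \<phi> \<in> carrier ?M" if a: "a \<in> carrier R" and \<phi>: "\<phi> \<in> carrier ?M" for a \<phi>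
    using a add[OF \<phi>] nz[OF \<phi>] by (auto simp: char_module_simps character_def r_distr)
  show "(a \<oplus> b) \<odot>\<^bsub>?M\<^esub> \<phi> = a \<odot>\<^bsub>?M\<^esub> \<phi> \<oplus>\<^bsub>?M\<^esub> b \<odot>\<^bsub>?M\<^esub> \<phi>"
    if "a \<in> carrier R" "b \<in> carrier R" and \<phi>: "\<phi> \<in> carrier ?M" for a b \<phi>
    using that(1,2) add[OF \<phi>] by (auto simp: char_module_simps fun_eq_iff l_distr)
  show "(a \<otimes> b) \<odot>\<^bsub>?M\<^esub> \<phi> = b \<odot>\<^bsub>?M\<^esub> (a \<odot>\<^bsub>?M\<^esub> \<phi>)" if "a \<in> carrier R" "b \<in> carrier R" for a b \<phi>
    using that by (auto simp: char_module_simps fun_eq_iff m_assoc)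
  show "\<one> \<odot>\<^bsub>?M\<^esub> \<phi> = \<phi>" if \<phi>: "\<phi> \<in> carrier ?M" for \<phi>
    using out[OF \<phi>] by (auto simp: char_module_simps fun_eq_iff)
qed (auto simp: char_module_simps fun_eq_iff)

lemma (in right_module) submodule_image:
  assumes "right_module R L" "f \<in> rmod_hom R L M" "submodule A R L"
  shows "submodule (f ` A) R M"
proof -
  interpret L: right_module R L by fact
  note A = submodule_mem[OF assms(3)]
  show ?thesis
  proof (rule submoduleI)
    show "f ` A \<subseteq> carrier M" using A rmod_hom_closed[OF assms(2)] by blast
    have "f \<zero>\<^bsub>L\<^esub> = \<zero>\<^bsub>M\<^esub>"
      using rmod_hom_zero[OF assms(1) right_module_axioms assms(2)] .
    then show "\<zero>\<^bsub>M\<^esub> \<in> f ` A" using submodule_zero[OF assms(3)] by (metis imageI)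
  next
    fix x y assume "x \<in> f ` A" "y \<in> f ` A"
    then obtain u v where uv: "u \<in> A" "v \<in> A" "x = f u" "y = f v" by blast
    then have "x \<oplus>\<^bsub>M\<^esub> y = f (u \<oplus>\<^bsub>L\<^esub> v)" using rmod_hom_add[OF assms(2)] A by simp
    then show "x \<oplus>\<^bsub>M\<^esub> y \<in> f ` A" using submodule_add[OF assms(3) uv(1,2)] by blast
  next
    fix a x assume "a \<in> carrier R" "x \<in> f ` A"
    then obtain u where u: "u \<in> A" "x = f u" by blast
    then have "a \<odot>\<^bsub>M\<^esub> x = f (a \<odot>\<^bsub>L\<^esub> u)" using rmod_hom_smult[OF assms(2)] A \<open>a \<in> carrier R\<close> by simp
    then show "a \<odot>\<^bsub>M\<^esub> x \<in> f ` A"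
      using submodule_smult[OF assms(3) \<open>a \<in> carrier R\<close> u(1)] by blast
  qed
qed

text \<open>Evaluation at \<open>\<one>\<close> identifies homomorphisms into the character module with families of
  characters, so they extend because characters do.\<close>

lemma (in ring) char_module_extend:
  assumes A: "right_module R A" and B: "right_module R B"
    and i: "i \<in> rmod_mono R A B" and f: "f \<in> rmod_hom R A (char_module R)"
  obtains g where "g \<in> rmod_hom R B (char_module R)" "\<And>x. x \<in> carrier A \<Longrightarrow> g (i x) = f x"
proof -
  interpret A: right_module R A by fact
  interpret B: right_module R B by fact
  let ?M = "char_module R"
  note ih = rmod_monoD[OF i] and fc = rmod_hom_closed[OF f]
  have inj: "inj_on i (carrier A)" using i by (simp add: rmod_mono_def)
  have sub: "submodule (i ` carrier A) R B"
    by (rule B.submodule_image[OF A ih A.submodule_carrier])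
  define v where "v = inv_into (carrier A) i"
  have v: "v (i x) = x" if "x \<in> carrier A" for x
    using that inj by (simp add: v_def)
  \<comment> \<open>For each index \<open>j\<close>, the composite of \<open>f\<close> with
    evaluation at \<open>(j, \<one>)\<close> is moved to the image of \<open>i\<close> and extended
    from there.\<close>
  have "\<exists>\<psi>. character B (carrier B) \<psi> \<and> (\<forall>x\<in>carrier A. \<psi> (i x) = f x (j, \<one>))" if j: "j \<in> carrier R" for j
  proof -
    have "character B (i ` carrier A) (\<lambda>y. f (v y) (j, \<one>))"
      unfolding character_def
    proof (intro conjI ballI)
      fix x y assume "x \<in> i ` carrier A" "y \<in> i ` carrier A"
      then obtain a b where "a \<in> carrier A" "b \<in> carrier A" "x = i a" "y = i b" by blast
      then show "f (v (x \<oplus>\<^bsub>B\<^esub> y)) (j, \<one>) = f (v x) (j, \<one>) * f (v y) (j, \<one>)"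
        using v[of a] v[of b] v[of "a \<oplus>\<^bsub>A\<^esub> b"] rmod_hom_add[OF ih] rmod_hom_add[OF f]
        by (simp add: char_module_simps)
    next
      fix x assume "x \<in> i ` carrier A"
      then show "f (v x) (j, \<one>) \<noteq> 0"
        using v character_nz[OF char_module_character[OF fc j]] by auto
    qed
    from character_extend[OF B sub this, of undefined]
    obtain \<psi> where "character B (carrier B) \<psi>" "\<And>x. x \<in> i ` carrier A \<Longrightarrow> \<psi> x = f (v x) (j, \<one>)"
      by metis
    then show ?thesis using v by (intro exI[of _ \<psi>]) auto
  qed
  then obtain \<psi> where \<psi>: "\<And>j. j \<in> carrier R \<Longrightarrow> character B (carrier B) (\<psi> j)"
    "\<And>j x. j \<in> carrier R \<Longrightarrow> x \<in> carrier A \<Longrightarrow> \<psi> j (i x) = f x (j, \<one>)"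
    by metis
  \<comment> \<open>The family of characters is turned back into a homomorphism: component
    \<open>j\<close> of \<open>g b\<close> sends \<open>r\<close> to the value of
    \<open>\<psi> j\<close> at \<open>b r\<close>.\<close>
  define g where "g b = (\<lambda>p. if p \<in> carrier R \<times> carrier R then \<psi> (fst p) (snd p \<odot>\<^bsub>B\<^esub> b) else 1)" for b
  have "g \<in> rmod_hom R B ?M"
  proof (rule rmod_homI)
    show "g b \<in> carrier ?M" if b: "b \<in> carrier B" for b
      using b character_add[OF \<psi>(1)] character_nz[OF \<psi>(1)]
      by (auto simp: char_module_simps character_def g_def B.smult_closed B.smult_l_distr)
    show "g (b \<oplus>\<^bsub>B\<^esub> c) = g b \<oplus>\<^bsub>?M\<^esub> g c" if "b \<in> carrier B" "c \<in> carrier B" for b c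
      using that character_add[OF \<psi>(1)]
      by (auto simp: char_module_simps g_def B.smult_closed B.smult_r_distr fun_eq_iff)
    show "g (a \<odot>\<^bsub>B\<^esub> b) = a \<odot>\<^bsub>?M\<^esub> g b" if "a \<in> carrier R" "b \<in> carrier B" for a b
      using that by (auto simp: char_module_simps g_def B.smult_assoc fun_eq_iff)
  qed
  moreover have "g (i x) = f x" if x: "x \<in> carrier A" for x
  proof
    fix p
    show "g (i x) p = f x p"
    proof (cases "p \<in> carrier R \<times> carrier R")
      case True
      then obtain j r where p: "p = (j, r)" "j \<in> carrier R" "r \<in> carrier R" by auto
      have "g (i x) p = \<psi> j (i (r \<odot>\<^bsub>A\<^esub> x))"
        using p x rmod_hom_smult[OF ih] by (simp add: g_def)
      also have "\<dots> = f (r \<odot>\<^bsub>A\<^esub> x) (j, \<one>)" using p x A.smult_closed \<psi>(2) by simp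
      also have "\<dots> = f x p" using rmod_hom_smult[OF f p(3) x] p by (simp add: char_module_simps)
      finally show ?thesis .
    next
      case False
      then show ?thesis using char_module_outside[OF fc[OF x]] by (simp add: g_def)
    qed
  qed
  ultimately show ?thesis using that by blast
qed

text \<open>Unions of chains inherit all conditions, so Zorn's lemma applies. \<open>D\<close> is an
  arbitrary set; the lemma is used with \<open>D\<close> a given submodule \<open>X\<close>, to find
  a complement \<open>C\<close>, and then with \<open>D = C\<close>, to find the hull of
  \<open>X\<close>.\<close>

lemma (in right_module) maximal_disjoint_submodule:
  assumes A: "submodule A R M" and "A \<inter> D = {\<zero>\<^bsub>M\<^esub>}"
  obtains C where "submodule C R M" "A \<subseteq> C" "C \<inter> D = {\<zero>\<^bsub>M\<^esub>}"
    "\<And>C'. submodule C' R M \<Longrightarrow> C \<subseteq> C' \<Longrightarrow> C' \<inter> D = {\<zero>\<^bsub>M\<^esub>} \<Longrightarrow> C' = C"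
proof -
  define \<A> where "\<A> = {C. submodule C R M \<and> A \<subseteq> C \<and> C \<inter> D = {\<zero>\<^bsub>M\<^esub>}}"
  have "\<exists>C\<in>\<A>. \<forall>X\<in>\<A>. C \<subseteq> X \<longrightarrow> X = C"
  proof (rule subset_Zorn_nonempty)
    show "\<A> \<noteq> {}" using assms by (auto simp: \<A>_def)
  next
    fix \<C> assume \<C>: "\<C> \<noteq> {}" "subset.chain \<A> \<C>"
    then have c: "\<And>C. C \<in> \<C> \<Longrightarrow> submodule C R M" "\<And>C. C \<in> \<C> \<Longrightarrow> A \<subseteq> C"
      "\<And>C. C \<in> \<C> \<Longrightarrow> C \<inter> D = {\<zero>\<^bsub>M\<^esub>}" "\<And>C C'. C \<in> \<C> \<Longrightarrow> C' \<in> \<C> \<Longrightarrow> C \<subseteq> C' \<or> C' \<subseteq> C"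
      by (auto simp: \<A>_def subset.chain_def)
    have "submodule (\<Union>\<C>) R M" using submodule_Union_chain[OF c(1) \<C>(1) c(4)] .
    then show "\<Union>\<C> \<in> \<A>" using c(2,3) \<C>(1) unfolding \<A>_def by blast
  qed
  then obtain C where C: "C \<in> \<A>" "\<forall>X\<in>\<A>. C \<subseteq> X \<longrightarrow> X = C" by blast
  show ?thesis
  proof (rule that[of C])
    show "submodule C R M" "A \<subseteq> C" "C \<inter> D = {\<zero>\<^bsub>M\<^esub>}" using C(1) by (simp_all add: \<A>_def)
    fix C' assume *: "submodule C' R M" "C \<subseteq> C'" "C' \<inter> D = {\<zero>\<^bsub>M\<^esub>}"
    have "A \<subseteq> C" using C(1) by (simp add: \<A>_def)
    then have "C' \<in> \<A>" using * by (simp add: \<A>_def)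
    then show "C' = C" using bspec[OF C(2)] *(2) by simp
  qed
qed

text \<open>A maximal submodule \<open>E \<supseteq> X\<close> disjoint from a complement \<open>C\<close> of \<open>X\<close> is a retract: a retraction is
  any extension of the projection \<open>E + C \<rightarrow> E\<close>, since its image is again disjoint from \<open>C\<close>.\<close>

lemma (in ring) char_module_hull:
  assumes X: "submodule X R (char_module R)"
  obtains E q where "submodule E R (char_module R)" "X \<subseteq> E"
    "q \<in> rmod_hom R (char_module R) (submod (char_module R) E)" "\<And>x. x \<in> E \<Longrightarrow> q x = x"
    "\<And>y. y \<in> E \<Longrightarrow> y \<noteq> \<zero>\<^bsub>char_module R\<^esub> \<Longrightarrow>
      \<exists>r\<in>carrier R. r \<odot>\<^bsub>char_module R\<^esub> y \<in> X \<and> r \<odot>\<^bsub>char_module R\<^esub> y \<noteq> \<zero>\<^bsub>char_module R\<^esub>"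
proof -
  let ?M = "char_module R"
  interpret M: right_module R ?M by (rule right_module_char_module)
  have "{\<zero>\<^bsub>?M\<^esub>} \<inter> X = {\<zero>\<^bsub>?M\<^esub>}" using submodule_zero[OF X] by blast
  from M.maximal_disjoint_submodule[OF M.submodule_zero_set this]
  obtain C where C: "submodule C R ?M" "C \<inter> X = {\<zero>\<^bsub>?M\<^esub>}"
    and Cmax: "\<And>C'. submodule C' R ?M \<Longrightarrow> C \<subseteq> C' \<Longrightarrow> C' \<inter> X = {\<zero>\<^bsub>?M\<^esub>} \<Longrightarrow> C' = C"
    by metis
  have "X \<inter> C = {\<zero>\<^bsub>?M\<^esub>}" using C(2) by blast
  from M.maximal_disjoint_submodule[OF X this]
  obtain E where E: "submodule E R ?M" "X \<subseteq> E" "E \<inter> C = {\<zero>\<^bsub>?M\<^esub>}"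
    and Emax: "\<And>E'. submodule E' R ?M \<Longrightarrow> E \<subseteq> E' \<Longrightarrow> E' \<inter> C = {\<zero>\<^bsub>?M\<^esub>} \<Longrightarrow> E' = E"
    by metis
  note Em = submodule_mem[OF E(1)] and Cm = submodule_mem[OF C(1)]
  \<comment> \<open>Maximality of \<open>C\<close>: the submodule generated by \<open>C\<close> and
    \<open>z\<close> is larger, hence meets \<open>X\<close> in a nonzero element.\<close>
  have ess: "\<exists>r\<in>carrier R. \<exists>c\<in>C. c \<oplus>\<^bsub>?M\<^esub> r \<odot>\<^bsub>?M\<^esub> z \<in> X \<and> c \<oplus>\<^bsub>?M\<^esub> r \<odot>\<^bsub>?M\<^esub> z \<noteq> \<zero>\<^bsub>?M\<^esub>"
    if z: "z \<in> carrier ?M" "z \<notin> C" for z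
  proof -
    define C' where "C' = {c \<oplus>\<^bsub>?M\<^esub> u | c u. c \<in> C \<and> u \<in> (\<lambda>r. r \<odot>\<^bsub>?M\<^esub> z) ` carrier R}"
    have C': "submodule C' R ?M"
      unfolding C'_def by (rule M.submodule_sum[OF C(1) M.submodule_cyclic[OF z(1)]])
    have "c \<in> C'" if "c \<in> C" for c
    proof -
      have "c = c \<oplus>\<^bsub>?M\<^esub> \<zero> \<odot>\<^bsub>?M\<^esub> z" using that Cm z M.smult_l_zero by simp
      then show ?thesis using that unfolding C'_def by blast
    qed
    moreover have "z \<in> C'"
    proof -
      have "z = \<zero>\<^bsub>?M\<^esub> \<oplus>\<^bsub>?M\<^esub> \<one> \<odot>\<^bsub>?M\<^esub> z" using z by (simp add: M.smult_one)
      then show ?thesis using submodule_zero[OF C(1)] unfolding C'_def by blast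
    qed
    ultimately have "C' \<inter> X \<noteq> {\<zero>\<^bsub>?M\<^esub>}" using Cmax[OF C'] z by blast
    then obtain x where "x \<in> C'" "x \<in> X" "x \<noteq> \<zero>\<^bsub>?M\<^esub>"
      using submodule_zero[OF C'] submodule_zero[OF X] by blast
    then show ?thesis unfolding C'_def by blast
  qed
  define F where "F = {x \<oplus>\<^bsub>?M\<^esub> c | x c. x \<in> E \<and> c \<in> C}"
  have F: "submodule F R ?M" unfolding F_def by (rule M.submodule_sum[OF E(1) C(1)])
  \<comment> \<open>The component in \<open>E\<close> of an element of \<open>E + C\<close>; it is
    unique because \<open>E \<inter> C = 0\<close>.\<close>
  define p where "p y = (THE x. x \<in> E \<and> (\<exists>c\<in>C. y = x \<oplus>\<^bsub>?M\<^esub> c))" for y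
  have p: "p (x \<oplus>\<^bsub>?M\<^esub> c) = x" if xc: "x \<in> E" "c \<in> C" for x c
    unfolding p_def
  proof (rule the_equality)
    show "x \<in> E \<and> (\<exists>d\<in>C. x \<oplus>\<^bsub>?M\<^esub> c = x \<oplus>\<^bsub>?M\<^esub> d)" using xc by blast
    fix x' assume "x' \<in> E \<and> (\<exists>d\<in>C. x \<oplus>\<^bsub>?M\<^esub> c = x' \<oplus>\<^bsub>?M\<^esub> d)"
    then obtain d where d: "x' \<in> E" "d \<in> C" "x \<oplus>\<^bsub>?M\<^esub> c = x' \<oplus>\<^bsub>?M\<^esub> d" by blast
    have m: "x \<in> carrier ?M" "c \<in> carrier ?M" "x' \<in> carrier ?M" "d \<in> carrier ?M"
      using xc d Em Cm by auto
    have "x \<ominus>\<^bsub>?M\<^esub> x' = d \<ominus>\<^bsub>?M\<^esub> c"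
    proof -
      have "x \<ominus>\<^bsub>?M\<^esub> x' = (x \<oplus>\<^bsub>?M\<^esub> \<ominus>\<^bsub>?M\<^esub> x') \<oplus>\<^bsub>?M\<^esub> (c \<oplus>\<^bsub>?M\<^esub> \<ominus>\<^bsub>?M\<^esub> c)"
        using m by (simp add: a_minus_def M.M.r_neg)
      also have "\<dots> = (x \<oplus>\<^bsub>?M\<^esub> c) \<oplus>\<^bsub>?M\<^esub> (\<ominus>\<^bsub>?M\<^esub> x' \<oplus>\<^bsub>?M\<^esub> \<ominus>\<^bsub>?M\<^esub> c)"
        using m by (simp add: M.M.a_ac)
      also have "\<dots> = (x' \<oplus>\<^bsub>?M\<^esub> \<ominus>\<^bsub>?M\<^esub> x') \<oplus>\<^bsub>?M\<^esub> (d \<oplus>\<^bsub>?M\<^esub> \<ominus>\<^bsub>?M\<^esub> c)"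
        unfolding d(3) using m by (simp add: M.M.a_ac)
      also have "\<dots> = d \<ominus>\<^bsub>?M\<^esub> c"
        using m by (simp add: a_minus_def M.M.r_neg)
      finally show ?thesis .
    qed
    then have "x \<ominus>\<^bsub>?M\<^esub> x' = \<zero>\<^bsub>?M\<^esub>"
      using submodule_diff[OF E(1) xc(1) d(1)] submodule_diff[OF C(1) d(2) xc(2)] E(3) by auto
    then show "x' = x" using M.minus_eq_zero_iff m by simp
  qed
  have "p \<in> rmod_hom R (submod ?M F) ?M"
  proof (rule rmod_homI)
    fix y assume "y \<in> carrier (submod ?M F)"
    then show "p y \<in> carrier ?M" using p Em by (auto simp: F_def)
  next
    fix y y' assume "y \<in> carrier (submod ?M F)" "y' \<in> carrier (submod ?M F)"
    then obtain x c x' c' where *: "x \<in> E" "c \<in> C" "x' \<in> E" "c' \<in> C"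
      "y = x \<oplus>\<^bsub>?M\<^esub> c" "y' = x' \<oplus>\<^bsub>?M\<^esub> c'" by (auto simp: F_def)
    then have "y \<oplus>\<^bsub>?M\<^esub> y' = (x \<oplus>\<^bsub>?M\<^esub> x') \<oplus>\<^bsub>?M\<^esub> (c \<oplus>\<^bsub>?M\<^esub> c')"
      using Em Cm by (simp add: M.M.a_ac)
    then show "p (y \<oplus>\<^bsub>submod ?M F\<^esub> y') = p y \<oplus>\<^bsub>?M\<^esub> p y'"
      using p * submodule_add[OF E(1)] submodule_add[OF C(1)] by simp
  next
    fix a y assume a: "a \<in> carrier R" and "y \<in> carrier (submod ?M F)"
    then obtain x c where *: "x \<in> E" "c \<in> C" "y = x \<oplus>\<^bsub>?M\<^esub> c" by (auto simp: F_def)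
    then have "a \<odot>\<^bsub>?M\<^esub> y = a \<odot>\<^bsub>?M\<^esub> x \<oplus>\<^bsub>?M\<^esub> a \<odot>\<^bsub>?M\<^esub> c"
      using Em Cm a by (simp add: M.smult_r_distr)
    then show "p (a \<odot>\<^bsub>submod ?M F\<^esub> y) = a \<odot>\<^bsub>?M\<^esub> p y"
      using p * submodule_smult[OF E(1) a] submodule_smult[OF C(1) a] by simp
  qed
  moreover have "(\<lambda>x. x) \<in> rmod_mono R (submod ?M F) ?M"
    using submodule_subset[OF F] by (auto simp: rmod_mono_def rmod_hom_def)
  ultimately obtain q where q: "q \<in> rmod_hom R ?M ?M" "\<And>y. y \<in> F \<Longrightarrow> q y = p y"
    using char_module_extend[OF M.right_module_submod[OF F] right_module_char_module] by auto
  have qE: "q x = x" if "x \<in> E" for x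
  proof -
    have "x = x \<oplus>\<^bsub>?M\<^esub> \<zero>\<^bsub>?M\<^esub>" using that Em by simp
    then have "x \<in> F" using that submodule_zero[OF C(1)] unfolding F_def by blast
    then show ?thesis
      using q(2) p[OF that submodule_zero[OF C(1)]] that Em by simp
  qed
  have qC: "q c = \<zero>\<^bsub>?M\<^esub>" if "c \<in> C" for c
  proof -
    have "c = \<zero>\<^bsub>?M\<^esub> \<oplus>\<^bsub>?M\<^esub> c" using that Cm by simp
    then have "c \<in> F" using that submodule_zero[OF E(1)] unfolding F_def by blast
    then show ?thesis
      using q(2) p[OF submodule_zero[OF E(1)] that] that Cm by simp
  qed
  have "q ` carrier ?M = E"
  proof (rule Emax)
    show "submodule (q ` carrier ?M) R ?M"
      by (rule M.submodule_image[OF right_module_char_module q(1) M.submodule_carrier])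
    show "E \<subseteq> q ` carrier ?M" using qE Em by force
    \<comment> \<open>Suppose \<open>q z\<close> is nonzero. As \<open>q\<close> kills
      \<open>C\<close>, \<open>z\<close> is outside \<open>C\<close>, and some
      \<open>c + z r\<close> is a nonzero element of \<open>X\<close>. It is fixed by
      \<open>q\<close>, but \<open>q\<close> sends it to \<open>(q z) r\<close>, which lies in
      \<open>C\<close>. This contradicts \<open>C \<inter> X = 0\<close>.\<close>
    have "q z = \<zero>\<^bsub>?M\<^esub>" if z: "z \<in> carrier ?M" "q z \<in> C" for z
    proof (rule ccontr)
      assume "q z \<noteq> \<zero>\<^bsub>?M\<^esub>"
      then have "z \<notin> C" using qC by blast
      then obtain r c where rc: "r \<in> carrier R" "c \<in> C" "c \<oplus>\<^bsub>?M\<^esub> r \<odot>\<^bsub>?M\<^esub> z \<in> X"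
        "c \<oplus>\<^bsub>?M\<^esub> r \<odot>\<^bsub>?M\<^esub> z \<noteq> \<zero>\<^bsub>?M\<^esub>" using ess[OF z(1)] by blast
      have "q (c \<oplus>\<^bsub>?M\<^esub> r \<odot>\<^bsub>?M\<^esub> z) = q c \<oplus>\<^bsub>?M\<^esub> r \<odot>\<^bsub>?M\<^esub> q z"
        using rmod_hom_add[OF q(1), of c "r \<odot>\<^bsub>?M\<^esub> z"] rmod_hom_smult[OF q(1) rc(1) z(1)] rc z Cm
          M.smult_closed by simp
      also have "\<dots> = r \<odot>\<^bsub>?M\<^esub> q z"
        using qC[OF rc(2)] rc(1) Cm[OF z(2)] M.smult_closed by simp
      finally have "c \<oplus>\<^bsub>?M\<^esub> r \<odot>\<^bsub>?M\<^esub> z \<in> C"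
        using qE rc(3) E(2) submodule_smult[OF C(1) rc(1) z(2)] by auto
      then show False using C(2) rc(3,4) by blast
    qed
    then show "q ` carrier ?M \<inter> C = {\<zero>\<^bsub>?M\<^esub>}"
      using submodule_zero[OF C(1)] qE[OF submodule_zero[OF E(1)]] by (auto simp: image_iff) force
  qed
  then have "q \<in> rmod_hom R ?M (submod ?M E)"
    using q(1) by (auto simp: rmod_hom_def)
  \<comment> \<open>\<open>E\<close> is essential over \<open>X\<close>: if \<open>c + y r\<close>
    lies in \<open>X \<subseteq> E\<close>, then \<open>c\<close> lies in
    \<open>E \<inter> C = 0\<close>.\<close>
  moreover have "\<exists>r\<in>carrier R. r \<odot>\<^bsub>?M\<^esub> y \<in> X \<and> r \<odot>\<^bsub>?M\<^esub> y \<noteq> \<zero>\<^bsub>?M\<^esub>"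
    if y: "y \<in> E" "y \<noteq> \<zero>\<^bsub>?M\<^esub>" for y
  proof -
    have "y \<notin> C" using y E(3) by blast
    then obtain r c where rc: "r \<in> carrier R" "c \<in> C" "c \<oplus>\<^bsub>?M\<^esub> r \<odot>\<^bsub>?M\<^esub> y \<in> X"
      "c \<oplus>\<^bsub>?M\<^esub> r \<odot>\<^bsub>?M\<^esub> y \<noteq> \<zero>\<^bsub>?M\<^esub>" using ess[OF Em[OF y(1)]] by blast
    have ry: "r \<odot>\<^bsub>?M\<^esub> y \<in> E" using submodule_smult[OF E(1) rc(1) y(1)] .
    have "(c \<oplus>\<^bsub>?M\<^esub> r \<odot>\<^bsub>?M\<^esub> y) \<ominus>\<^bsub>?M\<^esub> r \<odot>\<^bsub>?M\<^esub> y = c"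
      using Cm[OF rc(2)] Em[OF ry] by (simp add: a_minus_def M.M.a_assoc M.M.r_neg)
    then have "c \<in> E" using submodule_diff[OF E(1) _ ry] rc(3) E(2) by (metis subsetD)
    then have "c = \<zero>\<^bsub>?M\<^esub>" using rc(2) E(3) by blast
    then show ?thesis using rc Em[OF ry] by auto
  qed
  ultimately show ?thesis using that E(1,2) qE by blast
qed

text \<open>A complex number is determined by the Dedekind cuts of its real and imaginary parts, and
  \<open>bool \<times> rat\<close> is countable.\<close>

lemma ex_inj_complex_nat_set: "\<exists>c :: complex \<Rightarrow> nat set. inj c"
proof
  let ?f = "\<lambda>b z. if b then Re z else Im z"
  let ?c = "\<lambda>z. {to_nat (b :: bool, q :: rat) | b q. of_rat q < ?f b z}"
  show "inj ?c"
  proof (rule injI)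
    fix z w assume eq: "?c z = ?c w"
    have "of_rat q < ?f b z \<longleftrightarrow> of_rat q < ?f b w" for b :: bool and q :: rat
    proof -
      have m: "of_rat q < ?f b u \<longleftrightarrow> to_nat (b, q) \<in> ?c u" for u by auto
      have "to_nat (b, q) \<in> ?c z \<longleftrightarrow> to_nat (b, q) \<in> ?c w" by (simp only: eq)
      then show ?thesis by (rule trans[OF m[of z] trans[OF _ m[of w, symmetric]]])
    qed
    then have nl: "\<not> ?f b z < ?f b w" "\<not> ?f b w < ?f b z" for b
      using of_rat_dense by (metis less_asym)+
    have "?f b z = ?f b w" for b using nl[of b] by linarith
    from this[of True] this[of False] show "z = w" by (simp add: complex_eq_iff)
  qed
qed

lemma hom_submod_inclusion:
  assumes "f \<in> rmod_hom R L (submod M H)" "H \<subseteq> carrier M"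
  shows "f \<in> rmod_hom R L M"
  using assms by (auto simp: rmod_hom_def)

section \<open>Injective hulls inside the universe\<close>

context universe_ring
begin

text \<open>A family \<open>\<phi>\<close> is recorded by the words consisting of \<open>i\<close>,
  \<open>r\<close> and then \<open>n\<close> zeros, where \<open>n\<close> runs through the set of
  naturals that codes \<open>\<phi> (i, r)\<close>.\<close>

lemma char_module_code: "\<exists>g :: ('a \<times> 'a \<Rightarrow> complex) \<Rightarrow> 'u. inj_on g (carrier (char_module R))"
proof -
  obtain code :: "'a list set \<Rightarrow> 'u" where code: "inj_on code (Pow (lists (carrier R)))"
    using adequate by (auto simp: adequate_universe_def)
  obtain c :: "complex \<Rightarrow> nat set" where c: "inj c" using ex_inj_complex_nat_set by blast
  let ?s = "\<lambda>\<phi>. {i # r # replicate n \<zero> | i r n. i \<in> carrier R \<and> r \<in> carrier R \<and> n \<in> c (\<phi> (i, r))}"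
  have sub: "?s \<phi> \<in> Pow (lists (carrier R))" for \<phi> by (auto simp: in_lists_conv_set)
  have "inj_on (\<lambda>\<phi>. code (?s \<phi>)) (carrier (char_module R))"
  proof (rule inj_onI)
    fix \<phi> \<psi> assume *: "\<phi> \<in> carrier (char_module R)" "\<psi> \<in> carrier (char_module R)" "code (?s \<phi>) = code (?s \<psi>)"
    have eq: "?s \<phi> = ?s \<psi>" using inj_onD[OF code *(3) sub sub] .
    show "\<phi> = \<psi>"
    proof
      fix p
      show "\<phi> p = \<psi> p"
      proof (cases "p \<in> carrier R \<times> carrier R")
        case True
        then obtain i r where p: "p = (i, r)" "i \<in> carrier R" "r \<in> carrier R" by auto
        have m: "n \<in> c (\<theta> p) \<longleftrightarrow> i # r # replicate n \<zero> \<in> ?s \<theta>" for n \<theta>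
          using p by auto
        have "c (\<phi> p) = c (\<psi> p)" by (rule Set.set_eqI) (simp only: m eq)
        then show ?thesis using injD[OF c] by blast
      next
        case False
        then show ?thesis using char_module_outside[OF *(1)] char_module_outside[OF *(2)] by simp
      qed
    qed
  qed
  then show ?thesis by blast
qed

text \<open>\<open>R/K\<close> embeds in the character module because characters separate points
  from \<open>K\<close>; a hull found there is copied into the universe. Uniformity of
  \<open>R/K\<close> passes to the essential extension and makes it indecomposable. The generator
  \<open>e\<close>, its annihilator and essentiality are what later arguments use of the
  hull.\<close>

lemma injective_hull:
  assumes K: "right_ideal K R" and K1: "\<one> \<notin> K"
    and uniform: "\<And>x y. x \<in> carrier R - K \<Longrightarrow> y \<in> carrier R - K \<Longrightarrow>
      \<exists>r\<in>carrier R. \<exists>s\<in>carrier R. x \<otimes> r \<ominus> y \<otimes> s \<in> K \<and> x \<otimes> r \<notin> K"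
  obtains E :: "('a, 'u) module" and e where "E \<in> indec_injectives R" "e \<in> carrier E"
    "\<And>a. a \<in> carrier R \<Longrightarrow> a \<odot>\<^bsub>E\<^esub> e = \<zero>\<^bsub>E\<^esub> \<longleftrightarrow> a \<in> K"
    "\<And>y. y \<in> carrier E \<Longrightarrow> y \<noteq> \<zero>\<^bsub>E\<^esub> \<Longrightarrow>
      \<exists>r\<in>carrier R. \<exists>x\<in>carrier R. r \<odot>\<^bsub>E\<^esub> y = x \<odot>\<^bsub>E\<^esub> e \<and> x \<notin> K"
proof -
  let ?M = "char_module R"
  interpret M: right_module R ?M by (rule right_module_char_module)
  have reg: "character S A \<chi> \<longleftrightarrow> character R A \<chi>" for A \<chi>
    by (simp add: character_def)
  have triv: "character S K (\<lambda>_. 1)" by (simp add: character_def)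
  \<comment> \<open>The character with index \<open>i\<close> is trivial on \<open>K\<close> and
    nontrivial at \<open>i\<close> when \<open>i\<close> lies outside \<open>K\<close>. One
    character for each element of \<open>R\<close> is why the character module is a product indexed
    by \<open>R\<close>.\<close>
  have "\<exists>\<chi>. character R (carrier R) \<chi> \<and> (\<forall>x\<in>K. \<chi> x = 1) \<and> (i \<in> carrier R \<longrightarrow> i \<notin> K \<longrightarrow> \<chi> i \<noteq> 1)" for i
  proof -
    obtain \<chi> where "character S (carrier S) \<chi>" "\<And>x. x \<in> K \<Longrightarrow> \<chi> x = 1"
      "i \<in> carrier S \<Longrightarrow> i \<notin> K \<Longrightarrow> \<chi> i \<noteq> 1"
      using character_extend[OF right_module_regular K triv, of i] by metis
    then show ?thesis by (intro exI[of _ \<chi>]) (simp add: reg)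
  qed
  then obtain \<chi> where \<chi>: "\<And>i. character R (carrier R) (\<chi> i)" "\<And>i x. x \<in> K \<Longrightarrow> \<chi> i x = 1"
    "\<And>i. i \<in> carrier R \<Longrightarrow> i \<notin> K \<Longrightarrow> \<chi> i i \<noteq> 1"
    by metis
  \<comment> \<open>All these characters together form one element whose annihilator is exactly
    \<open>K\<close>.\<close>
  define e0 where "e0 p = (if p \<in> carrier R \<times> carrier R then \<chi> (fst p) (snd p) else 1)" for p
  have e0: "e0 \<in> carrier ?M"
    using character_add[OF \<chi>(1)] character_nz[OF \<chi>(1)]
    by (auto simp: char_module_simps e0_def character_def)
  have ann0: "a \<odot>\<^bsub>?M\<^esub> e0 = \<zero>\<^bsub>?M\<^esub> \<longleftrightarrow> a \<in> K" if a: "a \<in> carrier R" for a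
  proof
    assume "a \<odot>\<^bsub>?M\<^esub> e0 = \<zero>\<^bsub>?M\<^esub>"
    from fun_cong[OF this, of "(a, \<one>)"] have "\<chi> a a = 1"
      using a by (simp add: char_module_simps e0_def)
    then show "a \<in> K" using \<chi>(3)[OF a] by blast
  next
    assume "a \<in> K"
    then have "\<chi> i (a \<otimes> r) = 1" if "r \<in> carrier R" for i r
      using \<chi>(2) right_ideal_mult[OF K _ that] by blast
    then show "a \<odot>\<^bsub>?M\<^esub> e0 = \<zero>\<^bsub>?M\<^esub>"
      using a by (auto simp: char_module_simps e0_def fun_eq_iff)
  qed
  obtain H q where H: "submodule H R ?M" "(\<lambda>a. a \<odot>\<^bsub>?M\<^esub> e0) ` carrier R \<subseteq> H"
    and q: "q \<in> rmod_hom R ?M (submod ?M H)" "\<And>x. x \<in> H \<Longrightarrow> q x = x"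
    and ess: "\<And>y. y \<in> H \<Longrightarrow> y \<noteq> \<zero>\<^bsub>?M\<^esub> \<Longrightarrow> \<exists>r\<in>carrier R.
      r \<odot>\<^bsub>?M\<^esub> y \<in> (\<lambda>a. a \<odot>\<^bsub>?M\<^esub> e0) ` carrier R \<and> r \<odot>\<^bsub>?M\<^esub> y \<noteq> \<zero>\<^bsub>?M\<^esub>"
    by (rule char_module_hull[OF M.submodule_cyclic[OF e0]]) (rule that)
  let ?H = "submod ?M H"
  have rH: "right_module R ?H" by (rule M.right_module_submod[OF H(1)])
  obtain g0 :: "('a \<times> 'a \<Rightarrow> complex) \<Rightarrow> 'u" where "inj_on g0 (carrier ?M)"
    using char_module_code by blast
  then have "inj_on g0 (carrier ?H)"
    using submodule_subset[OF H(1)] by (auto intro: inj_on_subset)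
  from transport_rmod[OF rH this]
  obtain E :: "('a, 'u) module" where E: "right_module R E" "g0 \<in> rmod_hom R ?H E"
    "bij_betw g0 (carrier ?H) (carrier E)" by blast
  interpret E: right_module R E by (rule E)
  have ge: "g0 \<in> rmod_epi R ?H E" using E by (auto simp: rmod_epi_def bij_betw_def)
  have inj: "inj_on g0 H" using E(3) by (simp add: bij_betw_def)
  have "(\<lambda>x. x) \<in> rmod_hom R ?H ?H" by (auto simp: rmod_hom_def)
  from rmod_hom_factor[OF rH ge this] inj
  obtain v where v: "v \<in> rmod_hom R E ?H" "\<And>x. x \<in> H \<Longrightarrow> v (g0 x) = x"
    by (auto simp: inj_on_def)
  have gv: "g0 (v y) = y" if "y \<in> carrier E" for y
    using rmod_epi_ex[OF ge that] v(2) by auto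
  have g0z: "g0 x = \<zero>\<^bsub>E\<^esub> \<longleftrightarrow> x = \<zero>\<^bsub>?M\<^esub>" if "x \<in> H" for x
    using rmod_hom_zero[OF rH E(1,2)] inj_onD[OF inj] that submodule_zero[OF H(1)] by auto
  define e where "e = g0 e0"
  have e0H: "e0 \<in> H" using H(2) M.smult_one[OF e0] by force
  have e: "e \<in> carrier E" using rmod_hom_closed[OF E(2)] e0H by (simp add: e_def)
  have ge0: "g0 (a \<odot>\<^bsub>?M\<^esub> e0) = a \<odot>\<^bsub>E\<^esub> e" if "a \<in> carrier R" for a
    using rmod_hom_smult[OF E(2) that, of e0] e0H by (simp add: e_def)
  have ann: "a \<odot>\<^bsub>E\<^esub> e = \<zero>\<^bsub>E\<^esub> \<longleftrightarrow> a \<in> K" if "a \<in> carrier R" for a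
    using g0z[of "a \<odot>\<^bsub>?M\<^esub> e0"] submodule_smult[OF H(1) that e0H] ann0[OF that] ge0[OF that] by simp
  have ess': "\<exists>r\<in>carrier R. \<exists>x\<in>carrier R. r \<odot>\<^bsub>E\<^esub> y = x \<odot>\<^bsub>E\<^esub> e \<and> x \<notin> K"
    if y: "y \<in> carrier E" "y \<noteq> \<zero>\<^bsub>E\<^esub>" for y
  proof -
    have vy: "v y \<in> H" using rmod_hom_closed[OF v(1) y(1)] by simp
    have "v y \<noteq> \<zero>\<^bsub>?M\<^esub>" using g0z[OF vy] gv[OF y(1)] y(2) by simp
    from ess[OF vy this] obtain r x where rx: "r \<in> carrier R" "x \<in> carrier R"
      "r \<odot>\<^bsub>?M\<^esub> v y = x \<odot>\<^bsub>?M\<^esub> e0" "r \<odot>\<^bsub>?M\<^esub> v y \<noteq> \<zero>\<^bsub>?M\<^esub>" by auto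
    have "r \<odot>\<^bsub>E\<^esub> y = g0 (r \<odot>\<^bsub>?M\<^esub> v y)"
      using rmod_hom_smult[OF E(2) rx(1), of "v y"] vy gv[OF y(1)] by simp
    then have "r \<odot>\<^bsub>E\<^esub> y = x \<odot>\<^bsub>E\<^esub> e" using rx ge0 by simp
    moreover have "x \<notin> K" using rx ann0 by auto
    ultimately show ?thesis using rx by blast
  qed
  have "injective_rmod R E"
    unfolding injective_rmod_def
  proof (intro conjI allI impI ballI E)
    fix A B :: "('a, 'u) module" and i f
    assume *: "right_module R A" "right_module R B" "i \<in> rmod_mono R A B" "f \<in> rmod_hom R A E"
    have "(\<lambda>x. v (f x)) \<in> rmod_hom R A ?M"
      using hom_submod_inclusion[OF rmod_hom_comp[OF *(4) v(1)]] submodule_subset[OF H(1)] .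
    from char_module_extend[OF *(1-3) this]
    obtain h where h: "h \<in> rmod_hom R B ?M" "\<And>x. x \<in> carrier A \<Longrightarrow> h (i x) = v (f x)" by blast
    \<comment> \<open>Extend into the character module, retract onto the hull, return to the
      universe.\<close>
    have "(\<lambda>y. g0 (q (h y))) \<in> rmod_hom R B E"
      using rmod_hom_comp[OF rmod_hom_comp[OF h(1) q(1)] E(2)] .
    moreover have "g0 (q (h (i x))) = f x" if "x \<in> carrier A" for x
    proof -
      have fx: "f x \<in> carrier E" using rmod_hom_closed[OF *(4) that] .
      then have "v (f x) \<in> H" using rmod_hom_closed[OF v(1)] by fastforce
      then show ?thesis using h(2)[OF that] q(2) gv[OF fx] by simp
    qed
    ultimately show "\<exists>g\<in>rmod_hom R B E. \<forall>x\<in>carrier A. g (i x) = f x"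
      by (intro bexI[of _ "\<lambda>y. g0 (q (h y))"]) auto
  qed
  moreover have "indecomposable_rmod R E"
    unfolding indecomposable_rmod_def
  proof (intro conjI allI impI E)
    show "carrier E \<noteq> {\<zero>\<^bsub>E\<^esub>}" using ann[of \<one>] K1 e E.smult_one[OF e] by auto
    fix A B assume AB: "submodule A R E" "submodule B R E" "A \<inter> B = {\<zero>\<^bsub>E\<^esub>}" "A <+>\<^bsub>E\<^esub> B = carrier E"
    \<comment> \<open>Every nonzero submodule meets the copy of \<open>R/K\<close>, so two nonzero
      submodules with zero intersection would give two such submodules of
      \<open>R/K\<close>.\<close>
    have ex: "\<exists>x. x \<in> carrier R - K \<and> x \<odot>\<^bsub>E\<^esub> e \<in> C" if C: "submodule C R E" "C \<noteq> {\<zero>\<^bsub>E\<^esub>}" for C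
    proof -
      obtain y where "y \<in> C" "y \<noteq> \<zero>\<^bsub>E\<^esub>" using C submodule_zero[OF C(1)] by blast
      with ess'[of y] submodule_mem[OF C(1)] obtain r x
        where "r \<in> carrier R" "x \<in> carrier R" "r \<odot>\<^bsub>E\<^esub> y = x \<odot>\<^bsub>E\<^esub> e" "x \<notin> K" by blast
      then show ?thesis using submodule_smult[OF C(1) _ \<open>y \<in> C\<close>, of r] by (intro exI[of _ x]) auto
    qed
    show "A = {\<zero>\<^bsub>E\<^esub>} \<or> B = {\<zero>\<^bsub>E\<^esub>}"
    proof (rule ccontr)
      assume "\<not> (A = {\<zero>\<^bsub>E\<^esub>} \<or> B = {\<zero>\<^bsub>E\<^esub>})"
      then obtain x y where x: "x \<in> carrier R - K" "x \<odot>\<^bsub>E\<^esub> e \<in> A" and y: "y \<in> carrier R - K" "y \<odot>\<^bsub>E\<^esub> e \<in> B"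
        using ex[OF AB(1)] ex[OF AB(2)] by blast
      obtain r s where rs: "r \<in> carrier R" "s \<in> carrier R" "x \<otimes> r \<ominus> y \<otimes> s \<in> K" "x \<otimes> r \<notin> K"
        using uniform[OF x(1) y(1)] by blast
      have "(x \<otimes> r \<ominus> y \<otimes> s) \<odot>\<^bsub>E\<^esub> e = \<zero>\<^bsub>E\<^esub>"
        using ann rs x y by simp
      moreover have "(x \<otimes> r \<ominus> y \<otimes> s) \<odot>\<^bsub>E\<^esub> e = (x \<otimes> r) \<odot>\<^bsub>E\<^esub> e \<ominus>\<^bsub>E\<^esub> (y \<otimes> s) \<odot>\<^bsub>E\<^esub> e"
        using rs x y e by (simp add: a_minus_def E.smult_l_distr E.smult_l_minus)
      ultimately have "(x \<otimes> r) \<odot>\<^bsub>E\<^esub> e = (y \<otimes> s) \<odot>\<^bsub>E\<^esub> e"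
        using E.minus_eq_zero_iff rs x y e E.smult_closed by simp
      moreover have "(x \<otimes> r) \<odot>\<^bsub>E\<^esub> e \<in> A" "(y \<otimes> s) \<odot>\<^bsub>E\<^esub> e \<in> B"
        using submodule_smult[OF AB(1) rs(1) x(2)] submodule_smult[OF AB(2) rs(2) y(2)] rs x y e
        by (simp_all add: E.smult_assoc)
      ultimately have "(x \<otimes> r) \<odot>\<^bsub>E\<^esub> e \<in> A \<inter> B" by simp
      then show False using AB(3) ann[of "x \<otimes> r"] rs x by simp
    qed
  qed
  ultimately have "E \<in> indec_injectives R" by (simp add: indec_injectives_def)
  then show ?thesis using that e ann ess' by blast
qed

end

section \<open>Right noetherian domains\<close>

locale noetherian_domain = universe_ring R U for R :: "('a, 'r) ring_scheme" (structure) and U :: "'u itself" +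
  assumes noetherian: "right_noetherian R" and dom: "noncomm_domain R"
begin

section \<open>Cancellation, maximal condition, Ore condition and uniform quotients\<close>

lemma one_neq_zero: "\<one> \<noteq> \<zero>"
  using dom by (simp add: noncomm_domain_def)

lemma integral: "a \<otimes> b = \<zero> \<Longrightarrow> a \<in> carrier R \<Longrightarrow> b \<in> carrier R \<Longrightarrow> a = \<zero> \<or> b = \<zero>"
  using dom by (simp add: noncomm_domain_def)

lemma minus_eq_zero_iff: "x \<in> carrier R \<Longrightarrow> y \<in> carrier R \<Longrightarrow> x \<ominus> y = \<zero> \<longleftrightarrow> x = y"
  using right_module.minus_eq_zero_iff[OF right_module_regular, of x y] by (simp add: a_minus_regular)

lemma left_cancel:
  assumes "a \<otimes> b = a \<otimes> c" "a \<noteq> \<zero>" "a \<in> carrier R" "b \<in> carrier R" "c \<in> carrier R"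
  shows "b = c"
proof -
  have "a \<otimes> (b \<ominus> c) = \<zero>"
    using assms by (simp add: a_minus_def r_distr r_minus r_neg)
  then have "b \<ominus> c = \<zero>" using integral[of a "b \<ominus> c"] assms by simp
  then show ?thesis using minus_eq_zero_iff assms by simp
qed

lemma right_cancel:
  assumes "a \<otimes> c = b \<otimes> c" "c \<noteq> \<zero>" "a \<in> carrier R" "b \<in> carrier R" "c \<in> carrier R"
  shows "a = b"
proof -
  have "(a \<ominus> b) \<otimes> c = \<zero>"
    using assms by (simp add: a_minus_def l_distr l_minus r_neg)
  then have "a \<ominus> b = \<zero>" using integral[of "a \<ominus> b" c] assms by simp
  then show ?thesis using minus_eq_zero_iff assms by simp
qed

text \<open>A finite generating set of the union of a chain lies in one member of the chain, which
  is then equal to the union.\<close>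

lemma maximal_right_ideal:
  assumes "\<A> \<noteq> {}" and A: "\<And>A. A \<in> \<A> \<Longrightarrow> right_ideal A R"
  shows "\<exists>K\<in>\<A>. \<forall>X\<in>\<A>. K \<subseteq> X \<longrightarrow> X = K"
proof (rule subset_Zorn_nonempty[OF assms(1)])
  fix \<C> assume \<C>: "\<C> \<noteq> {}" "subset.chain \<A> \<C>"
  then have c: "\<And>C. C \<in> \<C> \<Longrightarrow> right_ideal C R" "\<And>C C'. C \<in> \<C> \<Longrightarrow> C' \<in> \<C> \<Longrightarrow> C \<subseteq> C' \<or> C' \<subseteq> C"
    using A unfolding subset_chain_def by (simp add: subset_iff, blast)
  have "right_ideal (\<Union>\<C>) R"
    by (rule right_module.submodule_Union_chain[OF right_module_regular c(1) \<C>(1) c(2)])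
  then obtain F where F: "finite F" "F \<subseteq> carrier S" "\<Union>\<C> = \<Inter>{K. right_ideal K R \<and> F \<subseteq> K}"
    using noetherian unfolding right_noetherian_def fin_gen_submodule_def by auto
  then have "F \<subseteq> \<Union>\<C>" by auto
  then obtain C where C: "C \<in> \<C>" "F \<subseteq> C"
    using finite_subset_Union_chain[OF F(1) _ \<C>] by metis
  then have "\<Union>\<C> \<subseteq> C" using F(3) c(1) by auto
  then have "\<Union>\<C> = C" using C(1) by auto
  then show "\<Union>\<C> \<in> \<A>" using C(1) \<C>(2) by (auto simp: subset.chain_def)
qed

text \<open>If \<open>xR \<inter> yR = 0\<close>, the right ideals \<open>xR + yxR + \<dots> + y\<^sup>n\<^sup>-\<^sup>1xR\<close> would increase strictly.\<close>

lemma right_ore: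
  assumes x: "x \<in> carrier R" "x \<noteq> \<zero>" and y: "y \<in> carrier R" "y \<noteq> \<zero>"
  shows "\<exists>r\<in>carrier R. \<exists>s\<in>carrier R. x \<otimes> r = y \<otimes> s \<and> x \<otimes> r \<noteq> \<zero>"
proof (rule ccontr)
  assume "\<not> ?thesis"
  then have no: "x \<otimes> r = \<zero>" if "r \<in> carrier R" "s \<in> carrier R" "x \<otimes> r = y \<otimes> s" for r s
    using that by blast
  \<comment> \<open>\<open>I (n + 1) = xR + y (I n)\<close>: the recursion multiplies on the left by
    \<open>y\<close>, which cancellation can undo.\<close>
  define I where "I = rec_nat {\<zero>} (\<lambda>_ A. {x \<otimes> r \<oplus> y \<otimes> u | r u. r \<in> carrier R \<and> u \<in> A})"
  have I0: "I 0 = {\<zero>}" and ISuc: "I (Suc n) = {x \<otimes> r \<oplus> y \<otimes> u | r u. r \<in> carrier R \<and> u \<in> I n}" for n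
    by (simp_all add: I_def)
  have ideal: "right_ideal (I n) R" for n
  proof (induction n)
    case 0
    then show ?case by (simp add: I0 right_ideal_zero_set)
  next
    case (Suc n)
    have "I (Suc n) = {u \<oplus> v | u v. u \<in> (\<lambda>r. x \<otimes> r) ` carrier R \<and> v \<in> (\<lambda>r. y \<otimes> r) ` I n}"
      by (auto simp: ISuc)
    moreover have "right_ideal ((\<lambda>r. x \<otimes> r) ` carrier R) R"
      using right_module.submodule_cyclic[OF right_module_regular, of x] x by simp
    moreover have "right_ideal ((\<lambda>r. y \<otimes> r) ` I n) R"
      using right_module.submodule_image[OF right_module_regular right_module_regular mult_left_hom[OF y(1)] Suc] .
    ultimately show ?case
      using right_module.submodule_sum[OF right_module_regular] by simp
  qed
  have mono: "I n \<subseteq> I (Suc n)" for n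
  proof (induction n)
    case 0
    show ?case using right_ideal_zero[OF ideal] by (simp add: I0)
  next
    case (Suc n)
    then show ?case unfolding ISuc[of n] ISuc[of "Suc n"] by blast
  qed
  \<comment> \<open>An inclusion descends by one stage: \<open>y u = x r + y v\<close> puts
    \<open>x r\<close> in \<open>xR \<inter> yR = 0\<close>, so cancelling \<open>y\<close> gives
    \<open>u = v\<close>.\<close>
  have strict: "\<not> I (Suc n) \<subseteq> I n" for n
  proof (induction n)
    case 0
    have "x \<otimes> \<one> \<oplus> y \<otimes> \<zero> \<in> I (Suc 0)" unfolding ISuc I0 by blast
    then show ?case using x y by (auto simp: I0)
  next
    case (Suc n)
    show ?case
    proof
      assume *: "I (Suc (Suc n)) \<subseteq> I (Suc n)"
      have "u \<in> I n" if u: "u \<in> I (Suc n)" for u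
      proof -
        have uR: "u \<in> carrier R" using right_ideal_mem[OF ideal u] .
        have "x \<otimes> \<zero> \<oplus> y \<otimes> u \<in> I (Suc (Suc n))" unfolding ISuc[of "Suc n"] using u by blast
        with * have "y \<otimes> u \<in> I (Suc n)" using x y uR by auto
        then obtain r v where rv: "r \<in> carrier R" "v \<in> I n" "y \<otimes> u = x \<otimes> r \<oplus> y \<otimes> v"
          unfolding ISuc[of n] by blast
        have vR: "v \<in> carrier R" using right_ideal_mem[OF ideal rv(2)] .
        have "y \<otimes> (u \<ominus> v) = x \<otimes> r"
          using rv(1,3) vR uR x y by (simp add: a_minus_def r_distr r_minus a_assoc r_neg)
        then have "x \<otimes> r = \<zero>" using no[of r "u \<ominus> v"] rv(1) uR vR by simp
        then have "y \<otimes> u = y \<otimes> v" using rv(3) y vR by simp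
        then show ?thesis using left_cancel[OF _ y(2,1) uR vR] rv(2) by simp
      qed
      then show False using Suc by blast
    qed
  qed
  have "\<exists>K\<in>range I. \<forall>X\<in>range I. K \<subseteq> X \<longrightarrow> X = K"
    by (rule maximal_right_ideal) (use ideal in auto)
  then obtain n where "\<forall>X\<in>range I. I n \<subseteq> X \<longrightarrow> X = I n" by blast
  then have "I (Suc n) = I n" using mono by blast
  then show False using strict[of n] by blast
qed

text \<open>\<open>R/K\<close> is a nonzero uniform module: any two nonzero cyclic submodules meet
  nontrivially. This makes its injective hull a point of the spectrum.\<close>

definition uniform_ideal where
  "uniform_ideal K \<longleftrightarrow> right_ideal K R \<and> \<one> \<notin> K \<and> (\<forall>x\<in>carrier R - K. \<forall>y\<in>carrier R - K.
     \<exists>r\<in>carrier R. \<exists>s\<in>carrier R. x \<otimes> r \<ominus> y \<otimes> s \<in> K \<and> x \<otimes> r \<notin> K)"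

text \<open>This is the Ore condition; the resulting hull of \<open>R\<close> will be the generic
  point.\<close>

lemma uniform_zero: "uniform_ideal {\<zero>}"
  unfolding uniform_ideal_def
proof (intro conjI ballI)
  fix x y assume "x \<in> carrier R - {\<zero>}" "y \<in> carrier R - {\<zero>}"
  then obtain r s where rs: "r \<in> carrier R" "s \<in> carrier R" "x \<otimes> r = y \<otimes> s" "x \<otimes> r \<noteq> \<zero>"
    "y \<in> carrier R"
    using right_ore[of x y] by auto
  then show "\<exists>r\<in>carrier R. \<exists>s\<in>carrier R. x \<otimes> r \<ominus> y \<otimes> s \<in> {\<zero>} \<and> x \<otimes> r \<notin> {\<zero>}"
    by (intro bexI[of _ r] bexI[of _ s]) (simp_all add: a_minus_def r_neg)
qed (use one_neq_zero right_ideal_zero_set in auto)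

text \<open>For a maximal right ideal \<open>K\<close> the module \<open>R/K\<close> is simple,
  hence uniform: \<open>x\<close> already lies in \<open>K + yR\<close>, so the multiplier of
  \<open>x\<close> can be \<open>\<one>\<close>.\<close>

lemma uniform_maximal:
  assumes I: "right_ideal I R" "\<one> \<notin> I"
  obtains K where "uniform_ideal K" "I \<subseteq> K"
proof -
  define \<A> where "\<A> = {K. right_ideal K R \<and> I \<subseteq> K \<and> \<one> \<notin> K}"
  have "\<exists>K\<in>\<A>. \<forall>X\<in>\<A>. K \<subseteq> X \<longrightarrow> X = K"
    by (rule maximal_right_ideal) (use I in \<open>auto simp: \<A>_def\<close>)
  then obtain K where K: "K \<in> \<A>" and max: "\<And>X. X \<in> \<A> \<Longrightarrow> K \<subseteq> X \<Longrightarrow> X = K" by blast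
  have K': "right_ideal K R" "I \<subseteq> K" "\<one> \<notin> K" using K by (simp_all add: \<A>_def)
  have "\<exists>r\<in>carrier R. \<exists>s\<in>carrier R. x \<otimes> r \<ominus> y \<otimes> s \<in> K \<and> x \<otimes> r \<notin> K"
    if x: "x \<in> carrier R - K" and y: "y \<in> carrier R - K" for x y
  proof -
    have yR: "y \<in> carrier R" and xR: "x \<in> carrier R" using x y by auto
    note adj = right_ideal_adjoin[OF K'(1) yR]
    have "adjoin R K y \<noteq> K" using adj(3) y by auto
    then have "adjoin R K y \<notin> \<A>" using max[OF _ adj(2)] by blast
    then have "\<one> \<in> adjoin R K y" using adj(1,2) K'(2) by (auto simp: \<A>_def)
    then have "x \<in> adjoin R K y" using right_ideal_eq_carrier[OF adj(1)] x by auto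
    then obtain k s where ks: "k \<in> K" "s \<in> carrier R" "x = k \<oplus> y \<otimes> s" by (auto simp: adjoin_def)
    have "x \<otimes> \<one> \<ominus> y \<otimes> s = k"
      using ks(2) right_ideal_mem[OF K'(1) ks(1)] xR yR
      by (simp add: a_minus_def) (simp add: ks(3) a_assoc r_neg)
    then show ?thesis using ks x xR by (intro bexI[of _ \<one>] bexI[of _ s]) auto
  qed
  then have "uniform_ideal K" using K' by (simp add: uniform_ideal_def)
  then show ?thesis using that K'(2) by blast
qed

section \<open>Points of the spectrum and the Gabriel filters they determine\<close>

lemma spec_point_indec: "p \<in> spec_points R \<Longrightarrow> E \<in> p \<Longrightarrow> E \<in> indec_injectives R"
  by (auto simp: spec_points_def quotient_def)

lemma rmod_iso_refl: "rmod_iso R M M"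
  unfolding rmod_iso_def by (intro bexI[of _ "\<lambda>x. x"]) (auto simp: rmod_hom_def bij_betw_def)

lemma spec_point_nonempty: "p \<in> spec_points R \<Longrightarrow> p \<noteq> {}"
  unfolding spec_points_def quotient_def using rmod_iso_refl by fast

lemma indec_injectiveD:
  assumes "E \<in> indec_injectives R"
  shows "right_module R E" "injective_rmod R E" "carrier E \<noteq> {\<zero>\<^bsub>E\<^esub>}"
  using assms by (auto simp: indec_injectives_def injective_rmod_def indecomposable_rmod_def)

text \<open>\<open>basic_open\<close> quantifies over all representatives of a point, but vanishing
  of maps passes along isomorphisms of the target, so one representative decides.\<close>

lemma spec_point_of:
  assumes E: "(E :: ('a, 'u) module) \<in> indec_injectives R"
  obtains p where "p \<in> spec_points R" "E \<in> p"
    "\<And>N :: ('a, 'u) module. hom_trivial R N E \<Longrightarrow> p \<in> basic_open R N"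
proof -
  let ?r = "{(E :: ('a, 'u) module, F :: ('a, 'u) module). E \<in> indec_injectives R \<and> F \<in> indec_injectives R \<and> rmod_iso R E F}"
  define p where "p = ?r `` {E}"
  have p: "p \<in> spec_points R" using E unfolding spec_points_def p_def by (rule Equiv_Relations.quotientI)
  have "E \<in> p" using E by (simp add: p_def rmod_iso_refl)
  moreover have "p \<in> basic_open R N" if N: "hom_trivial R N E" for N :: "('a, 'u) module"
    unfolding basic_open_def
  proof (intro CollectI conjI p ballI)
    fix F assume "F \<in> p"
    then have F: "F \<in> indec_injectives R" "rmod_iso R E F" by (simp_all add: p_def)
    obtain k where k: "k \<in> rmod_hom R F E" "inj_on k (carrier F)"
      using rmod_iso_sym[OF indec_injectiveD(1)[OF E] F(2)] by (auto simp: rmod_iso_def bij_betw_def)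
    have k0: "\<And>y. y \<in> carrier F \<Longrightarrow> k y = \<zero>\<^bsub>E\<^esub> \<Longrightarrow> y = \<zero>\<^bsub>F\<^esub>"
      using rmod_hom_inj_iff[OF indec_injectiveD(1)[OF F(1)] indec_injectiveD(1)[OF E] k(1)] k(2) by simp
    show "hom_trivial R N F"
      unfolding hom_trivial_def
    proof (intro ballI)
      fix h x assume h: "h \<in> rmod_hom R N F" "x \<in> carrier N"
      show "h x = \<zero>\<^bsub>F\<^esub>"
        using k0[OF rmod_hom_closed[OF h]] hom_trivialD[OF N rmod_hom_comp[OF h(1) k(1)] h(2)] by simp
    qed
  qed
  ultimately show ?thesis using that p by blast
qed

lemma uniform_point:
  assumes "uniform_ideal K"
  obtains p and E :: "('a, 'u) module" and e where "p \<in> spec_points R" "E \<in> p" "e \<in> carrier E"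
    "\<And>a. a \<in> carrier R \<Longrightarrow> a \<odot>\<^bsub>E\<^esub> e = \<zero>\<^bsub>E\<^esub> \<longleftrightarrow> a \<in> K"
    "\<And>y. y \<in> carrier E \<Longrightarrow> y \<noteq> \<zero>\<^bsub>E\<^esub> \<Longrightarrow>
      \<exists>r\<in>carrier R. \<exists>x\<in>carrier R. r \<odot>\<^bsub>E\<^esub> y = x \<odot>\<^bsub>E\<^esub> e \<and> x \<notin> K"
    "\<And>N :: ('a, 'u) module. hom_trivial R N E \<Longrightarrow> p \<in> basic_open R N"
proof -
  have K: "right_ideal K R" "\<one> \<notin> K" "\<And>x y. x \<in> carrier R - K \<Longrightarrow> y \<in> carrier R - K \<Longrightarrow>
     \<exists>r\<in>carrier R. \<exists>s\<in>carrier R. x \<otimes> r \<ominus> y \<otimes> s \<in> K \<and> x \<otimes> r \<notin> K"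
    using assms unfolding uniform_ideal_def by simp_all
  obtain E :: "('a, 'u) module" and e where E: "E \<in> indec_injectives R" "e \<in> carrier E"
    "\<And>a. a \<in> carrier R \<Longrightarrow> a \<odot>\<^bsub>E\<^esub> e = \<zero>\<^bsub>E\<^esub> \<longleftrightarrow> a \<in> K"
    "\<And>y. y \<in> carrier E \<Longrightarrow> y \<noteq> \<zero>\<^bsub>E\<^esub> \<Longrightarrow>
      \<exists>r\<in>carrier R. \<exists>x\<in>carrier R. r \<odot>\<^bsub>E\<^esub> y = x \<odot>\<^bsub>E\<^esub> e \<and> x \<notin> K"
    by (rule injective_hull[OF K(1,2)], erule (1) K(3), rule that)
  obtain p where "p \<in> spec_points R" "E \<in> p" "\<And>N :: ('a, 'u) module. hom_trivial R N E \<Longrightarrow> p \<in> basic_open R N"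
    by (rule spec_point_of[OF E(1)]) (rule that)
  then show ?thesis using that[OF _ _ E(2-4)] by blast
qed

text \<open>If \<open>A\<close> kills \<open>e\<close>, then \<open>r \<mapsto> e r\<close> factors
  through \<open>R/A\<close>. This module is torsion, so it has no nonzero map to \<open>E\<close>;
  the value at \<open>\<one>\<close> is \<open>e\<close>.\<close>

lemma gabriel_annihilates:
  fixes M E :: "('a, 'u) module"
  assumes M: "right_module R M" and E: "injective_rmod R E" and "hom_trivial R M E"
    and A: "A \<in> gabriel R (generated_torsion_class R M)"
    and e: "e \<in> carrier E" "\<And>a. a \<in> A \<Longrightarrow> a \<odot>\<^bsub>E\<^esub> e = \<zero>\<^bsub>E\<^esub>"
  shows "e = \<zero>\<^bsub>E\<^esub>"
proof -
  note T = torsion_class_generated[OF M]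
  have A': "right_ideal A R" using gabriel_right_ideal[OF T(1) A] .
  have rE: "right_module R E" using E by (simp add: injective_rmod_def)
  interpret E: right_module R E by (rule rE)
  obtain Z :: "('a, 'u) module" and p where Z: "is_quotient R S A Z p"
    using cyclic_realization[OF A'] .
  have "Z \<in> generated_torsion_class R M" using gabriel_iff[OF A' Z T(1)] A by blast
  then have triv: "hom_trivial R Z E"
    using generated_torsion_class_orthogonal[OF E M assms(3)] by blast
  obtain h where h: "h \<in> rmod_hom R Z E" "\<And>r. r \<in> carrier S \<Longrightarrow> h (p r) = r \<odot>\<^bsub>E\<^esub> e"
    using is_quotient_hom[OF right_module_regular rE Z E.cyclic_hom[OF e(1)]] e(2) by blast
  have "h (p \<one>) = \<zero>\<^bsub>E\<^esub>"
    using hom_trivialD[OF triv h(1) rmod_hom_closed[OF is_quotientD(3)[OF Z]]] by simp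
  then show ?thesis using h(2)[of \<one>] E.smult_one[OF e(1)] by simp
qed

text \<open>A right ideal maximal among those outside the Gabriel filter is uniform, and the injective hull
  of the quotient by it is a point of \<open>[M]\<close>.\<close>

lemma gabriel_generatedI:
  fixes M :: "('a, 'u) module"
  assumes M: "right_module R M" and A: "right_ideal A R"
    and *: "\<And>p E e. p \<in> basic_open R M \<Longrightarrow> E \<in> p \<Longrightarrow> e \<in> carrier E \<Longrightarrow>
      (\<And>a. a \<in> A \<Longrightarrow> a \<odot>\<^bsub>E\<^esub> e = \<zero>\<^bsub>E\<^esub>) \<Longrightarrow> e = \<zero>\<^bsub>E\<^esub>"
  shows "A \<in> gabriel R (generated_torsion_class R M)"
proof (rule ccontr)
  let ?T = "generated_torsion_class R M"
  note T = torsion_class_generated[OF M]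
  interpret M: right_module R M by (rule M)
  assume "A \<notin> gabriel R ?T"
  define \<A> where "\<A> = {K. right_ideal K R \<and> A \<subseteq> K \<and> K \<notin> gabriel R ?T}"
  have "\<exists>K\<in>\<A>. \<forall>X\<in>\<A>. K \<subseteq> X \<longrightarrow> X = K"
    by (rule maximal_right_ideal) (use A \<open>A \<notin> gabriel R ?T\<close> in \<open>auto simp: \<A>_def\<close>)
  then obtain K where K: "K \<in> \<A>" and max: "\<And>X. X \<in> \<A> \<Longrightarrow> K \<subseteq> X \<Longrightarrow> X = K" by blast
  have K': "right_ideal K R" "A \<subseteq> K" "K \<notin> gabriel R ?T" using K by (simp_all add: \<A>_def)
  \<comment> \<open>Right ideals strictly above \<open>K\<close> are in the filter, by
    maximality.\<close>
  have adj: "adjoin R K x \<in> gabriel R ?T" if x: "x \<in> carrier R" "x \<notin> K" for x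
  proof -
    note adj = right_ideal_adjoin[OF K'(1) x(1)]
    have "adjoin R K x \<noteq> K" using adj(3) x by auto
    then have "adjoin R K x \<notin> \<A>" using max[OF _ adj(2)] by blast
    then show ?thesis using adj(1,2) K'(2) by (auto simp: \<A>_def)
  qed
  \<comment> \<open>Otherwise the extension property would put \<open>K\<close> itself in the
    filter. Both arguments below, for uniformity and for \<open>(M, E) = 0\<close>, end in a
    contradiction to this.\<close>
  have no_colon: "colon R K x \<notin> gabriel R ?T" if "x \<in> carrier R" "x \<notin> K" for x
    using gabriel_extension[OF T(1) K'(1) that(1) adj[OF that]] K'(3) by blast
  \<comment> \<open>The annihilator of zero shows that \<open>R\<close> is in the filter, so
    \<open>K\<close> is proper.\<close>
  have "{r \<in> carrier R. r \<odot>\<^bsub>M\<^esub> \<zero>\<^bsub>M\<^esub> = \<zero>\<^bsub>M\<^esub>} \<in> gabriel R ?T"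
    by (rule gabriel_annihilator[OF T]) simp
  moreover have "{r \<in> carrier R. r \<odot>\<^bsub>M\<^esub> \<zero>\<^bsub>M\<^esub> = \<zero>\<^bsub>M\<^esub>} = carrier R"
    using M.smult_r_zero by auto
  ultimately have "\<one> \<notin> K" using K'(3) right_ideal_eq_carrier[OF K'(1)] by auto
  moreover have "\<exists>r\<in>carrier R. \<exists>s\<in>carrier R. x \<otimes> r \<ominus> y \<otimes> s \<in> K \<and> x \<otimes> r \<notin> K"
    if x: "x \<in> carrier R - K" and y: "y \<in> carrier R - K" for x y
  proof (rule ccontr)
    assume no: "\<not> ?thesis"
    have xR: "x \<in> carrier R" and yR: "y \<in> carrier R" and xK: "x \<notin> K" and yK: "y \<notin> K" using x y by auto
    have "colon R (adjoin R K y) x \<in> gabriel R ?T"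
      by (rule gabriel_colon[OF T(1) adj[OF yR yK] xR])
    \<comment> \<open>If \<open>xR\<close> and \<open>yR\<close> meet only in zero modulo
      \<open>K\<close>, then \<open>x r = k + y s\<close> forces \<open>x r\<close> into
      \<open>K\<close>.\<close>
    moreover have "colon R (adjoin R K y) x \<subseteq> colon R K x"
    proof
      fix r assume "r \<in> colon R (adjoin R K y) x"
      then obtain k s where r: "r \<in> carrier R" "k \<in> K" "s \<in> carrier R" "x \<otimes> r = k \<oplus> y \<otimes> s"
        by (auto simp: colon_def adjoin_def)
      have "x \<otimes> r \<ominus> y \<otimes> s = k"
        using r right_ideal_mem[OF K'(1) r(2)] yR by (simp add: a_minus_def a_assoc r_neg)
      then have "x \<otimes> r \<ominus> y \<otimes> s \<in> K" using r(2) by simp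
      then have "x \<otimes> r \<in> K" using no r(1,3) by blast
      then show "r \<in> colon R K x" using r(1) by (simp add: colon_def)
    qed
    ultimately have "colon R K x \<in> gabriel R ?T"
      using gabriel_mono[OF T(1) _ right_ideal_colon[OF K'(1) xR]] by blast
    then show False using no_colon[OF xR xK] by blast
  qed
  ultimately have "uniform_ideal K" using K'(1) by (simp add: uniform_ideal_def)
  then obtain p and E :: "('a, 'u) module" and e where p: "p \<in> spec_points R" "E \<in> p" "e \<in> carrier E"
    "\<And>a. a \<in> carrier R \<Longrightarrow> a \<odot>\<^bsub>E\<^esub> e = \<zero>\<^bsub>E\<^esub> \<longleftrightarrow> a \<in> K"
    "\<And>y. y \<in> carrier E \<Longrightarrow> y \<noteq> \<zero>\<^bsub>E\<^esub> \<Longrightarrow>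
      \<exists>r\<in>carrier R. \<exists>x\<in>carrier R. r \<odot>\<^bsub>E\<^esub> y = x \<odot>\<^bsub>E\<^esub> e \<and> x \<notin> K"
    "\<And>N :: ('a, 'u) module. hom_trivial R N E \<Longrightarrow> p \<in> basic_open R N"
    by (rule uniform_point) (rule that)
  interpret E: right_module R E
    using indec_injectiveD(1)[OF spec_point_indec[OF p(1,2)]] .
  \<comment> \<open>A nonzero \<open>h m\<close> has a multiple \<open>x e\<close> with
    \<open>x\<close> outside \<open>K\<close>. The annihilator of the corresponding multiple of
    \<open>m\<close> is then contained in \<open>(K : x)\<close>, although annihilators of elements
    of \<open>M\<close> belong to the filter.\<close>
  have "hom_trivial R M E"
    unfolding hom_trivial_def
  proof (intro ballI, rule ccontr)
    fix h m assume h: "h \<in> rmod_hom R M E" and m: "m \<in> carrier M" and "h m \<noteq> \<zero>\<^bsub>E\<^esub>"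
    then obtain r x where rx: "r \<in> carrier R" "x \<in> carrier R" "r \<odot>\<^bsub>E\<^esub> h m = x \<odot>\<^bsub>E\<^esub> e" "x \<notin> K"
      using p(5)[OF rmod_hom_closed[OF h m]] by blast
    let ?m = "r \<odot>\<^bsub>M\<^esub> m"
    have m': "?m \<in> carrier M" "h ?m = x \<odot>\<^bsub>E\<^esub> e"
      using M.smult_closed[OF rx(1) m] rmod_hom_smult[OF h rx(1) m] rx(3) by simp_all
    have "{s \<in> carrier R. s \<odot>\<^bsub>M\<^esub> ?m = \<zero>\<^bsub>M\<^esub>} \<subseteq> colon R K x"
    proof
      fix s assume "s \<in> {s \<in> carrier R. s \<odot>\<^bsub>M\<^esub> ?m = \<zero>\<^bsub>M\<^esub>}"
      then have s: "s \<in> carrier R" "s \<odot>\<^bsub>M\<^esub> ?m = \<zero>\<^bsub>M\<^esub>" by auto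
      have "(x \<otimes> s) \<odot>\<^bsub>E\<^esub> e = h (s \<odot>\<^bsub>M\<^esub> ?m)"
        using rmod_hom_smult[OF h s(1) m'(1)] m'(2) s rx p(3) by (simp add: E.smult_assoc)
      also have "\<dots> = \<zero>\<^bsub>E\<^esub>"
        using rmod_hom_zero[OF M E.right_module_axioms h] s(2) by simp
      finally show "s \<in> colon R K x" using p(4)[of "x \<otimes> s"] rx s by (simp add: colon_def)
    qed
    then have "colon R K x \<in> gabriel R ?T"
      using gabriel_mono[OF T(1) gabriel_annihilator[OF T m'(1)] right_ideal_colon[OF K'(1) rx(2)]] by blast
    then show False using no_colon rx by blast
  qed
  from *[OF p(6)[OF this] p(2,3)] have "e = \<zero>\<^bsub>E\<^esub>"
    using p(4) K'(1,2) right_ideal_mem by blast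
  then show False using p(4)[of \<one>] \<open>\<one> \<notin> K\<close> E.smult_r_zero by simp
qed

abbreviation \<B> :: "('a, 'u) module set set set" where "\<B> \<equiv> basic_opens R"

text \<open>Unpacks the choice of a module in \<open>torsion_class_of\<close>.\<close>

lemma basic_open_torsion:
  assumes "V \<in> \<B>"
  obtains M where "right_module R M" "basic_open R M = V" "torsion_class_of R V = generated_torsion_class R M"
proof -
  have "\<exists>M. fin_presented R M \<and> basic_open R M = V" using assms by (auto simp: basic_opens_def)
  from someI_ex[OF this] show ?thesis
    using that[of "SOME M. fin_presented R M \<and> basic_open R M = V"]
    by (auto simp: torsion_class_of_def fin_presented_def)
qed

lemma basic_openD:
  assumes "V \<in> \<B>" "p \<in> V"
  shows "p \<in> spec_points R"
  using assms by (auto simp: basic_opens_def basic_open_def)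

text \<open>The right-hand side mentions only the points of \<open>V\<close>. The chosen module
  thereby disappears, and passing to a smaller open set can only enlarge the filter.\<close>

lemma gabriel_basic_open_iff:
  assumes V: "V \<in> \<B>"
  shows "A \<in> gabriel R (torsion_class_of R V) \<longleftrightarrow> right_ideal A R \<and>
    (\<forall>p\<in>V. \<forall>E\<in>p. \<forall>e\<in>carrier E. (\<forall>a\<in>A. a \<odot>\<^bsub>E\<^esub> e = \<zero>\<^bsub>E\<^esub>) \<longrightarrow> e = \<zero>\<^bsub>E\<^esub>)"
proof -
  obtain M where M: "right_module R M" "basic_open R M = V"
    "torsion_class_of R V = generated_torsion_class R M" using basic_open_torsion[OF V] .
  have "e = \<zero>\<^bsub>E\<^esub>" if A: "A \<in> gabriel R (generated_torsion_class R M)" and pE: "p \<in> V" "E \<in> p"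
    and e: "e \<in> carrier E" "\<forall>a\<in>A. a \<odot>\<^bsub>E\<^esub> e = \<zero>\<^bsub>E\<^esub>" for p E e
  proof (rule gabriel_annihilates[OF M(1) _ _ A e(1)])
    show "injective_rmod R E"
      using indec_injectiveD(2)[OF spec_point_indec[OF basic_openD[OF V pE(1)] pE(2)]] .
    show "hom_trivial R M E" using pE M(2) by (auto simp: basic_open_def)
  qed (use e(2) in blast)
  moreover have "A \<in> gabriel R (generated_torsion_class R M)"
    if "right_ideal A R"
      and *: "\<forall>p\<in>V. \<forall>E\<in>p. \<forall>e\<in>carrier E. (\<forall>a\<in>A. a \<odot>\<^bsub>E\<^esub> e = \<zero>\<^bsub>E\<^esub>) \<longrightarrow> e = \<zero>\<^bsub>E\<^esub>"
    by (rule gabriel_generatedI[OF M(1) that(1)]) (use * M(2) in blast)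
  moreover have "right_ideal A R" if "A \<in> gabriel R (generated_torsion_class R M)"
    using that by (simp add: gabriel_def)
  ultimately show ?thesis unfolding M(3) by blast
qed

text \<open>The zero ideal kills every element of a point, and points are nonzero modules. For the
  empty set, by contrast, every right ideal is in the filter.\<close>

lemma zero_notin_gabriel:
  assumes "V \<in> \<B>" "p \<in> V"
  shows "{\<zero>} \<notin> gabriel R (torsion_class_of R V)"
proof
  assume *: "{\<zero>} \<in> gabriel R (torsion_class_of R V)"
  have "p \<in> spec_points R" using basic_openD[OF assms] .
  then obtain E where E: "E \<in> p" using spec_point_nonempty by blast
  note E' = indec_injectiveD[OF spec_point_indec[OF \<open>p \<in> spec_points R\<close> E]]
  interpret E: right_module R E by (rule E')
  have "\<forall>e\<in>carrier E. e = \<zero>\<^bsub>E\<^esub>"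
    using * E.smult_l_zero assms(2) E unfolding gabriel_basic_open_iff[OF assms(1)] by blast
  then show False using E'(3) E.M.zero_closed by blast
qed

text \<open>The point is the hull of \<open>R\<close>. A nonzero map to it from a module defining
  \<open>V\<close> would produce an element of that module with zero annihilator, and
  \<open>{\<zero>}\<close> would be in the filter of a nonempty \<open>V\<close>.\<close>

lemma generic_point:
  obtains p where "p \<in> spec_points R" "\<And>V. V \<in> \<B> \<Longrightarrow> V \<noteq> {} \<Longrightarrow> p \<in> V"
proof -
  obtain p and E :: "('a, 'u) module" and e where p: "p \<in> spec_points R" "E \<in> p" "e \<in> carrier E"
    "\<And>a. a \<in> carrier R \<Longrightarrow> a \<odot>\<^bsub>E\<^esub> e = \<zero>\<^bsub>E\<^esub> \<longleftrightarrow> a \<in> {\<zero>}"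
    "\<And>y. y \<in> carrier E \<Longrightarrow> y \<noteq> \<zero>\<^bsub>E\<^esub> \<Longrightarrow>
      \<exists>r\<in>carrier R. \<exists>x\<in>carrier R. r \<odot>\<^bsub>E\<^esub> y = x \<odot>\<^bsub>E\<^esub> e \<and> x \<notin> {\<zero>}"
    "\<And>N :: ('a, 'u) module. hom_trivial R N E \<Longrightarrow> p \<in> basic_open R N"
    by (rule uniform_point[OF uniform_zero]) (rule that)
  interpret E: right_module R E
    using indec_injectiveD(1)[OF spec_point_indec[OF p(1,2)]] .
  have "p \<in> V" if V: "V \<in> \<B>" "V \<noteq> {}" for V
  proof -
    obtain M where M: "right_module R M" "basic_open R M = V"
      "torsion_class_of R V = generated_torsion_class R M" using basic_open_torsion[OF V(1)] .
    interpret M: right_module R M by (rule M(1))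
    note T = torsion_class_generated[OF M(1)]
    have "hom_trivial R M E"
      unfolding hom_trivial_def
    proof (intro ballI, rule ccontr)
      fix h m assume h: "h \<in> rmod_hom R M E" and m: "m \<in> carrier M" and "h m \<noteq> \<zero>\<^bsub>E\<^esub>"
      then obtain r x where rx: "r \<in> carrier R" "x \<in> carrier R" "r \<odot>\<^bsub>E\<^esub> h m = x \<odot>\<^bsub>E\<^esub> e" "x \<noteq> \<zero>"
        using p(5)[OF rmod_hom_closed[OF h m]] by blast
      let ?m = "r \<odot>\<^bsub>M\<^esub> m"
      have m': "?m \<in> carrier M" "h ?m = x \<odot>\<^bsub>E\<^esub> e"
        using M.smult_closed[OF rx(1) m] rmod_hom_smult[OF h rx(1) m] rx(3) by simp_all
      have "s = \<zero>" if s: "s \<in> carrier R" "s \<odot>\<^bsub>M\<^esub> ?m = \<zero>\<^bsub>M\<^esub>" for s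
      proof -
        have "(x \<otimes> s) \<odot>\<^bsub>E\<^esub> e = h (s \<odot>\<^bsub>M\<^esub> ?m)"
          using rmod_hom_smult[OF h s(1) m'(1)] m'(2) s rx p(3) by (simp add: E.smult_assoc)
        also have "\<dots> = \<zero>\<^bsub>E\<^esub>"
          using rmod_hom_zero[OF M(1) E.right_module_axioms h] s(2) by simp
        finally have "x \<otimes> s = \<zero>" using p(4)[of "x \<otimes> s"] rx s by simp
        then show ?thesis using integral[of x s] rx s by blast
      qed
      then have "{s \<in> carrier R. s \<odot>\<^bsub>M\<^esub> ?m = \<zero>\<^bsub>M\<^esub>} = {\<zero>}"
        using M.smult_l_zero[OF m'(1)] by auto
      then have "{\<zero>} \<in> gabriel R (torsion_class_of R V)"
        using gabriel_annihilator[OF T m'(1)] M(3) by simp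
      then show False using zero_notin_gabriel[OF V(1)] V(2) by blast
    qed
    then show ?thesis using p(6) M(2) by blast
  qed
  then show ?thesis using that p(1) by blast
qed

text \<open>Detects that a right ideal is proper; it will be applied to the denominators of a global
  section.\<close>

lemma point_above:
  assumes "right_ideal I R" "\<one> \<notin> I"
  obtains p and E :: "('a, 'u) module" and e where "p \<in> spec_points R" "E \<in> p" "e \<in> carrier E"
    "e \<noteq> \<zero>\<^bsub>E\<^esub>" "\<And>a. a \<in> I \<Longrightarrow> a \<odot>\<^bsub>E\<^esub> e = \<zero>\<^bsub>E\<^esub>"
proof -
  obtain K where K: "uniform_ideal K" "I \<subseteq> K" using uniform_maximal[OF assms] .
  obtain p and E :: "('a, 'u) module" and e where p: "p \<in> spec_points R" "E \<in> p" "e \<in> carrier E"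
    "\<And>a. a \<in> carrier R \<Longrightarrow> a \<odot>\<^bsub>E\<^esub> e = \<zero>\<^bsub>E\<^esub> \<longleftrightarrow> a \<in> K"
    by (rule uniform_point[OF K(1)]) (rule that)
  interpret E: right_module R E
    using indec_injectiveD(1)[OF spec_point_indec[OF p(1,2)]] .
  have "\<one> \<notin> K" using K(1) by (simp add: uniform_ideal_def)
  then have "e \<noteq> \<zero>\<^bsub>E\<^esub>" using p(4)[of \<one>] E.smult_r_zero by auto
  moreover have "a \<odot>\<^bsub>E\<^esub> e = \<zero>\<^bsub>E\<^esub>" if "a \<in> I" for a
    using p(4)[of a] K(2) that right_ideal_mem[OF assms(1) that] by blast
  ultimately show ?thesis using that p(1-3) by blast
qed

end

section \<open>Intersections of basic open sets\<close>

definition prod_rmod :: "('a, 'm) module \<Rightarrow> ('a, 'n) module \<Rightarrow> ('a, 'm \<times> 'n) module" where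
  "prod_rmod M N = \<lparr>carrier = carrier M \<times> carrier N, mult = undefined, one = undefined,
     zero = (\<zero>\<^bsub>M\<^esub>, \<zero>\<^bsub>N\<^esub>), add = (\<lambda>x y. (fst x \<oplus>\<^bsub>M\<^esub> fst y, snd x \<oplus>\<^bsub>N\<^esub> snd y)),
     smult = (\<lambda>a x. (a \<odot>\<^bsub>M\<^esub> fst x, a \<odot>\<^bsub>N\<^esub> snd x))\<rparr>"

lemma prod_rmod_simps [simp]:
  "carrier (prod_rmod M N) = carrier M \<times> carrier N" "\<zero>\<^bsub>prod_rmod M N\<^esub> = (\<zero>\<^bsub>M\<^esub>, \<zero>\<^bsub>N\<^esub>)"
  "x \<oplus>\<^bsub>prod_rmod M N\<^esub> y = (fst x \<oplus>\<^bsub>M\<^esub> fst y, snd x \<oplus>\<^bsub>N\<^esub> snd y)"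
  "a \<odot>\<^bsub>prod_rmod M N\<^esub> x = (a \<odot>\<^bsub>M\<^esub> fst x, a \<odot>\<^bsub>N\<^esub> snd x)"
  by (simp_all add: prod_rmod_def)

lemma right_module_prod:
  assumes "right_module R M" "right_module R N"
  shows "right_module R (prod_rmod M N)"
proof -
  interpret M: right_module R M by fact
  interpret N: right_module R N by fact
  show ?thesis
  proof (intro right_module.intro right_module_axioms.intro M.R.ring_axioms)
    show "abelian_group (prod_rmod M N)"
    proof (rule abelian_groupI)
      fix x assume "x \<in> carrier (prod_rmod M N)"
      then show "\<exists>y\<in>carrier (prod_rmod M N). y \<oplus>\<^bsub>prod_rmod M N\<^esub> x = \<zero>\<^bsub>prod_rmod M N\<^esub>"
        using M.M.l_neg N.M.l_neg by (intro bexI[of _ "(\<ominus>\<^bsub>M\<^esub> fst x, \<ominus>\<^bsub>N\<^esub> snd x)"]) auto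
    qed (auto simp: M.M.a_ac N.M.a_ac)
  qed (auto simp: M.smult_closed N.smult_closed M.smult_l_distr N.smult_l_distr M.smult_r_distr
      N.smult_r_distr M.smult_assoc N.smult_assoc M.smult_one N.smult_one)
qed

lemma prod_rmod_homs:
  assumes "right_module R M" "right_module R N"
  shows "fst \<in> rmod_hom R (prod_rmod M N) M" "snd \<in> rmod_hom R (prod_rmod M N) N"
    "(\<lambda>x. (x, \<zero>\<^bsub>N\<^esub>)) \<in> rmod_hom R M (prod_rmod M N)"
    "(\<lambda>y. (\<zero>\<^bsub>M\<^esub>, y)) \<in> rmod_hom R N (prod_rmod M N)"
proof -
  interpret M: right_module R M by fact
  interpret N: right_module R N by fact
  show "fst \<in> rmod_hom R (prod_rmod M N) M" "snd \<in> rmod_hom R (prod_rmod M N) N"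
    "(\<lambda>x. (x, \<zero>\<^bsub>N\<^esub>)) \<in> rmod_hom R M (prod_rmod M N)"
    "(\<lambda>y. (\<zero>\<^bsub>M\<^esub>, y)) \<in> rmod_hom R N (prod_rmod M N)"
    by (auto simp: rmod_hom_def M.smult_r_zero N.smult_r_zero)
qed

lemma hom_trivial_prod_iff:
  assumes "right_module R M" "right_module R N" "right_module R E"
  shows "hom_trivial R (prod_rmod M N) E \<longleftrightarrow> hom_trivial R M E \<and> hom_trivial R N E"
proof -
  interpret M: right_module R M by fact
  interpret N: right_module R N by fact
  interpret E: right_module R E by fact
  note homs = prod_rmod_homs[OF assms(1,2)]
  show ?thesis
  proof (intro iffI conjI)
    assume t: "hom_trivial R (prod_rmod M N) E"
    show "hom_trivial R M E"
      unfolding hom_trivial_def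
    proof (intro ballI)
      fix h x assume "h \<in> rmod_hom R M E" "x \<in> carrier M"
      then show "h x = \<zero>\<^bsub>E\<^esub>"
        using hom_trivialD[OF t rmod_hom_comp[OF homs(1)], of h "(x, \<zero>\<^bsub>N\<^esub>)"] by simp
    qed
    show "hom_trivial R N E"
      unfolding hom_trivial_def
    proof (intro ballI)
      fix h x assume "h \<in> rmod_hom R N E" "x \<in> carrier N"
      then show "h x = \<zero>\<^bsub>E\<^esub>"
        using hom_trivialD[OF t rmod_hom_comp[OF homs(2)], of h "(\<zero>\<^bsub>M\<^esub>, x)"] by simp
    qed
  next
    assume t: "hom_trivial R M E \<and> hom_trivial R N E"
    show "hom_trivial R (prod_rmod M N) E"
      unfolding hom_trivial_def
    proof (intro ballI)
      fix h x assume h: "h \<in> rmod_hom R (prod_rmod M N) E" and "x \<in> carrier (prod_rmod M N)"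
      then obtain u v where x: "x = (u, v)" "u \<in> carrier M" "v \<in> carrier N" by auto
      have "h x = h (u, \<zero>\<^bsub>N\<^esub>) \<oplus>\<^bsub>E\<^esub> h (\<zero>\<^bsub>M\<^esub>, v)"
        using rmod_hom_add[OF h, of "(u, \<zero>\<^bsub>N\<^esub>)" "(\<zero>\<^bsub>M\<^esub>, v)"] x by simp
      also have "h (u, \<zero>\<^bsub>N\<^esub>) = \<zero>\<^bsub>E\<^esub>"
        using hom_trivialD[OF conjunct1[OF t] rmod_hom_comp[OF homs(3) h] x(2)] .
      also have "h (\<zero>\<^bsub>M\<^esub>, v) = \<zero>\<^bsub>E\<^esub>"
        using hom_trivialD[OF conjunct2[OF t] rmod_hom_comp[OF homs(4) h] x(3)] .
      finally show "h x = \<zero>\<^bsub>E\<^esub>" by simp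
    qed
  qed
qed

lemma hom_trivial_iso:
  assumes "right_module R X" "rmod_iso R X Y" "hom_trivial R X E"
  shows "hom_trivial R Y E"
  unfolding hom_trivial_def
proof (intro ballI)
  obtain k where k: "k \<in> rmod_hom R X Y" "bij_betw k (carrier X) (carrier Y)"
    using assms(2) by (auto simp: rmod_iso_def)
  fix h y assume h: "h \<in> rmod_hom R Y E" "y \<in> carrier Y"
  then obtain x where "x \<in> carrier X" "k x = y"
    using k(2) by (metis bij_betw_imp_surj_on imageE)
  then show "h y = \<zero>\<^bsub>E\<^esub>" using hom_trivialD[OF assms(3) rmod_hom_comp[OF k(1) h(1)]] by blast
qed

section \<open>Finite presentation of direct sums\<close>

lemma submodule_vimage:
  assumes "right_module R L" "right_module R M" "f \<in> rmod_hom R L M" "submodule K R M"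
  shows "submodule {x \<in> carrier L. f x \<in> K} R L"
proof -
  interpret L: right_module R L by fact
  show ?thesis
    by (rule L.submoduleI)
      (use rmod_hom_zero[OF assms(1-3)] rmod_hom_add[OF assms(3)] rmod_hom_smult[OF assms(3)]
        submodule_zero[OF assms(4)] submodule_add[OF assms(4)] submodule_smult[OF assms(4)] in
        \<open>auto simp: L.smult_closed\<close>)
qed

text \<open>Puts the intersection in its usable form: a submodule contains \<open>K\<close> as soon
  as it contains \<open>F\<close>.\<close>

lemma fin_gen_submoduleD:
  assumes "right_module R M" "fin_gen_submodule R M K"
  obtains F where "finite F" "F \<subseteq> K" "submodule K R M"
    "\<And>P. submodule P R M \<Longrightarrow> F \<subseteq> P \<Longrightarrow> K \<subseteq> P"
proof -
  interpret M: right_module R M by fact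
  obtain F where F: "finite F" "F \<subseteq> carrier M" "K = \<Inter>{P. submodule P R M \<and> F \<subseteq> P}"
    using assms(2) unfolding fin_gen_submodule_def by blast
  have "submodule K R M" unfolding F(3)
    by (rule M.submodule_Inter) (use F(2) M.submodule_carrier in auto)
  moreover have "F \<subseteq> K" unfolding F(3) by blast
  moreover have "K \<subseteq> P" if "submodule P R M" "F \<subseteq> P" for P
    unfolding F(3) using that by blast
  ultimately show ?thesis using that F(1) by blast
qed

text \<open>The kernel of a direct sum of maps is the sum of the kernels, generated by the images of
  both generating sets. Stating this through biproduct identities keeps index arithmetic out of the
  argument.\<close>

lemma fin_gen_submodule_biproduct:
  assumes L: "right_module R L" "right_module R L'" "right_module R L''"
    and a: "a \<in> rmod_hom R L'' L" and b: "b \<in> rmod_hom R L'' L'"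
    and i: "i \<in> rmod_hom R L L''" and j: "j \<in> rmod_hom R L' L''"
    and ai: "\<And>u. u \<in> carrier L \<Longrightarrow> a (i u) = u \<and> b (i u) = \<zero>\<^bsub>L'\<^esub>"
    and bj: "\<And>v. v \<in> carrier L' \<Longrightarrow> b (j v) = v \<and> a (j v) = \<zero>\<^bsub>L\<^esub>"
    and sum: "\<And>z. z \<in> carrier L'' \<Longrightarrow> z = i (a z) \<oplus>\<^bsub>L''\<^esub> j (b z)"
    and K: "fin_gen_submodule R L K" and K': "fin_gen_submodule R L' K'"
  shows "fin_gen_submodule R L'' {z \<in> carrier L''. a z \<in> K \<and> b z \<in> K'}"
proof -
  interpret L'': right_module R L'' by fact
  obtain F where F: "finite F" "F \<subseteq> K" "submodule K R L"
    "\<And>P. submodule P R L \<Longrightarrow> F \<subseteq> P \<Longrightarrow> K \<subseteq> P"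
    by (rule fin_gen_submoduleD[OF L(1) K]) (rule that)
  obtain F' where F': "finite F'" "F' \<subseteq> K'" "submodule K' R L'"
    "\<And>P. submodule P R L' \<Longrightarrow> F' \<subseteq> P \<Longrightarrow> K' \<subseteq> P"
    by (rule fin_gen_submoduleD[OF L(2) K']) (rule that)
  have FL: "F \<subseteq> carrier L" "F' \<subseteq> carrier L'"
    using F(2) F'(2) submodule_subset[OF F(3)] submodule_subset[OF F'(3)] by auto
  let ?K = "{z \<in> carrier L''. a z \<in> K \<and> b z \<in> K'}" and ?F = "i ` F \<union> j ` F'"
  have "?K = {z \<in> carrier L''. a z \<in> K} \<inter> {z \<in> carrier L''. b z \<in> K'}" by blast
  then have sK: "submodule ?K R L''"
    using L''.submodule_Int[OF submodule_vimage[OF L(3,1) a F(3)] submodule_vimage[OF L(3,2) b F'(3)]] by simp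
  have "i x \<in> ?K" if "x \<in> F" for x
  proof -
    have "x \<in> carrier L" "x \<in> K" using that FL(1) F(2) by auto
    then show ?thesis using ai[of x] submodule_zero[OF F'(3)] rmod_hom_closed[OF i] by simp
  qed
  moreover have "j x \<in> ?K" if "x \<in> F'" for x
  proof -
    have "x \<in> carrier L'" "x \<in> K'" using that FL(2) F'(2) by auto
    then show ?thesis using bj[of x] submodule_zero[OF F(3)] rmod_hom_closed[OF j] by simp
  qed
  ultimately have FK: "?F \<subseteq> ?K" by blast
  have "?K \<subseteq> P" if P: "submodule P R L''" "?F \<subseteq> P" for P
  proof
    fix z assume z: "z \<in> ?K"
    have "K \<subseteq> {u \<in> carrier L. i u \<in> P}"
      by (rule F(4)[OF submodule_vimage[OF L(1,3) i P(1)]]) (use P(2) FL in auto)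
    moreover have "K' \<subseteq> {u \<in> carrier L'. j u \<in> P}"
      by (rule F'(4)[OF submodule_vimage[OF L(2,3) j P(1)]]) (use P(2) FL in auto)
    ultimately have "i (a z) \<in> P" "j (b z) \<in> P" using z by auto
    then have "i (a z) \<oplus>\<^bsub>L''\<^esub> j (b z) \<in> P" by (rule submodule_add[OF P(1)])
    moreover have "i (a z) \<oplus>\<^bsub>L''\<^esub> j (b z) = z" using z by (intro sum[symmetric]) simp
    ultimately show "z \<in> P" by simp
  qed
  then have "?K = \<Inter>{P. submodule P R L'' \<and> ?F \<subseteq> P}"
    using sK FK by blast
  moreover have "finite ?F" "?F \<subseteq> carrier L''" using F(1) F'(1) FK by auto
  ultimately show ?thesis unfolding fin_gen_submodule_def by blast
qed

text \<open>The free module in the form required by \<open>fin_presented\<close>; as the index set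
  is finite, the condition on supports disappears from its carrier.\<close>

definition free_rmod :: "('a, 'r) ring_scheme \<Rightarrow> nat \<Rightarrow> ('a, nat \<Rightarrow> 'a) module" where
  "free_rmod R k = direct_sum {..<k} (\<lambda>_. regular_rmod R)"

lemma free_rmod_simps:
  "carrier (free_rmod R k) = (\<Pi>\<^sub>E i\<in>{..<k}. carrier R)"
  "\<zero>\<^bsub>free_rmod R k\<^esub> = (\<lambda>i\<in>{..<k}. \<zero>\<^bsub>R\<^esub>)"
  "x \<oplus>\<^bsub>free_rmod R k\<^esub> y = (\<lambda>i\<in>{..<k}. x i \<oplus>\<^bsub>R\<^esub> y i)"
  "a \<odot>\<^bsub>free_rmod R k\<^esub> x = (\<lambda>i\<in>{..<k}. x i \<otimes>\<^bsub>R\<^esub> a)"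
  by (auto simp: free_rmod_def direct_sum_def)

lemma free_rmod_ext:
  assumes "x \<in> carrier (free_rmod R k)" "y \<in> carrier (free_rmod R k)" "\<And>i. i < k \<Longrightarrow> x i = y i"
  shows "x = y"
  using assms by (intro PiE_ext[of x "{..<k}" "\<lambda>_. carrier R" y]) (auto simp: free_rmod_simps)

context ring
begin

lemma free_rmod_closed: "x \<in> carrier (free_rmod R k) \<Longrightarrow> i < k \<Longrightarrow> x i \<in> carrier R"
  by (auto simp: free_rmod_simps)

lemma right_module_free: "right_module R (free_rmod R k)"
proof (intro right_module.intro right_module_axioms.intro ring_axioms)
  let ?L = "free_rmod R k"
  note c = free_rmod_closed
  have cl: "x \<oplus>\<^bsub>?L\<^esub> y \<in> carrier ?L" if "x \<in> carrier ?L" "y \<in> carrier ?L" for x y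
    using c[OF that(1)] c[OF that(2)] by (auto simp: free_rmod_simps)
  have zr: "\<zero>\<^bsub>?L\<^esub> \<in> carrier ?L" by (auto simp: free_rmod_simps)
  show sm: "a \<odot>\<^bsub>?L\<^esub> x \<in> carrier ?L" if "a \<in> carrier R" "x \<in> carrier ?L" for a x
    using that(1) c[OF that(2)] by (auto simp: free_rmod_simps)
  show "abelian_group ?L"
  proof (rule abelian_groupI)
    fix x y z assume "x \<in> carrier ?L" "y \<in> carrier ?L" "z \<in> carrier ?L"
    then show "x \<oplus>\<^bsub>?L\<^esub> y \<oplus>\<^bsub>?L\<^esub> z = x \<oplus>\<^bsub>?L\<^esub> (y \<oplus>\<^bsub>?L\<^esub> z)"
      by (intro free_rmod_ext[where R = R and k = k] cl) (auto simp: free_rmod_simps(3) c a_assoc)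
  next
    fix x y assume "x \<in> carrier ?L" "y \<in> carrier ?L"
    then show "x \<oplus>\<^bsub>?L\<^esub> y = y \<oplus>\<^bsub>?L\<^esub> x"
      by (intro free_rmod_ext[where R = R and k = k] cl) (auto simp: free_rmod_simps(3) c a_comm)
  next
    fix x assume x: "x \<in> carrier ?L"
    then show "\<zero>\<^bsub>?L\<^esub> \<oplus>\<^bsub>?L\<^esub> x = x"
      by (intro free_rmod_ext[where R = R and k = k] cl zr) (auto simp: free_rmod_simps(2,3) c)
    have n: "(\<lambda>i\<in>{..<k}. \<ominus> x i) \<in> carrier ?L" using c[OF x] by (auto simp: free_rmod_simps(1))
    moreover have "(\<lambda>i\<in>{..<k}. \<ominus> x i) \<oplus>\<^bsub>?L\<^esub> x = \<zero>\<^bsub>?L\<^esub>"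
      using x n by (intro free_rmod_ext[where R = R and k = k] cl zr) (auto simp: free_rmod_simps(2,3) c l_neg)
    ultimately show "\<exists>y\<in>carrier ?L. y \<oplus>\<^bsub>?L\<^esub> x = \<zero>\<^bsub>?L\<^esub>" by blast
  qed (use cl zr in auto)
  show "(a \<oplus> b) \<odot>\<^bsub>?L\<^esub> x = a \<odot>\<^bsub>?L\<^esub> x \<oplus>\<^bsub>?L\<^esub> b \<odot>\<^bsub>?L\<^esub> x"
    if "a \<in> carrier R" "b \<in> carrier R" "x \<in> carrier ?L" for a b x
    using that by (intro free_rmod_ext[where R = R and k = k] cl sm) (auto simp: free_rmod_simps(3,4) c r_distr)
  show "a \<odot>\<^bsub>?L\<^esub> (x \<oplus>\<^bsub>?L\<^esub> y) = a \<odot>\<^bsub>?L\<^esub> x \<oplus>\<^bsub>?L\<^esub> a \<odot>\<^bsub>?L\<^esub> y"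
    if "a \<in> carrier R" "x \<in> carrier ?L" "y \<in> carrier ?L" for a x y
    using that by (intro free_rmod_ext[where R = R and k = k] cl sm) (auto simp: free_rmod_simps(3,4) c l_distr)
  show "(a \<otimes> b) \<odot>\<^bsub>?L\<^esub> x = b \<odot>\<^bsub>?L\<^esub> (a \<odot>\<^bsub>?L\<^esub> x)"
    if "a \<in> carrier R" "b \<in> carrier R" "x \<in> carrier ?L" for a b x
    using that by (intro free_rmod_ext[where R = R and k = k] cl sm) (auto simp: free_rmod_simps(4) c m_assoc)
  show "\<one> \<odot>\<^bsub>?L\<^esub> x = x" if "x \<in> carrier ?L" for x
    using that by (intro free_rmod_ext[where R = R and k = k] cl sm) (auto simp: free_rmod_simps(4) c)
qed

lemma free_rmod_homI:
  assumes "\<And>x. x \<in> carrier (free_rmod R k) \<Longrightarrow> f x \<in> carrier (free_rmod R l)"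
    and "\<And>x y i. x \<in> carrier (free_rmod R k) \<Longrightarrow> y \<in> carrier (free_rmod R k) \<Longrightarrow> i < l \<Longrightarrow>
      f (x \<oplus>\<^bsub>free_rmod R k\<^esub> y) i = f x i \<oplus> f y i"
    and "\<And>a x i. a \<in> carrier R \<Longrightarrow> x \<in> carrier (free_rmod R k) \<Longrightarrow> i < l \<Longrightarrow>
      f (a \<odot>\<^bsub>free_rmod R k\<^esub> x) i = f x i \<otimes> a"
  shows "f \<in> rmod_hom R (free_rmod R k) (free_rmod R l)"
proof -
  interpret K: right_module R "free_rmod R k" by (rule right_module_free)
  interpret L: right_module R "free_rmod R l" by (rule right_module_free)
  show ?thesis
  proof (rule rmod_homI)
    fix x y assume xy: "x \<in> carrier (free_rmod R k)" "y \<in> carrier (free_rmod R k)"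
    then show "f (x \<oplus>\<^bsub>free_rmod R k\<^esub> y) = f x \<oplus>\<^bsub>free_rmod R l\<^esub> f y"
      using assms(2)[OF xy] by (intro free_rmod_ext[where R = R and k = l] L.M.a_closed assms(1) K.M.a_closed)
        (auto simp: free_rmod_simps(3)[of R l])
  next
    fix a x assume ax: "a \<in> carrier R" "x \<in> carrier (free_rmod R k)"
    then show "f (a \<odot>\<^bsub>free_rmod R k\<^esub> x) = a \<odot>\<^bsub>free_rmod R l\<^esub> f x"
      using assms(3)[OF ax] by (intro free_rmod_ext[where R = R and k = l] L.smult_closed assms(1) K.smult_closed)
        (auto simp: free_rmod_simps(4)[of R l])
  qed (rule assms(1))
qed

text \<open>Splits a tuple into its first \<open>m\<close> and its last \<open>n\<close>
  coordinates; \<open>b\<close> and \<open>v\<close> carry the shift by \<open>m\<close>.\<close>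

lemma free_rmod_biproduct:
  obtains a b u v where "a \<in> rmod_hom R (free_rmod R (m + n)) (free_rmod R m)"
    "b \<in> rmod_hom R (free_rmod R (m + n)) (free_rmod R n)"
    "u \<in> rmod_hom R (free_rmod R m) (free_rmod R (m + n))"
    "v \<in> rmod_hom R (free_rmod R n) (free_rmod R (m + n))"
    "\<And>x. x \<in> carrier (free_rmod R m) \<Longrightarrow> a (u x) = x \<and> b (u x) = \<zero>\<^bsub>free_rmod R n\<^esub>"
    "\<And>y. y \<in> carrier (free_rmod R n) \<Longrightarrow> b (v y) = y \<and> a (v y) = \<zero>\<^bsub>free_rmod R m\<^esub>"
    "\<And>z. z \<in> carrier (free_rmod R (m + n)) \<Longrightarrow> z = u (a z) \<oplus>\<^bsub>free_rmod R (m + n)\<^esub> v (b z)"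
proof -
  define a where "a = (\<lambda>z :: nat \<Rightarrow> 'a. \<lambda>i\<in>{..<m}. z i)"
  define b where "b = (\<lambda>z :: nat \<Rightarrow> 'a. \<lambda>i\<in>{..<n}. z (m + i))"
  define u where "u = (\<lambda>x :: nat \<Rightarrow> 'a. \<lambda>i\<in>{..<m + n}. if i < m then x i else \<zero>)"
  define v where "v = (\<lambda>x :: nat \<Rightarrow> 'a. \<lambda>i\<in>{..<m + n}. if i < m then \<zero> else x (i - m))"
  note c = free_rmod_closed and s = free_rmod_simps
  interpret K: right_module R "free_rmod R (m + n)" by (rule right_module_free)
  interpret L: right_module R "free_rmod R m" by (rule right_module_free)
  interpret L': right_module R "free_rmod R n" by (rule right_module_free)
  have a: "a \<in> rmod_hom R (free_rmod R (m + n)) (free_rmod R m)"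
  proof (rule free_rmod_homI)
    fix x assume x: "x \<in> carrier (free_rmod R (m + n))"
    show "a x \<in> carrier (free_rmod R (m))"
      unfolding s(1) a_def restrict_PiE_iff using c[OF x] by auto
  qed (auto simp: a_def s(3,4))
  have b: "b \<in> rmod_hom R (free_rmod R (m + n)) (free_rmod R n)"
  proof (rule free_rmod_homI)
    fix x assume x: "x \<in> carrier (free_rmod R (m + n))"
    show "b x \<in> carrier (free_rmod R (n))"
      unfolding s(1) b_def restrict_PiE_iff using c[OF x] by auto
  qed (auto simp: b_def s(3,4))
  have u: "u \<in> rmod_hom R (free_rmod R m) (free_rmod R (m + n))"
  proof (rule free_rmod_homI)
    fix x assume x: "x \<in> carrier (free_rmod R (m))"
    show "u x \<in> carrier (free_rmod R (m + n))"
      unfolding s(1) u_def restrict_PiE_iff using c[OF x] by auto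
  qed (auto simp: u_def s(3,4))
  have v: "v \<in> rmod_hom R (free_rmod R n) (free_rmod R (m + n))"
  proof (rule free_rmod_homI)
    fix x assume x: "x \<in> carrier (free_rmod R (n))"
    show "v x \<in> carrier (free_rmod R (m + n))"
      unfolding s(1) v_def restrict_PiE_iff using c[OF x] by auto
  qed (auto simp: v_def s(3,4))
  note ac = rmod_hom_closed[OF a] and bc = rmod_hom_closed[OF b] and uc = rmod_hom_closed[OF u]
    and vc = rmod_hom_closed[OF v]
  have au: "a (u x) = x \<and> b (u x) = \<zero>\<^bsub>free_rmod R n\<^esub>" if x: "x \<in> carrier (free_rmod R m)" for x
  proof
    show "a (u x) = x"
      by (rule free_rmod_ext[OF ac[OF uc[OF x]] x]) (simp add: a_def u_def)
    show "b (u x) = \<zero>\<^bsub>free_rmod R n\<^esub>"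
      by (rule free_rmod_ext[OF bc[OF uc[OF x]] L'.M.zero_closed]) (simp add: b_def u_def s(2))
  qed
  have bv: "b (v y) = y \<and> a (v y) = \<zero>\<^bsub>free_rmod R m\<^esub>" if y: "y \<in> carrier (free_rmod R n)" for y
  proof
    show "b (v y) = y"
      by (rule free_rmod_ext[OF bc[OF vc[OF y]] y]) (simp add: b_def v_def)
    show "a (v y) = \<zero>\<^bsub>free_rmod R m\<^esub>"
      by (rule free_rmod_ext[OF ac[OF vc[OF y]] L.M.zero_closed]) (simp add: a_def v_def s(2))
  qed
  have sum: "z = u (a z) \<oplus>\<^bsub>free_rmod R (m + n)\<^esub> v (b z)" if z: "z \<in> carrier (free_rmod R (m + n))" for z
    by (rule free_rmod_ext[OF z K.M.a_closed[OF uc[OF ac[OF z]] vc[OF bc[OF z]]]])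
      (use c[OF z] in \<open>auto simp: a_def b_def u_def v_def s(3)\<close>)
  show ?thesis by (rule that[OF a b u v au bv sum])
qed

end

context universe_ring
begin

text \<open>Pairs need not lie in the universe, so the direct sum has to be copied there. Since
  \<open>M\<close> and \<open>N\<close> are finitely generated, their elements can be coded by the
  coordinates of chosen preimages in free modules.\<close>

lemma fin_presented_prod:
  fixes M N :: "('a, 'u) module"
  assumes "fin_presented R M" "fin_presented R N"
  obtains P :: "('a, 'u) module" where "fin_presented R P" "rmod_iso R (prod_rmod M N) P"
proof -
  obtain code :: "'a list set \<Rightarrow> 'u" where code: "inj_on code (Pow (lists (carrier R)))"
    using adequate by (auto simp: adequate_universe_def)
  have M: "right_module R M" and N: "right_module R N"
    using assms by (simp_all add: fin_presented_def)
  interpret M: right_module R M by (rule M)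
  interpret N: right_module R N by (rule N)
  obtain m h where h: "h \<in> rmod_epi R (free_rmod R m) M"
    "fin_gen_submodule R (free_rmod R m) (a_kernel (free_rmod R m) M h)"
    using assms(1) unfolding fin_presented_def Let_def free_rmod_def by blast
  obtain n k where k: "k \<in> rmod_epi R (free_rmod R n) N"
    "fin_gen_submodule R (free_rmod R n) (a_kernel (free_rmod R n) N k)"
    using assms(2) unfolding fin_presented_def Let_def free_rmod_def by blast
  define s where "s = inv_into (carrier (free_rmod R m)) h"
  define t where "t = inv_into (carrier (free_rmod R n)) k"
  have s: "s x \<in> carrier (free_rmod R m)" "h (s x) = x" if "x \<in> carrier M" for x
  proof -
    have "x \<in> h ` carrier (free_rmod R m)" using h(1) that by (simp add: rmod_epi_def)
    then show "s x \<in> carrier (free_rmod R m)" "h (s x) = x"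
      unfolding s_def by (rule inv_into_into, rule f_inv_into_f)
  qed
  have t: "t y \<in> carrier (free_rmod R n)" "k (t y) = y" if "y \<in> carrier N" for y
  proof -
    have "y \<in> k ` carrier (free_rmod R n)" using k(1) that by (simp add: rmod_epi_def)
    then show "t y \<in> carrier (free_rmod R n)" "k (t y) = y"
      unfolding t_def by (rule inv_into_into, rule f_inv_into_f)
  qed
  \<comment> \<open>Both coordinate tuples in one word; the first block has the fixed length
    \<open>m\<close>, so the word determines both.\<close>
  define w where "w p = map (s (fst p)) [0..<m] @ map (t (snd p)) [0..<n]" for p
  let ?P = "prod_rmod M N"
  have wl: "{w p} \<in> Pow (lists (carrier R))" if "p \<in> carrier ?P" for p
    using that free_rmod_closed[OF s(1)[of "fst p"]] free_rmod_closed[OF t(1)[of "snd p"]]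
    by (auto simp: w_def)
  have "inj_on (\<lambda>p. code {w p}) (carrier ?P)"
  proof (rule inj_onI)
    fix p q assume *: "p \<in> carrier ?P" "q \<in> carrier ?P" "code {w p} = code {w q}"
    then have "w p = w q" using inj_onD[OF code *(3) wl wl] by simp
    then have "map (s (fst p)) [0..<m] = map (s (fst q)) [0..<m]"
      "map (t (snd p)) [0..<n] = map (t (snd q)) [0..<n]" by (simp_all add: w_def)
    then have eq: "\<And>i. i < m \<Longrightarrow> s (fst p) i = s (fst q) i" "\<And>i. i < n \<Longrightarrow> t (snd p) i = t (snd q) i"
      by simp_all
    have "s (fst p) = s (fst q)"
      by (rule free_rmod_ext[OF s(1) s(1) eq(1)]) (use * in auto)
    moreover have "t (snd p) = t (snd q)"
      by (rule free_rmod_ext[OF t(1) t(1) eq(2)]) (use * in auto)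
    ultimately have "fst p = fst q" "snd p = snd q"
      using s(2)[of "fst p"] s(2)[of "fst q"] t(2)[of "snd p"] t(2)[of "snd q"] * by auto
    then show "p = q" by (rule prod_eqI)
  qed
  from transport_rmod[OF right_module_prod[OF M N] this]
  obtain P :: "('a, 'u) module" and g where P: "right_module R P" "g \<in> rmod_hom R ?P P"
    "bij_betw g (carrier ?P) (carrier P)" by metis
  have g0: "g p = \<zero>\<^bsub>P\<^esub> \<longleftrightarrow> p = \<zero>\<^bsub>?P\<^esub>" if "p \<in> carrier ?P" for p
  proof -
    have "inj_on g (carrier ?P)" using P(3) by (simp add: bij_betw_def)
    then show ?thesis
      using rmod_hom_zero[OF right_module_prod[OF M N] P(1,2)] that
        rmod_hom_inj_iff[OF right_module_prod[OF M N] P(1,2)] by auto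
  qed
  obtain a b u v where bi: "a \<in> rmod_hom R (free_rmod R (m + n)) (free_rmod R m)"
    "b \<in> rmod_hom R (free_rmod R (m + n)) (free_rmod R n)"
    "u \<in> rmod_hom R (free_rmod R m) (free_rmod R (m + n))"
    "v \<in> rmod_hom R (free_rmod R n) (free_rmod R (m + n))"
    "\<And>x. x \<in> carrier (free_rmod R m) \<Longrightarrow> a (u x) = x \<and> b (u x) = \<zero>\<^bsub>free_rmod R n\<^esub>"
    "\<And>y. y \<in> carrier (free_rmod R n) \<Longrightarrow> b (v y) = y \<and> a (v y) = \<zero>\<^bsub>free_rmod R m\<^esub>"
    "\<And>z. z \<in> carrier (free_rmod R (m + n)) \<Longrightarrow> z = u (a z) \<oplus>\<^bsub>free_rmod R (m + n)\<^esub> v (b z)"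
    by (rule free_rmod_biproduct) (rule that)
  let ?L = "free_rmod R (m + n)"
  define f where "f z = g (h (a z), k (b z))" for z
  have hk: "(\<lambda>z. (h (a z), k (b z))) \<in> rmod_hom R ?L ?P"
    using rmod_hom_comp[OF bi(1) rmod_epiD[OF h(1)]] rmod_hom_comp[OF bi(2) rmod_epiD[OF k(1)]]
    by (auto simp: rmod_hom_def)
  have fh: "f \<in> rmod_hom R ?L P"
    using rmod_hom_comp[OF hk P(2)] by (simp add: f_def[abs_def])
  have "f \<in> rmod_epi R ?L P"
  proof (rule rmod_epiI[OF fh])
    fix y assume "y \<in> carrier P"
    then have "y \<in> g ` (carrier M \<times> carrier N)" using P(3) by (simp add: bij_betw_def)
    then obtain x x' where x: "x \<in> carrier M" "x' \<in> carrier N" "y = g (x, x')" by auto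
    interpret L: right_module R ?L by (rule right_module_free)
    interpret L1: right_module R "free_rmod R m" by (rule right_module_free)
    interpret L2: right_module R "free_rmod R n" by (rule right_module_free)
    note sx = s[OF x(1)] and tx = t[OF x(2)]
    let ?z = "u (s x) \<oplus>\<^bsub>?L\<^esub> v (t x')"
    have uv: "u (s x) \<in> carrier ?L" "v (t x') \<in> carrier ?L"
      using rmod_hom_closed[OF bi(3) sx(1)] rmod_hom_closed[OF bi(4) tx(1)] .
    have "a ?z = s x" "b ?z = t x'"
      using rmod_hom_add[OF bi(1) uv] rmod_hom_add[OF bi(2) uv] bi(5)[OF sx(1)] bi(6)[OF tx(1)]
        sx(1) tx(1) by simp_all
    then have "f ?z = y" using sx(2) tx(2) x(3) by (simp add: f_def)
    then show "\<exists>z\<in>carrier ?L. f z = y" using uv by blast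
  qed
  moreover have "a_kernel ?L P f = {z \<in> carrier ?L. a z \<in> a_kernel (free_rmod R m) M h \<and>
      b z \<in> a_kernel (free_rmod R n) N k}"
  proof -
    have "f z = \<zero>\<^bsub>P\<^esub> \<longleftrightarrow> h (a z) = \<zero>\<^bsub>M\<^esub> \<and> k (b z) = \<zero>\<^bsub>N\<^esub>" if "z \<in> carrier ?L" for z
      using g0[OF rmod_hom_closed[OF hk that]] by (simp add: f_def)
    then show ?thesis
      using rmod_hom_closed[OF bi(1)] rmod_hom_closed[OF bi(2)] by (auto simp: a_kernel_def')
  qed
  then have "fin_gen_submodule R ?L (a_kernel ?L P f)"
    using fin_gen_submodule_biproduct[OF right_module_free right_module_free right_module_free
        bi(1-4) bi(5) bi(6) bi(7) h(2) k(2)] by simp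
  ultimately have "fin_presented R P"
    unfolding fin_presented_def Let_def free_rmod_def[symmetric] using P(1) by blast
  moreover have "rmod_iso R ?P P" using P(2,3) by (auto simp: rmod_iso_def)
  ultimately show ?thesis using that by blast
qed

end

context noetherian_domain
begin

text \<open>The intersection belongs to the direct sum, since a map out of it vanishes exactly when
  both of its components do.\<close>

lemma basic_opens_Int:
  assumes "V \<in> \<B>" "W \<in> \<B>"
  shows "V \<inter> W \<in> \<B>"
proof -
  obtain M N :: "('a, 'u) module" where M: "fin_presented R M" "V = basic_open R M"
    and N: "fin_presented R N" "W = basic_open R N"
    using assms by (auto simp: basic_opens_def)
  have MN: "right_module R M" "right_module R N" using M N by (simp_all add: fin_presented_def)
  obtain P :: "('a, 'u) module" where P: "fin_presented R P" "rmod_iso R (prod_rmod M N) P"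
    using fin_presented_prod[OF M(1) N(1)] .
  note rP = right_module_prod[OF MN]
  have rP': "right_module R P" using P(1) by (simp add: fin_presented_def)
  have eq: "hom_trivial R P E \<longleftrightarrow> hom_trivial R M E \<and> hom_trivial R N E"
    if "right_module R E" for E :: "('a, 'u) module"
  proof -
    have "hom_trivial R P E \<longleftrightarrow> hom_trivial R (prod_rmod M N) E"
      by (rule iffI, rule hom_trivial_iso[OF rP' rmod_iso_sym[OF rP P(2)]], assumption,
          rule hom_trivial_iso[OF rP P(2)])
    then show ?thesis using hom_trivial_prod_iff[OF MN that] by simp
  qed
  have "p \<in> basic_open R P \<longleftrightarrow> p \<in> V \<inter> W" for p
  proof (cases "p \<in> spec_points R")
    case True
    have "\<forall>E\<in>p. hom_trivial R P E \<longleftrightarrow> hom_trivial R M E \<and> hom_trivial R N E"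
      using eq indec_injectiveD(1)[OF spec_point_indec[OF True]] by simp
    then show ?thesis using True unfolding M(2) N(2) basic_open_def by auto
  next
    case False
    then show ?thesis unfolding M(2) N(2) basic_open_def by simp
  qed
  then have "basic_open R P = V \<inter> W" by (rule Set.set_eqI)
  then show ?thesis using P(1) unfolding basic_opens_def by (auto intro!: exI[of _ P])
qed

end

section \<open>Presheaves with rigid constant sections\<close>

text \<open>\<open>J V a\<close> is the section over \<open>V\<close> given by \<open>a\<close>. The premises \<open>p \<in> V\<close> and \<open>p \<in> W\<close> only say that
  these sets are nonempty: the localisation attached to the empty set is the zero ring.\<close>

locale rigid_presheaf = ring R for R :: "('a, 'r) ring_scheme" (structure) +
  fixes \<B> :: "'p set set" and F :: "'p set \<Rightarrow> 's ring" and \<rho> :: "'p set \<Rightarrow> 'p set \<Rightarrow> 's \<Rightarrow> 's"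
    and X :: "'p set" and J :: "'p set \<Rightarrow> 'a \<Rightarrow> 's"
  assumes cover: "X = \<Union>\<B>" and nonempty: "X \<noteq> {}"
    and Int: "V \<in> \<B> \<Longrightarrow> W \<in> \<B> \<Longrightarrow> V \<inter> W \<in> \<B>"
    and J_closed: "V \<in> \<B> \<Longrightarrow> p \<in> V \<Longrightarrow> a \<in> carrier R \<Longrightarrow> J V a \<in> carrier (F V)"
    and J_inj: "V \<in> \<B> \<Longrightarrow> p \<in> V \<Longrightarrow> a \<in> carrier R \<Longrightarrow> b \<in> carrier R \<Longrightarrow> J V a = J V b \<Longrightarrow> a = b"
    and J_mult: "V \<in> \<B> \<Longrightarrow> p \<in> V \<Longrightarrow> a \<in> carrier R \<Longrightarrow> b \<in> carrier R \<Longrightarrow>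
      J V a \<otimes>\<^bsub>F V\<^esub> J V b = J V (a \<otimes> b)"
    and J_add: "V \<in> \<B> \<Longrightarrow> p \<in> V \<Longrightarrow> a \<in> carrier R \<Longrightarrow> b \<in> carrier R \<Longrightarrow>
      J V a \<oplus>\<^bsub>F V\<^esub> J V b = J V (a \<oplus> b)"
    and J_one: "V \<in> \<B> \<Longrightarrow> p \<in> V \<Longrightarrow> \<one>\<^bsub>F V\<^esub> = J V \<one>"
    and J_zero: "V \<in> \<B> \<Longrightarrow> p \<in> V \<Longrightarrow> \<zero>\<^bsub>F V\<^esub> = J V \<zero>"
    and J_restrict: "V \<in> \<B> \<Longrightarrow> W \<in> \<B> \<Longrightarrow> p \<in> W \<Longrightarrow> W \<subseteq> V \<Longrightarrow> a \<in> carrier R \<Longrightarrow>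
      \<rho> V W (J V a) = J W a"
    and rigid: "V \<in> \<B> \<Longrightarrow> W \<in> \<B> \<Longrightarrow> p \<in> W \<Longrightarrow> W \<subseteq> V \<Longrightarrow> a \<in> carrier R \<Longrightarrow> t \<in> carrier (F V) \<Longrightarrow>
      \<rho> V W t = J W a \<Longrightarrow> t = J V a"
    and global: "\<sigma> \<in> carrier (sheafification \<B> F \<rho> X) \<Longrightarrow> \<exists>a\<in>carrier R. \<forall>p\<in>X. \<exists>V\<in>\<B>. p \<in> V \<and>
      \<sigma> p = germ \<B> F \<rho> p V (J V a)"
begin

text \<open>The germ of a constant section as an explicit set of representatives: rigidity leaves no
  others.\<close>

definition const_germ :: "'p \<Rightarrow> 'a \<Rightarrow> ('p set \<times> 's) set" where
  "const_germ p a = {(V, J V a) | V. V \<in> \<B> \<and> p \<in> V}"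

lemma germ_refl: "V \<in> \<B> \<Longrightarrow> p \<in> V \<Longrightarrow> s \<in> carrier (F V) \<Longrightarrow> (V, s) \<in> germ \<B> F \<rho> p V s"
  unfolding germ_def by auto

text \<open>Rigidity gives one inclusion; for the other, both sections are restricted to
  \<open>V \<inter> W\<close>, which is again in the basis.\<close>

lemma germ_J:
  assumes "V \<in> \<B>" "p \<in> V" "a \<in> carrier R"
  shows "germ \<B> F \<rho> p V (J V a) = const_germ p a"
proof (rule Set.set_eqI, clarify)
  fix W t
  show "(W, t) \<in> germ \<B> F \<rho> p V (J V a) \<longleftrightarrow> (W, t) \<in> const_germ p a"
  proof
    assume "(W, t) \<in> germ \<B> F \<rho> p V (J V a)"
    then obtain W' where W: "W \<in> \<B>" "p \<in> W" "t \<in> carrier (F W)" "W' \<in> \<B>" "p \<in> W'" "W' \<subseteq> V \<inter> W"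
      "\<rho> V W' (J V a) = \<rho> W W' t" unfolding germ_def by blast
    then have "\<rho> W W' t = J W' a" using J_restrict[OF assms(1) W(4,5) _ assms(3)] by simp
    then have "t = J W a" using rigid[OF W(1,4,5) _ assms(3) W(3)] W(6) by blast
    then show "(W, t) \<in> const_germ p a" using W by (simp add: const_germ_def)
  next
    assume "(W, t) \<in> const_germ p a"
    then have W: "W \<in> \<B>" "p \<in> W" "t = J W a" by (auto simp: const_germ_def)
    have I: "V \<inter> W \<in> \<B>" "p \<in> V \<inter> W" using Int assms W by auto
    have "\<rho> V (V \<inter> W) (J V a) = \<rho> W (V \<inter> W) t"
      using J_restrict[OF assms(1) I _ assms(3)] J_restrict[OF W(1) I _ assms(3)] W(3) by simp
    then show "(W, t) \<in> germ \<B> F \<rho> p V (J V a)"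
      using W I J_closed[OF W(1,2) assms(3)] unfolding germ_def
      by (intro CollectI case_prodI conjI bexI[of _ "V \<inter> W"]) simp_all
  qed
qed

text \<open>Representatives of a constant germ are forced, so the \<open>THE\<close> in the
  operations of \<open>stalk\<close> has a unique solution on constant germs.\<close>

lemma germ_eq_const:
  assumes "V \<in> \<B>" "p \<in> V" "s \<in> carrier (F V)" "const_germ p a = germ \<B> F \<rho> p V s"
  shows "s = J V a"
proof -
  have "(V, s) \<in> const_germ p a" using germ_refl[OF assms(1-3)] assms(4) by simp
  then show ?thesis by (simp add: const_germ_def)
qed

lemma ex_nbhd: "p \<in> X \<Longrightarrow> \<exists>V. V \<in> \<B> \<and> p \<in> V"
  using cover by blast

lemma stalk_mult:
  assumes p: "p \<in> X" and ab: "a \<in> carrier R" "b \<in> carrier R"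
  shows "const_germ p a \<otimes>\<^bsub>stalk \<B> F \<rho> p\<^esub> const_germ p b = const_germ p (a \<otimes> b)"
proof -
  let ?P = "\<lambda>z. \<exists>V\<in>\<B>. p \<in> V \<and> (\<exists>s\<in>carrier (F V). \<exists>t\<in>carrier (F V).
    const_germ p a = germ \<B> F \<rho> p V s \<and> const_germ p b = germ \<B> F \<rho> p V t \<and>
    z = germ \<B> F \<rho> p V (s \<otimes>\<^bsub>F V\<^esub> t))"
  have "(THE z. ?P z) = const_germ p (a \<otimes> b)"
  proof (rule the_equality)
    obtain V where V: "V \<in> \<B>" "p \<in> V" using ex_nbhd[OF p] by blast
    have "const_germ p (a \<otimes> b) = germ \<B> F \<rho> p V (J V a \<otimes>\<^bsub>F V\<^esub> J V b)"
      using germ_J[OF V, of "a \<otimes> b"] J_mult[OF V ab] ab by simp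
    then show "?P (const_germ p (a \<otimes> b))"
      using V J_closed[OF V ab(1)] J_closed[OF V ab(2)] germ_J[OF V ab(1)] germ_J[OF V ab(2)]
      by (intro bexI[of _ V] conjI bexI[of _ "J V a"] bexI[of _ "J V b"]) simp_all
  next
    fix z assume "?P z"
    then obtain V s t where V: "V \<in> \<B>" "p \<in> V" and st: "s \<in> carrier (F V)" "t \<in> carrier (F V)"
      "const_germ p a = germ \<B> F \<rho> p V s" "const_germ p b = germ \<B> F \<rho> p V t"
      and z: "z = germ \<B> F \<rho> p V (s \<otimes>\<^bsub>F V\<^esub> t)" by blast
    have "s \<otimes>\<^bsub>F V\<^esub> t = J V (a \<otimes> b)"
      using germ_eq_const[OF V st(1,3)] germ_eq_const[OF V st(2,4)] J_mult[OF V ab] by simp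
    then show "z = const_germ p (a \<otimes> b)" using z germ_J[OF V, of "a \<otimes> b"] ab by simp
  qed
  then show ?thesis by (simp add: stalk_def)
qed

lemma stalk_add:
  assumes p: "p \<in> X" and ab: "a \<in> carrier R" "b \<in> carrier R"
  shows "const_germ p a \<oplus>\<^bsub>stalk \<B> F \<rho> p\<^esub> const_germ p b = const_germ p (a \<oplus> b)"
proof -
  let ?P = "\<lambda>z. \<exists>V\<in>\<B>. p \<in> V \<and> (\<exists>s\<in>carrier (F V). \<exists>t\<in>carrier (F V).
    const_germ p a = germ \<B> F \<rho> p V s \<and> const_germ p b = germ \<B> F \<rho> p V t \<and>
    z = germ \<B> F \<rho> p V (s \<oplus>\<^bsub>F V\<^esub> t))"
  have "(THE z. ?P z) = const_germ p (a \<oplus> b)"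
  proof (rule the_equality)
    obtain V where V: "V \<in> \<B>" "p \<in> V" using ex_nbhd[OF p] by blast
    have "const_germ p (a \<oplus> b) = germ \<B> F \<rho> p V (J V a \<oplus>\<^bsub>F V\<^esub> J V b)"
      using germ_J[OF V, of "a \<oplus> b"] J_add[OF V ab] ab by simp
    then show "?P (const_germ p (a \<oplus> b))"
      using V J_closed[OF V ab(1)] J_closed[OF V ab(2)] germ_J[OF V ab(1)] germ_J[OF V ab(2)]
      by (intro bexI[of _ V] conjI bexI[of _ "J V a"] bexI[of _ "J V b"]) simp_all
  next
    fix z assume "?P z"
    then obtain V s t where V: "V \<in> \<B>" "p \<in> V" and st: "s \<in> carrier (F V)" "t \<in> carrier (F V)"
      "const_germ p a = germ \<B> F \<rho> p V s" "const_germ p b = germ \<B> F \<rho> p V t"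
      and z: "z = germ \<B> F \<rho> p V (s \<oplus>\<^bsub>F V\<^esub> t)" by blast
    have "s \<oplus>\<^bsub>F V\<^esub> t = J V (a \<oplus> b)"
      using germ_eq_const[OF V st(1,3)] germ_eq_const[OF V st(2,4)] J_add[OF V ab] by simp
    then show "z = const_germ p (a \<oplus> b)" using z germ_J[OF V, of "a \<oplus> b"] ab by simp
  qed
  then show ?thesis by (simp add: stalk_def)
qed

lemma stalk_one: "p \<in> X \<Longrightarrow> \<one>\<^bsub>stalk \<B> F \<rho> p\<^esub> = const_germ p \<one>"
  unfolding stalk_def using ex_nbhd[of p] germ_J[of _ p \<one>] J_one
  by (auto intro!: the_equality)

lemma stalk_zero: "p \<in> X \<Longrightarrow> \<zero>\<^bsub>stalk \<B> F \<rho> p\<^esub> = const_germ p \<zero>"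
  unfolding stalk_def using ex_nbhd[of p] germ_J[of _ p \<zero>] J_zero
  by (auto intro!: the_equality)

text \<open>Constant sections give a bijection that respects the operations, surjective by the
  assumption \<open>global\<close>; the ring axioms are transported along it.\<close>

theorem global_sections:
  "ring (sheafification \<B> F \<rho> X)" "sheafification \<B> F \<rho> X \<simeq> R"
proof -
  let ?G = "sheafification \<B> F \<rho> X" and ?\<phi> = "\<lambda>a. \<lambda>p\<in>X. const_germ p a"
  have closed: "?\<phi> a \<in> carrier ?G" if a: "a \<in> carrier R" for a
  proof -
    have "const_germ p a \<in> carrier (stalk \<B> F \<rho> p)" if "p \<in> X" for p
    proof -
      obtain V where V: "V \<in> \<B>" "p \<in> V" using ex_nbhd[OF \<open>p \<in> X\<close>] by blast
      then show ?thesis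
        using germ_J[OF V a, symmetric] J_closed[OF V a] unfolding stalk_def by auto
    qed
    moreover have "\<exists>V\<in>\<B>. p \<in> V \<and> V \<subseteq> X \<and> (\<exists>s\<in>carrier (F V). \<forall>q\<in>V. ?\<phi> a q = germ \<B> F \<rho> q V s)"
      if "p \<in> X" for p
    proof -
      obtain V where V: "V \<in> \<B>" "p \<in> V" using ex_nbhd[OF \<open>p \<in> X\<close>] by blast
      have VX: "V \<subseteq> X" using cover V by blast
      have "\<forall>q\<in>V. ?\<phi> a q = germ \<B> F \<rho> q V (J V a)"
        using germ_J[OF V(1) _ a] VX by auto
      then show ?thesis using V VX J_closed[OF V a] by blast
    qed
    ultimately show ?thesis by (simp add: sheafification_def)
  qed
  have surj: "\<exists>a\<in>carrier R. \<sigma> = ?\<phi> a" if \<sigma>: "\<sigma> \<in> carrier ?G" for \<sigma>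
  proof -
    obtain a where a: "a \<in> carrier R" "\<And>p. p \<in> X \<Longrightarrow> \<exists>V\<in>\<B>. p \<in> V \<and> \<sigma> p = germ \<B> F \<rho> p V (J V a)"
      using global[OF \<sigma>] by blast
    have "\<sigma> p = const_germ p a" if "p \<in> X" for p
      using a(2)[OF that] germ_J[OF _ _ a(1)] by auto
    moreover have "\<sigma> \<in> extensional X" using \<sigma> by (simp add: sheafification_def PiE_def)
    ultimately have "\<sigma> = ?\<phi> a" by (auto simp: extensional_def fun_eq_iff)
    then show ?thesis using a(1) by blast
  qed
  have inj: "a = b" if ab: "a \<in> carrier R" "b \<in> carrier R" "?\<phi> a = ?\<phi> b" for a b
  proof -
    obtain p where p: "p \<in> X" using nonempty by blast
    obtain V where V: "V \<in> \<B>" "p \<in> V" using ex_nbhd[OF p] by blast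
    have "const_germ p a = const_germ p b" using fun_cong[OF ab(3), of p] p by simp
    then have "J V b = J V a"
      using germ_eq_const[OF V J_closed[OF V ab(2)], of a] germ_J[OF V ab(2)] by simp
    then show ?thesis using J_inj[OF V ab(1,2)] by simp
  qed
  have "?\<phi> \<in> ring_hom R ?G"
  proof (rule ring_hom_memI)
    fix a b assume "a \<in> carrier R" "b \<in> carrier R"
    then show "?\<phi> (a \<otimes> b) = ?\<phi> a \<otimes>\<^bsub>?G\<^esub> ?\<phi> b" "?\<phi> (a \<oplus> b) = ?\<phi> a \<oplus>\<^bsub>?G\<^esub> ?\<phi> b"
      by (auto simp: sheafification_def fun_eq_iff stalk_mult stalk_add)
  next
    show "?\<phi> \<one> = \<one>\<^bsub>?G\<^esub>" by (auto simp: sheafification_def fun_eq_iff stalk_one)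
  qed (rule closed)
  moreover have "bij_betw ?\<phi> (carrier R) (carrier ?G)"
    by (rule bij_betwI') (use closed surj inj in blast)+
  ultimately have iso: "?\<phi> \<in> ring_iso R ?G" by (simp add: ring_iso_def)
  \<comment> \<open>Transport along a bijection resets the zero of the target to the image of
    \<open>\<zero>\<close>; the two zeros have to be identified.\<close>
  have "?\<phi> \<zero> = \<zero>\<^bsub>?G\<^esub>" by (auto simp: sheafification_def fun_eq_iff stalk_zero)
  then have "?G\<lparr>zero := ?\<phi> \<zero>\<rparr> = ?G" by simp
  then show "ring ?G" using ring_iso_imp_img_ring[OF iso] by simp
  show "?G \<simeq> R" using ring_iso_set_sym[OF ring_axioms iso] unfolding is_ring_iso_def by blast
qed

end

section \<open>Fractions of the regular module\<close>

context noetherian_domain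
begin

abbreviation T :: "('a, 'u) module set set \<Rightarrow> ('a, 'u) module set" where "T V \<equiv> torsion_class_of R V"

section \<open>Gabriel filters of basic open sets and fractions over them\<close>

lemma torsion_class_T: "V \<in> \<B> \<Longrightarrow> torsion_class R (T V)"
  by (erule basic_open_torsion) (simp add: torsion_class_generated)

lemma gabriel_T_right_ideal: "V \<in> \<B> \<Longrightarrow> A \<in> gabriel R (T V) \<Longrightarrow> right_ideal A R"
  using gabriel_right_ideal[OF torsion_class_T] .

lemma gabriel_T_annihilates:
  assumes "V \<in> \<B>" "p \<in> V" "E \<in> p" "A \<in> gabriel R (T V)" "e \<in> carrier E"
    "\<And>a. a \<in> A \<Longrightarrow> a \<odot>\<^bsub>E\<^esub> e = \<zero>\<^bsub>E\<^esub>"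
  shows "e = \<zero>\<^bsub>E\<^esub>"
  using assms gabriel_basic_open_iff[OF assms(1)] by simp

lemma basic_open_right_module: "V \<in> \<B> \<Longrightarrow> p \<in> V \<Longrightarrow> E \<in> p \<Longrightarrow> right_module R E"
  using indec_injectiveD(1)[OF spec_point_indec[OF basic_openD]] .

lemma gabriel_T_carrier:
  assumes V: "V \<in> \<B>"
  shows "carrier R \<in> gabriel R (T V)"
  unfolding gabriel_basic_open_iff[OF V]
proof (intro conjI right_ideal_carrier ballI impI)
  fix p E e assume *: "p \<in> V" "E \<in> p" "e \<in> carrier E" "\<forall>a\<in>carrier R. a \<odot>\<^bsub>E\<^esub> e = \<zero>\<^bsub>E\<^esub>"
  interpret E: right_module R E by (rule basic_open_right_module[OF V *(1,2)])
  show "e = \<zero>\<^bsub>E\<^esub>" using *(4) E.smult_one[OF *(3)] by simp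
qed

text \<open>If \<open>A \<inter> B\<close> kills \<open>e\<close>, then for \<open>a\<close> in
  \<open>A\<close> the element \<open>e a\<close> is killed by \<open>(B : a)\<close>, which is in
  the filter. Hence \<open>A\<close> kills \<open>e\<close>, and so \<open>e = 0\<close>.\<close>

lemma gabriel_T_Int:
  assumes V: "V \<in> \<B>" and A: "A \<in> gabriel R (T V)" and B: "B \<in> gabriel R (T V)"
  shows "A \<inter> B \<in> gabriel R (T V)"
  unfolding gabriel_basic_open_iff[OF V]
proof (intro conjI ballI impI)
  note A' = gabriel_T_right_ideal[OF V A] and B' = gabriel_T_right_ideal[OF V B]
  show "right_ideal (A \<inter> B) R" by (rule right_ideal_Int[OF A' B'])
  fix p E e assume *: "p \<in> V" "E \<in> p" "e \<in> carrier E" "\<forall>a\<in>A \<inter> B. a \<odot>\<^bsub>E\<^esub> e = \<zero>\<^bsub>E\<^esub>"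
  interpret E: right_module R E by (rule basic_open_right_module[OF V *(1,2)])
  have "a \<odot>\<^bsub>E\<^esub> e = \<zero>\<^bsub>E\<^esub>" if a: "a \<in> A" for a
  proof -
    have aR: "a \<in> carrier R" using right_ideal_mem[OF A' a] .
    have "r \<odot>\<^bsub>E\<^esub> (a \<odot>\<^bsub>E\<^esub> e) = \<zero>\<^bsub>E\<^esub>" if "r \<in> colon R B a" for r
      using that right_ideal_mult[OF A' a, of r] *(3,4) aR
      by (simp add: colon_def E.smult_assoc[symmetric])
    then show ?thesis
      using gabriel_T_annihilates[OF V *(1,2) gabriel_colon[OF torsion_class_T[OF V] B aR]]
        E.smult_closed[OF aR *(3)] by simp
  qed
  then show "e = \<zero>\<^bsub>E\<^esub>" using gabriel_T_annihilates[OF V *(1,2) A *(3)] by simp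
qed

text \<open>Fewer points have to be tested.\<close>

lemma gabriel_T_restrict:
  assumes "V \<in> \<B>" "W \<in> \<B>" "W \<subseteq> V" "A \<in> gabriel R (T V)"
  shows "A \<in> gabriel R (T W)"
  using assms(3,4) unfolding gabriel_basic_open_iff[OF assms(1)] gabriel_basic_open_iff[OF assms(2)]
  by (auto dest: subsetD)

lemma gabriel_T_nonzero:
  assumes "V \<in> \<B>" "p \<in> V" "A \<in> gabriel R (T V)"
  shows "\<exists>a\<in>A. a \<noteq> \<zero>"
proof (rule ccontr)
  assume "\<not> ?thesis"
  then have "A \<subseteq> {\<zero>}" by auto
  moreover have "\<zero> \<in> A" by (rule right_ideal_zero[OF gabriel_T_right_ideal[OF assms(1,3)]])
  ultimately have "A = {\<zero>}" by blast
  then show False using zero_notin_gabriel[OF assms(1,2)] assms(3) by simp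
qed

text \<open>The regular module is torsion-free: in a domain a nonzero \<open>b\<close> has zero
  annihilator, and \<open>{\<zero>}\<close> is not in the filter. Hence the second entry of a
  fraction is always \<open>{\<zero>}\<close>.\<close>

lemma belongs_to_ideal_iff:
  assumes V: "V \<in> \<B>" "p \<in> V" and B: "right_ideal B R"
  shows "belongs_to R (T V) (submod S B) \<longleftrightarrow> B = {\<zero>}"
proof
  assume "belongs_to R (T V) (submod S B)"
  then obtain Z h where Z: "Z \<in> T V" "h \<in> rmod_hom R Z (submod S B)"
    "bij_betw h (carrier Z) (carrier (submod S B))"
    unfolding belongs_to_def rmod_iso_def by auto
  have rZ: "right_module R Z" using torsion_classD(1)[OF torsion_class_T[OF V(1)] Z(1)] .
  have rB: "right_module R (submod S B)"
    using right_module.right_module_submod[OF right_module_regular B] .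
  have "b = \<zero>" if b: "b \<in> B" for b
  proof (rule ccontr)
    assume "b \<noteq> \<zero>"
    have bR: "b \<in> carrier R" using right_ideal_mem[OF B b] .
    obtain z where z: "z \<in> carrier Z" "h z = b"
      using b Z(3) by (auto simp: bij_betw_def image_iff dest: equalityD2)
    have "r = \<zero>" if r: "r \<in> carrier R" "r \<odot>\<^bsub>Z\<^esub> z = \<zero>\<^bsub>Z\<^esub>" for r
    proof -
      have "b \<otimes> r = \<zero>"
        using rmod_hom_smult[OF Z(2) r(1) z(1)] rmod_hom_zero[OF rZ rB Z(2)] r(2) z(2) by simp
      then show ?thesis using integral[of b r] bR r(1) \<open>b \<noteq> \<zero>\<close> by auto
    qed
    moreover have "\<zero> \<odot>\<^bsub>Z\<^esub> z = \<zero>\<^bsub>Z\<^esub>" using right_module.smult_l_zero[OF rZ z(1)] .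
    ultimately have "{r \<in> carrier R. r \<odot>\<^bsub>Z\<^esub> z = \<zero>\<^bsub>Z\<^esub>} = {\<zero>}" by blast
    then have "{\<zero>} \<in> gabriel R (T V)"
      using gabriel_annihilator[OF torsion_class_T[OF V(1)] Z(1) z(1)] by simp
    then show False using zero_notin_gabriel[OF V] by simp
  qed
  then show "B = {\<zero>}" using right_ideal_zero[OF B] by blast
next
  assume B0: "B = {\<zero>}"
  obtain M where M: "right_module R M" "basic_open R M = V" "T V = generated_torsion_class R M"
    using basic_open_torsion[OF V(1)] .
  interpret M: right_module R M by (rule M(1))
  \<comment> \<open>A zero module in the universe, torsion as a submodule of
    \<open>M\<close>.\<close>
  define Z where "Z = submod M {\<zero>\<^bsub>M\<^esub>}"
  have Z: "right_module R Z" unfolding Z_def by (rule M.right_module_submod[OF M.submodule_zero_set])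
  have "(\<lambda>x. x) \<in> rmod_mono R Z M" by (auto simp: rmod_mono_def rmod_hom_def Z_def)
  then have "Z \<in> T V"
    using torsion_classD(2)[OF torsion_class_T[OF V(1)] Z] torsion_class_generated(2)[OF M(1)] M(3) by simp
  moreover have "rmod_iso R Z (submod S B)"
    unfolding rmod_iso_def
    by (intro bexI[of _ "\<lambda>_. \<zero>"]) (auto simp: rmod_hom_def Z_def B0 bij_betw_def)
  ultimately show "belongs_to R (T V) (submod S B)" unfolding belongs_to_def by auto
qed

lemma coset_zero: "x \<in> carrier R \<Longrightarrow> a_r_coset S {\<zero>} x = {x}"
  by (simp add: a_r_coset_def')

text \<open>Cosets of the zero ideal are singletons, so \<open>R/0\<close> is \<open>R\<close> up to
  braces.\<close>

lemma quot_zero_hom_iff: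
  assumes A: "right_ideal A R"
  shows "f \<in> rmod_hom R (submod S A) (quot_rmod S {\<zero>}) \<longleftrightarrow>
    (\<exists>g\<in>rmod_hom R (submod S A) S. \<forall>x\<in>A. f x = {g x})"
proof -
  let ?Q = "quot_rmod S {\<zero>}"
  note c = quot_rmod_epi(1)[OF right_module_regular right_ideal_zero_set]
  have ch: "a_r_coset S {\<zero>} \<in> rmod_hom R S ?Q" by (rule rmod_epiD[OF c])
  have car: "{x} \<in> carrier ?Q" if "x \<in> carrier R" for x
    using rmod_hom_closed[OF ch, of x] that by (simp add: coset_zero)
  have car': "\<exists>x\<in>carrier R. y = {x}" if "y \<in> carrier ?Q" for y
    using rmod_epi_ex[OF c that] coset_zero by auto
  have add: "{x} \<oplus>\<^bsub>?Q\<^esub> {y} = {x \<oplus> y}" if "x \<in> carrier R" "y \<in> carrier R" for x y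
    using rmod_hom_add[OF ch, of x y] that by (simp add: coset_zero)
  have sm: "a \<odot>\<^bsub>?Q\<^esub> {x} = {x \<otimes> a}" if "x \<in> carrier R" "a \<in> carrier R" for x a
    using rmod_hom_smult[OF ch, of a x] that by (simp add: coset_zero)
  note A' = right_ideal_add[OF A] right_ideal_mult[OF A]
  show ?thesis
  proof
    assume f: "f \<in> rmod_hom R (submod S A) ?Q"
    define g where "g x = the_elem (f x)" for x
    have g: "g x \<in> carrier R" "f x = {g x}" if "x \<in> A" for x
    proof -
      have "f x \<in> carrier ?Q" using rmod_hom_closed[OF f, of x] that by simp
      from car'[OF this] obtain y where "y \<in> carrier R" "f x = {y}" by (elim bexE)
      then show "g x \<in> carrier R" "f x = {g x}" by (simp_all add: g_def)
    qed
    have "g \<in> rmod_hom R (submod S A) S"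
    proof (rule rmod_homI)
      fix x y assume "x \<in> carrier (submod S A)" "y \<in> carrier (submod S A)"
      then show "g (x \<oplus>\<^bsub>submod S A\<^esub> y) = g x \<oplus>\<^bsub>S\<^esub> g y"
        using rmod_hom_add[OF f, of x y] g[of x] g[of y] g[of "x \<oplus> y"] A' add by simp
    next
      fix a x assume "a \<in> carrier R" "x \<in> carrier (submod S A)"
      then show "g (a \<odot>\<^bsub>submod S A\<^esub> x) = a \<odot>\<^bsub>S\<^esub> g x"
        using rmod_hom_smult[OF f, of a x] g[of x] g[of "x \<otimes> a"] A' sm by simp
    qed (use g in simp)
    then show "\<exists>g\<in>rmod_hom R (submod S A) S. \<forall>x\<in>A. f x = {g x}" using g by auto
  next
    assume "\<exists>g\<in>rmod_hom R (submod S A) S. \<forall>x\<in>A. f x = {g x}"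
    then obtain g where g: "g \<in> rmod_hom R (submod S A) S" "\<And>x. x \<in> A \<Longrightarrow> f x = {g x}" by auto
    have gc: "g x \<in> carrier R" if "x \<in> A" for x using rmod_hom_closed[OF g(1), of x] that by simp
    show "f \<in> rmod_hom R (submod S A) ?Q"
    proof (rule rmod_homI)
      fix x y assume "x \<in> carrier (submod S A)" "y \<in> carrier (submod S A)"
      then show "f (x \<oplus>\<^bsub>submod S A\<^esub> y) = f x \<oplus>\<^bsub>?Q\<^esub> f y"
        using rmod_hom_add[OF g(1), of x y] g(2) gc A' add by simp
    next
      fix a x assume "a \<in> carrier R" "x \<in> carrier (submod S A)"
      then show "f (a \<odot>\<^bsub>submod S A\<^esub> x) = a \<odot>\<^bsub>?Q\<^esub> f x"
        using rmod_hom_smult[OF g(1), of a x] g(2) gc A' sm by simp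
    qed (use g(2) gc car in simp)
  qed
qed

lemma fraction_iff:
  assumes V: "V \<in> \<B>" "p \<in> V"
  shows "(A, B, f) \<in> fractions R (T V) S S \<longleftrightarrow> A \<in> gabriel R (T V) \<and> B = {\<zero>} \<and>
    (\<exists>g\<in>rmod_hom R (submod S A) S. \<forall>x\<in>A. f x = {g x})"
proof
  assume *: "(A, B, f) \<in> fractions R (T V) S S"
  then have "right_ideal B R" "belongs_to R (T V) (submod S B)" by (simp_all add: fractions_def)
  then have B: "B = {\<zero>}" using belongs_to_ideal_iff[OF V, of B] by simp
  with * show "A \<in> gabriel R (T V) \<and> B = {\<zero>} \<and> (\<exists>g\<in>rmod_hom R (submod S A) S. \<forall>x\<in>A. f x = {g x})"
    using quot_zero_hom_iff[of A f] by (simp add: fractions_def gabriel_def)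
next
  assume *: "A \<in> gabriel R (T V) \<and> B = {\<zero>} \<and> (\<exists>g\<in>rmod_hom R (submod S A) S. \<forall>x\<in>A. f x = {g x})"
  then have "right_ideal A R" by (simp add: gabriel_def)
  with * show "(A, B, f) \<in> fractions R (T V) S S"
    using belongs_to_ideal_iff[OF V right_ideal_zero_set] quot_zero_hom_iff[of A f] right_ideal_zero_set
    by (simp add: fractions_def gabriel_def)
qed

lemma set_add_zero: "x \<in> carrier R \<Longrightarrow> {x} <+>\<^bsub>S\<^esub> {\<zero>} = {x}"
  by (simp add: set_add_def')

text \<open>\<open>D\<close> has to be zero as well, so equality of fractions reduces to agreement
  on a smaller right ideal of the filter.\<close>

lemma fraction_rel_iff:
  assumes V: "V \<in> \<B>" "p \<in> V"
  shows "((A, B, f), (A', B', f')) \<in> fraction_rel R (T V) S S \<longleftrightarrow>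
    (A, B, f) \<in> fractions R (T V) S S \<and> (A', B', f') \<in> fractions R (T V) S S \<and>
    (\<exists>C\<in>gabriel R (T V). C \<subseteq> A \<inter> A' \<and> (\<forall>x\<in>C. f x = f' x))"
proof (cases "(A, B, f) \<in> fractions R (T V) S S \<and> (A', B', f') \<in> fractions R (T V) S S")
  case False
  then show ?thesis by (auto simp: fraction_rel_def)
next
  case True
  then obtain g g' where B: "B = {\<zero>}" "B' = {\<zero>}"
    and g: "g \<in> rmod_hom R (submod S A) S" "\<And>x. x \<in> A \<Longrightarrow> f x = {g x}"
    and g': "g' \<in> rmod_hom R (submod S A') S" "\<And>x. x \<in> A' \<Longrightarrow> f' x = {g' x}"
    unfolding fraction_iff[OF V] by auto
  have f0: "f x <+>\<^bsub>S\<^esub> {\<zero>} = f x" if "x \<in> A" for x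
    using g that rmod_hom_closed[OF g(1), of x] set_add_zero by simp
  have f'0: "f' x <+>\<^bsub>S\<^esub> {\<zero>} = f' x" if "x \<in> A'" for x
    using g' that rmod_hom_closed[OF g'(1), of x] set_add_zero by simp
  have agree: "(\<forall>x\<in>C. f x <+>\<^bsub>S\<^esub> {\<zero>} = f' x <+>\<^bsub>S\<^esub> {\<zero>}) \<longleftrightarrow> (\<forall>x\<in>C. f x = f' x)"
    if "C \<subseteq> A \<inter> A'" for C
  proof (rule ball_cong[OF refl])
    fix x assume "x \<in> C"
    then have "x \<in> A" "x \<in> A'" using that by auto
    then show "(f x <+>\<^bsub>S\<^esub> {\<zero>} = f' x <+>\<^bsub>S\<^esub> {\<zero>}) \<longleftrightarrow> f x = f' x" using f0 f'0 by simp
  qed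
  let ?P = "\<lambda>C D. submodule C R S \<and> C \<subseteq> A \<inter> A' \<and> belongs_to R (T V) (quot_rmod S C) \<and>
    submodule D R S \<and> B \<union> B' \<subseteq> D \<and> belongs_to R (T V) (submod S D) \<and>
    (\<forall>x\<in>C. f x <+>\<^bsub>S\<^esub> D = f' x <+>\<^bsub>S\<^esub> D)"
  have "?P C D \<longleftrightarrow> C \<in> gabriel R (T V) \<and> D = {\<zero>} \<and> C \<subseteq> A \<inter> A' \<and> (\<forall>x\<in>C. f x = f' x)" for C D
  proof
    assume P: "?P C D"
    then have "right_ideal D R" "belongs_to R (T V) (submod S D)" by simp_all
    then have "D = {\<zero>}" using belongs_to_ideal_iff[OF V, of D] by simp
    with P show "C \<in> gabriel R (T V) \<and> D = {\<zero>} \<and> C \<subseteq> A \<inter> A' \<and> (\<forall>x\<in>C. f x = f' x)"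
      using agree[of C] by (simp add: gabriel_def)
  next
    assume *: "C \<in> gabriel R (T V) \<and> D = {\<zero>} \<and> C \<subseteq> A \<inter> A' \<and> (\<forall>x\<in>C. f x = f' x)"
    then show "?P C D"
      using belongs_to_ideal_iff[OF V right_ideal_zero_set] right_ideal_zero_set B agree[of C]
      by (simp add: gabriel_def)
  qed
  then have "(\<exists>C D. ?P C D) \<longleftrightarrow> (\<exists>C\<in>gabriel R (T V). C \<subseteq> A \<inter> A' \<and> (\<forall>x\<in>C. f x = f' x))" by auto
  then show ?thesis using True by (simp add: fraction_rel_def)
qed

lemma linear_mult: "g \<in> rmod_hom R (submod S A) S \<Longrightarrow> x \<in> A \<Longrightarrow> r \<in> carrier R \<Longrightarrow> g (x \<otimes> r) = g x \<otimes> r"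
  and linear_closed: "g \<in> rmod_hom R (submod S A) S \<Longrightarrow> x \<in> A \<Longrightarrow> g x \<in> carrier R"
  using rmod_hom_smult[of g R "submod S A" S r x] rmod_hom_closed[of g R "submod S A" S x] by simp_all

text \<open>The Ore condition gives \<open>x r = c s\<close> in \<open>C\<close> with
  \<open>r \<noteq> 0\<close>. So \<open>g x\<close> and \<open>g' x\<close> agree after
  multiplication by \<open>r\<close>, which cancels.\<close>

lemma linear_rigid:
  assumes A: "right_ideal A R" "g \<in> rmod_hom R (submod S A) S"
    and A': "right_ideal A' R" "g' \<in> rmod_hom R (submod S A') S"
    and C: "right_ideal C R" "C \<subseteq> A \<inter> A'" "c \<in> C" "c \<noteq> \<zero>" "\<And>x. x \<in> C \<Longrightarrow> g x = g' x"
    and x: "x \<in> A" "x \<in> A'"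
  shows "g x = g' x"
proof (cases "x = \<zero>")
  case True
  then show ?thesis using C(5)[OF right_ideal_zero[OF C(1)]] by simp
next
  case False
  have xR: "x \<in> carrier R" and cR: "c \<in> carrier R"
    using right_ideal_mem[OF A(1) x(1)] right_ideal_mem[OF C(1,3)] .
  obtain r s where rs: "r \<in> carrier R" "s \<in> carrier R" "x \<otimes> r = c \<otimes> s" "x \<otimes> r \<noteq> \<zero>"
    using right_ore[OF xR False cR C(4)] by auto
  have "g (x \<otimes> r) = g' (x \<otimes> r)"
    unfolding rs(3) by (rule C(5)[OF right_ideal_mult[OF C(1,3) rs(2)]])
  then have "g x \<otimes> r = g' x \<otimes> r"
    using linear_mult[OF A(2) x(1) rs(1)] linear_mult[OF A'(2) x(2) rs(1)] by simp
  moreover have "r \<noteq> \<zero>" using rs(4) xR by auto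
  ultimately show ?thesis
    using right_cancel[of "g x" r "g' x"] linear_closed[OF A(2) x(1)] linear_closed[OF A'(2) x(2)] rs(1) by simp
qed

section \<open>Sections given by elements of the ring\<close>

lemma linear_left_mult:
  "a \<in> carrier R \<Longrightarrow> right_ideal A R \<Longrightarrow> (\<lambda>x. a \<otimes> x) \<in> rmod_hom R (submod S A) S"
  by (rule rmod_homI) (auto simp: r_distr m_assoc right_ideal_mem)

text \<open>The whole equivalence class of left multiplication by \<open>a\<close> in explicit form;
  over nonempty \<open>V\<close> this is \<open>mult_class_rel\<close>. Membership then needs no
  search for a common smaller domain.\<close>

definition mult_class :: "('a, 'u) module set set \<Rightarrow> 'a \<Rightarrow> ('a, 'a) fraction set" where
  "mult_class V a = {(A, B, f). A \<in> gabriel R (T V) \<and> B = {\<zero>} \<and> (\<forall>x\<in>A. f x = {a \<otimes> x})}"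

lemma mult_class_fraction:
  assumes "V \<in> \<B>" "p \<in> V" "a \<in> carrier R" "t \<in> mult_class V a"
  shows "t \<in> fractions R (T V) S S"
proof -
  obtain A B f where t: "t = (A, B, f)" by (cases t)
  show ?thesis
    using assms(4) linear_left_mult[OF assms(3) gabriel_T_right_ideal[OF assms(1)], of A]
    unfolding t fraction_iff[OF assms(1,2)] mult_class_def by auto
qed

text \<open>By \<open>linear_rigid\<close>, a fraction that agrees with multiplication by
  \<open>a\<close> on a smaller domain is that multiplication on its whole domain. Conversely, two
  such fractions agree on the intersection of their domains.\<close>

lemma mult_class_rel:
  assumes V: "V \<in> \<B>" "p \<in> V" and a: "a \<in> carrier R" and t: "t \<in> mult_class V a"
  shows "fraction_rel R (T V) S S `` {t} = mult_class V a"
proof -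
  obtain A B f where t': "t = (A, B, f)" by (cases t)
  have A: "A \<in> gabriel R (T V)" "B = {\<zero>}" "\<And>x. x \<in> A \<Longrightarrow> f x = {a \<otimes> x}"
    using t by (simp_all add: t' mult_class_def)
  note G = gabriel_T_right_ideal[OF V(1)]
  have "(t, (A', B', f')) \<in> fraction_rel R (T V) S S \<longleftrightarrow> (A', B', f') \<in> mult_class V a" for A' B' f'
  proof
    assume "(t, (A', B', f')) \<in> fraction_rel R (T V) S S"
    then have f': "(A', B', f') \<in> fractions R (T V) S S" and
      ex: "\<exists>C\<in>gabriel R (T V). C \<subseteq> A \<inter> A' \<and> (\<forall>x\<in>C. f x = f' x)"
      unfolding t' fraction_rel_iff[OF V] by auto
    from f' obtain g where g: "A' \<in> gabriel R (T V)" "B' = {\<zero>}" "g \<in> rmod_hom R (submod S A') S"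
      "\<And>x. x \<in> A' \<Longrightarrow> f' x = {g x}" unfolding fraction_iff[OF V] by auto
    from ex obtain C where C: "C \<in> gabriel R (T V)" "C \<subseteq> A \<inter> A'" "\<And>x. x \<in> C \<Longrightarrow> f x = f' x" by auto
    obtain c where c: "c \<in> C" "c \<noteq> \<zero>" using gabriel_T_nonzero[OF V C(1)] by auto
    have "g x = a \<otimes> x" if "x \<in> C" for x
    proof -
      have "x \<in> A" "x \<in> A'" using that C(2) by auto
      then show ?thesis using C(3)[OF that] A(3) g(4) by simp
    qed
    then have "a \<otimes> x = g x" if "x \<in> A'" for x
      using linear_rigid[OF right_ideal_carrier linear_left_mult[OF a right_ideal_carrier] G[OF g(1)] g(3)
          G[OF C(1)] _ c, of x] that right_ideal_mem[OF G[OF g(1)] that] C(2) right_ideal_mem[OF G[OF C(1)]]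
      by auto
    then show "(A', B', f') \<in> mult_class V a" using g by (simp add: mult_class_def)
  next
    assume f': "(A', B', f') \<in> mult_class V a"
    then have "A' \<in> gabriel R (T V)" by (simp add: mult_class_def)
    then have "A \<inter> A' \<in> gabriel R (T V)" by (rule gabriel_T_Int[OF V(1) A(1)])
    moreover have "\<forall>x\<in>A \<inter> A'. f x = f' x" using A(3) f' by (simp add: mult_class_def)
    ultimately show "(t, (A', B', f')) \<in> fraction_rel R (T V) S S"
      using mult_class_fraction[OF V a t] mult_class_fraction[OF V a f']
      unfolding t' fraction_rel_iff[OF V] by (intro conjI bexI[of _ "A \<inter> A'"]) auto
  qed
  then show ?thesis by auto
qed

lemma mult_class_global:
  assumes V: "V \<in> \<B>"
  shows "(carrier R, {\<zero>}, \<lambda>x. {a \<otimes> x}) \<in> mult_class V a"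
  using gabriel_T_carrier[OF V] by (simp add: mult_class_def)

lemma mult_class_closed:
  assumes V: "V \<in> \<B>" "p \<in> V" and a: "a \<in> carrier R"
  shows "mult_class V a \<in> carrier (loc_ring R V)"
proof -
  let ?t = "(carrier R, {\<zero>}, \<lambda>x. {a \<otimes> x})"
  have "fraction_rel R (T V) S S `` {?t} \<in> fractions R (T V) S S // fraction_rel R (T V) S S"
    by (rule Equiv_Relations.quotientI[OF mult_class_fraction[OF V a mult_class_global[OF V(1)]]])
  then show ?thesis
    using mult_class_rel[OF V a mult_class_global[OF V(1)]]
    by (simp add: loc_ring_def quot_End_def quot_hom_def)
qed

lemma fraction_rel_refl:
  assumes V: "V \<in> \<B>" "p \<in> V" and u: "u \<in> fractions R (T V) S S"
  shows "(u, u) \<in> fraction_rel R (T V) S S"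
proof -
  obtain A B f where t': "u = (A, B, f)" by (cases u)
  then have "A \<in> gabriel R (T V)" using u by (simp add: fraction_iff[OF V])
  then show ?thesis using u unfolding t' fraction_rel_iff[OF V] by auto
qed

lemma fraction_rel_sym:
  assumes V: "V \<in> \<B>" "p \<in> V" and "(u, w) \<in> fraction_rel R (T V) S S"
  shows "(w, u) \<in> fraction_rel R (T V) S S"
proof -
  obtain A B f A' B' f' where t': "u = (A, B, f)" "w = (A', B', f')" by (cases u, cases w)
  have *: "u \<in> fractions R (T V) S S" "w \<in> fractions R (T V) S S"
    "\<exists>C\<in>gabriel R (T V). C \<subseteq> A \<inter> A' \<and> (\<forall>x\<in>C. f x = f' x)"
    using assms(3) unfolding t' fraction_rel_iff[OF V] by simp_all
  from *(3) obtain C where C: "C \<in> gabriel R (T V)" "C \<subseteq> A \<inter> A'" "\<forall>x\<in>C. f x = f' x" by (elim bexE conjE)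
  then have "C \<subseteq> A' \<inter> A" "\<forall>x\<in>C. f' x = f x" by auto
  then show ?thesis using *(1,2) C(1) unfolding t' fraction_rel_iff[OF V] by (intro conjI bexI[of _ C])
qed

lemma loc_ring_element:
  assumes V: "V \<in> \<B>" "p \<in> V" and s: "s \<in> carrier (loc_ring R V)"
  obtains A f g where "(A, {\<zero>}, f) \<in> s" "s = fraction_rel R (T V) S S `` {(A, {\<zero>}, f)}"
    "A \<in> gabriel R (T V)" "g \<in> rmod_hom R (submod S A) S" "\<And>x. x \<in> A \<Longrightarrow> f x = {g x}"
proof -
  obtain u where u: "u \<in> fractions R (T V) S S" "s = fraction_rel R (T V) S S `` {u}"
    using s by (auto simp: loc_ring_def quot_End_def quot_hom_def quotient_def)
  obtain A B f where t': "u = (A, B, f)" by (cases u)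
  obtain g where g: "A \<in> gabriel R (T V)" "B = {\<zero>}" "g \<in> rmod_hom R (submod S A) S"
    "\<And>x. x \<in> A \<Longrightarrow> f x = {g x}" using u(1) unfolding t' fraction_iff[OF V] by auto
  have "u \<in> s" using fraction_rel_refl[OF V u(1)] u(2) by auto
  then show ?thesis using that[of A f g] g u(2) t' by simp
qed

text \<open>Classes with a common member coincide; symmetry of the relation together with the
  explicit form of \<open>mult_class\<close> suffices.\<close>

lemma mult_class_eqI:
  assumes V: "V \<in> \<B>" "p \<in> V" and a: "a \<in> carrier R" and s: "s \<in> carrier (loc_ring R V)"
    and u: "u \<in> s" "u \<in> mult_class V a"
  shows "s = mult_class V a"
proof -
  obtain w where w: "w \<in> fractions R (T V) S S" "s = fraction_rel R (T V) S S `` {w}"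
    using s by (auto simp: loc_ring_def quot_End_def quot_hom_def quotient_def)
  have "(w, u) \<in> fraction_rel R (T V) S S" using u(1) w(2) by simp
  then have "w \<in> fraction_rel R (T V) S S `` {u}" using fraction_rel_sym[OF V] by auto
  then have "w \<in> mult_class V a" using mult_class_rel[OF V a u(2)] by simp
  then show ?thesis using mult_class_rel[OF V a] w(2) by simp
qed

lemma mult_class_inj:
  assumes V: "V \<in> \<B>" and "mult_class V a = mult_class V b" "a \<in> carrier R" "b \<in> carrier R"
  shows "a = b"
proof -
  have "(carrier R, {\<zero>}, \<lambda>x. {a \<otimes> x}) \<in> mult_class V b"
    using mult_class_global[OF V, of a] assms(2) by simp
  then have "{a \<otimes> \<one>} = {b \<otimes> \<one>}" unfolding mult_class_def by auto
  then show ?thesis using assms(3,4) by simp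
qed

text \<open>The operations of \<open>quot_End\<close> apply the relation to all combinations of
  representatives. It is therefore enough that these combinations form a nonempty part of the
  expected class.\<close>

lemma rel_image_mult_class:
  assumes V: "V \<in> \<B>" "p \<in> V" and a: "a \<in> carrier R" and "K \<subseteq> mult_class V a" "K \<noteq> {}"
  shows "fraction_rel R (T V) S S `` K = mult_class V a"
proof -
  have "fraction_rel R (T V) S S `` K = (\<Union>t\<in>K. fraction_rel R (T V) S S `` {t})" by auto
  also have "\<dots> = (\<Union>t\<in>K. mult_class V a)"
    by (rule SUP_cong[OF refl], rule mult_class_rel[OF V a]) (use assms(4) in auto)
  also have "\<dots> = mult_class V a" using assms(5) by simp
  finally show ?thesis .
qed

lemma mult_class_mult:
  assumes V: "V \<in> \<B>" "p \<in> V" and a: "a \<in> carrier R" and b: "b \<in> carrier R"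
  shows "mult_class V a \<otimes>\<^bsub>loc_ring R V\<^esub> mult_class V b = mult_class V (a \<otimes> b)"
proof -
  have "fraction_comp s t \<in> mult_class V (a \<otimes> b)" if s: "s \<in> mult_class V a" and t: "t \<in> mult_class V b" for s t
  proof -
    obtain A' B' g where s': "s = (A', B', g)" by (cases s)
    obtain A B f where t': "t = (A, B, f)" by (cases t)
    have g: "A' \<in> gabriel R (T V)" "B' = {\<zero>}" "\<And>x. x \<in> A' \<Longrightarrow> g x = {a \<otimes> x}"
      using s by (simp_all add: s' mult_class_def)
    have f: "A \<in> gabriel R (T V)" "B = {\<zero>}" "\<And>x. x \<in> A \<Longrightarrow> f x = {b \<otimes> x}"
      using t by (simp_all add: t' mult_class_def)
    note A = gabriel_T_right_ideal[OF V(1) f(1)] and A' = gabriel_T_right_ideal[OF V(1) g(1)]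
    \<comment> \<open>\<open>f x\<close> has the single element \<open>b x\<close>, so it meets
      \<open>A'\<close> exactly when \<open>x\<close> lies in \<open>(A' : b)\<close>.\<close>
    have dom: "{x \<in> A. f x \<inter> A' \<noteq> {}} = A \<inter> colon R A' b"
      using f(3) right_ideal_mem[OF A] by (auto simp: colon_def)
    have "A \<inter> colon R A' b \<in> gabriel R (T V)"
      by (rule gabriel_T_Int[OF V(1) f(1) gabriel_colon[OF torsion_class_T[OF V(1)] g(1) b]])
    moreover have "\<Union> (g ` (A' \<inter> B)) = {\<zero>}"
      using right_ideal_zero[OF A'] g(3) a by (simp add: f(2))
    moreover have "\<Union> (g ` (A' \<inter> f x)) = {(a \<otimes> b) \<otimes> x}" if "x \<in> A \<inter> colon R A' b" for x
    proof -
      have "x \<in> A" "b \<otimes> x \<in> A'" "x \<in> carrier R" using that by (auto simp: colon_def)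
      then show ?thesis using f(3)[of x] g(3)[of "b \<otimes> x"] a b by (simp add: m_assoc)
    qed
    ultimately show ?thesis by (simp add: s' t' fraction_comp_def mult_class_def dom)
  qed
  then have "{fraction_comp g f | g f. g \<in> mult_class V a \<and> f \<in> mult_class V b} \<subseteq> mult_class V (a \<otimes> b)"
    by auto
  moreover have "{fraction_comp g f | g f. g \<in> mult_class V a \<and> f \<in> mult_class V b} \<noteq> {}"
    using mult_class_global[OF V(1), of a] mult_class_global[OF V(1), of b] by blast
  ultimately show ?thesis
    using rel_image_mult_class[OF V m_closed[OF a b]] by (simp add: loc_ring_def quot_End_def quot_comp_def)
qed

lemma mult_class_add:
  assumes V: "V \<in> \<B>" "p \<in> V" and a: "a \<in> carrier R" and b: "b \<in> carrier R"
  shows "mult_class V a \<oplus>\<^bsub>loc_ring R V\<^esub> mult_class V b = mult_class V (a \<oplus> b)"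
proof -
  have "fraction_add S s t \<in> mult_class V (a \<oplus> b)" if s: "s \<in> mult_class V a" and t: "t \<in> mult_class V b" for s t
  proof -
    obtain A' B' g where s': "s = (A', B', g)" by (cases s)
    obtain A B f where t': "t = (A, B, f)" by (cases t)
    have g: "A' \<in> gabriel R (T V)" "B' = {\<zero>}" "\<And>x. x \<in> A' \<Longrightarrow> g x = {a \<otimes> x}"
      using s by (simp_all add: s' mult_class_def)
    have f: "A \<in> gabriel R (T V)" "B = {\<zero>}" "\<And>x. x \<in> A \<Longrightarrow> f x = {b \<otimes> x}"
      using t by (simp_all add: t' mult_class_def)
    have "g x <+>\<^bsub>S\<^esub> f x = {(a \<oplus> b) \<otimes> x}" if "x \<in> A' \<inter> A" for x
      using that f(3)[of x] g(3)[of x] a b right_ideal_mem[OF gabriel_T_right_ideal[OF V(1) f(1)], of x]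
      by (simp add: set_add_def' l_distr)
    then show ?thesis
      using gabriel_T_Int[OF V(1) g(1) f(1)] g(2) f(2) set_add_zero[of \<zero>]
      by (simp add: s' t' fraction_add_def mult_class_def)
  qed
  then have "{fraction_add S f g | f g. f \<in> mult_class V a \<and> g \<in> mult_class V b} \<subseteq> mult_class V (a \<oplus> b)"
    by auto
  moreover have "{fraction_add S f g | f g. f \<in> mult_class V a \<and> g \<in> mult_class V b} \<noteq> {}"
    using mult_class_global[OF V(1), of a] mult_class_global[OF V(1), of b] by blast
  ultimately show ?thesis
    using rel_image_mult_class[OF V a_closed[OF a b]] by (simp add: loc_ring_def quot_End_def quot_add_def)
qed

text \<open>Covers \<open>\<one>\<close> and \<open>\<zero>\<close>, which \<open>quot_End\<close>
  defines as images of module endomorphisms.\<close>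

lemma mult_class_functor:
  assumes V: "V \<in> \<B>" "p \<in> V" and a: "a \<in> carrier R" and "\<And>x. x \<in> carrier R \<Longrightarrow> h x = a \<otimes> x"
  shows "quot_functor R (T V) S S h = mult_class V a"
proof -
  have "(carrier R, {\<zero>}, \<lambda>x. {h x}) \<in> mult_class V a"
    using gabriel_T_carrier[OF V(1)] assms(4) by (simp add: mult_class_def)
  from mult_class_rel[OF V a this] show ?thesis by (simp add: quot_functor_def)
qed

lemma mult_class_one: "V \<in> \<B> \<Longrightarrow> p \<in> V \<Longrightarrow> \<one>\<^bsub>loc_ring R V\<^esub> = mult_class V \<one>"
  and mult_class_zero: "V \<in> \<B> \<Longrightarrow> p \<in> V \<Longrightarrow> \<zero>\<^bsub>loc_ring R V\<^esub> = mult_class V \<zero>"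
  using mult_class_functor[of V p \<one> "\<lambda>x. x"] mult_class_functor[of V p \<zero> "\<lambda>x. \<zero>"]
  by (simp_all add: loc_ring_def quot_End_def)

lemma mult_class_restrict:
  assumes VW: "V \<in> \<B>" "W \<in> \<B>" "p \<in> W" "W \<subseteq> V" and a: "a \<in> carrier R"
  shows "loc_restrict R V W (mult_class V a) = mult_class W a"
proof -
  have "mult_class V a \<subseteq> mult_class W a"
    using gabriel_T_restrict[OF VW(1,2,4)] by (auto simp: mult_class_def)
  then show ?thesis
    using rel_image_mult_class[OF VW(2,3) a] mult_class_global[OF VW(1), of a]
    by (auto simp: loc_restrict_def quot_change_def)
qed

lemma fraction_restrict:
  assumes VW: "V \<in> \<B>" "W \<in> \<B>" "p \<in> W" "W \<subseteq> V" and t: "t \<in> fractions R (T V) S S"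
  shows "t \<in> fractions R (T W) S S"
proof -
  have p: "p \<in> V" using VW by auto
  obtain A B f where t': "t = (A, B, f)" by (cases t)
  show ?thesis
    using t gabriel_T_restrict[OF VW(1,2,4), of A]
    unfolding t' fraction_iff[OF VW(1) p] fraction_iff[OF VW(2,3)] by auto
qed

text \<open>Restriction keeps every triple of a class. A representative of \<open>t\<close> with
  domain \<open>A\<close> therefore lies in \<open>mult_class W a\<close>, so it is multiplication
  by \<open>a\<close> on all of \<open>A\<close>, and \<open>A\<close> is already in the filter of
  \<open>V\<close>.\<close>

lemma mult_class_rigid:
  assumes VW: "V \<in> \<B>" "W \<in> \<B>" "p \<in> W" "W \<subseteq> V" and a: "a \<in> carrier R"
    and t: "t \<in> carrier (loc_ring R V)" "loc_restrict R V W t = mult_class W a"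
  shows "t = mult_class V a"
proof -
  have p: "p \<in> V" using VW by auto
  obtain A f g where u: "(A, {\<zero>}, f) \<in> t" "A \<in> gabriel R (T V)" "g \<in> rmod_hom R (submod S A) S"
    "\<And>x. x \<in> A \<Longrightarrow> f x = {g x}"
    by (rule loc_ring_element[OF VW(1) p t(1)]) (rule that)
  have "(A, {\<zero>}, f) \<in> fractions R (T V) S S" using u(2-4) unfolding fraction_iff[OF VW(1) p] by auto
  then have "(A, {\<zero>}, f) \<in> fractions R (T W) S S" by (rule fraction_restrict[OF VW])
  then have "((A, {\<zero>}, f), (A, {\<zero>}, f)) \<in> fraction_rel R (T W) S S"
    by (rule fraction_rel_refl[OF VW(2,3)])
  then have "(A, {\<zero>}, f) \<in> mult_class W a"
    using u(1) unfolding t(2)[symmetric] loc_restrict_def quot_change_def by auto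
  then have "(A, {\<zero>}, f) \<in> mult_class V a" using u(2) by (simp add: mult_class_def)
  then show ?thesis by (rule mult_class_eqI[OF VW(1) p a t(1) u(1)])
qed

section \<open>Denominators and global sections\<close>

lemma colon_nonzero:
  assumes K: "right_ideal K R" "k \<in> K" "k \<noteq> \<zero>" and r: "r \<in> carrier R"
  shows "\<exists>c\<in>colon R K r. c \<noteq> \<zero>"
proof (cases "r = \<zero>")
  case True
  then have "\<one> \<in> colon R K r" using right_ideal_zero[OF K(1)] by (simp add: colon_def)
  then show ?thesis using one_neq_zero by (intro bexI[of _ \<one>])
next
  case False
  have kR: "k \<in> carrier R" using right_ideal_mem[OF K(1,2)] .
  obtain u v where uv: "u \<in> carrier R" "v \<in> carrier R" "r \<otimes> u = k \<otimes> v" "r \<otimes> u \<noteq> \<zero>"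
    using right_ore[OF r False kR K(3)] by auto
  then have "u \<in> colon R K r" using right_ideal_mult[OF K(1,2) uv(2)] by (simp add: colon_def)
  moreover have "u \<noteq> \<zero>" using uv r by auto
  ultimately show ?thesis by (intro bexI[of _ u])
qed

lemma Int_nonzero:
  assumes C: "right_ideal C R" "c \<in> C" "c \<noteq> \<zero>" and D: "right_ideal D R" "d \<in> D" "d \<noteq> \<zero>"
  shows "\<exists>x\<in>C \<inter> D. x \<noteq> \<zero>"
proof -
  obtain u v where uv: "u \<in> carrier R" "v \<in> carrier R" "c \<otimes> u = d \<otimes> v" "c \<otimes> u \<noteq> \<zero>"
    using right_ore[OF right_ideal_mem[OF C(1,2)] C(3) right_ideal_mem[OF D(1,2)] D(3)] by auto
  have "c \<otimes> u \<in> C" by (rule right_ideal_mult[OF C(1,2) uv(1)])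
  moreover have "d \<otimes> v \<in> D" by (rule right_ideal_mult[OF D(1,2) uv(2)])
  ultimately show ?thesis using uv(3,4) by (intro bexI[of _ "c \<otimes> u"]) simp_all
qed

text \<open>With \<open>g\<close> a fraction \<open>d\<close> of the division ring of quotients, this is the right ideal of the \<open>r\<close>
  for which \<open>dr\<close> lies in \<open>R\<close>.\<close>

definition denominators :: "'a set \<Rightarrow> ('a \<Rightarrow> 'a) \<Rightarrow> 'a set" where
  "denominators A g = {r \<in> carrier R. \<exists>s\<in>carrier R. \<exists>C. right_ideal C R \<and> (\<exists>c\<in>C. c \<noteq> \<zero>) \<and>
     (\<forall>x\<in>C. r \<otimes> x \<in> A \<and> g (r \<otimes> x) = s \<otimes> x)}"

lemma denominatorsI:
  assumes "r \<in> carrier R" "s \<in> carrier R" "right_ideal C R" "\<exists>c\<in>C. c \<noteq> \<zero>"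
    "\<And>x. x \<in> C \<Longrightarrow> r \<otimes> x \<in> A \<and> g (r \<otimes> x) = s \<otimes> x"
  shows "r \<in> denominators A g"
  unfolding denominators_def
  by (intro CollectI conjI bexI[OF _ assms(2)] exI[of _ C] ballI) (use assms in auto)

lemma denominatorsE:
  assumes "r \<in> denominators A g"
  obtains s C c where "r \<in> carrier R" "s \<in> carrier R" "right_ideal C R" "c \<in> C" "c \<noteq> \<zero>"
    "\<And>x. x \<in> C \<Longrightarrow> r \<otimes> x \<in> A" "\<And>x. x \<in> C \<Longrightarrow> g (r \<otimes> x) = s \<otimes> x"
  using assms unfolding denominators_def by blast

text \<open>Numerators add, as \<open>s \<oplus> s'\<close> on \<open>C \<inter> C'\<close>, and
  multiply, as \<open>s \<otimes> t\<close> on \<open>(C : t)\<close>; the Ore condition keeps both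
  domains nonzero.\<close>

lemma right_ideal_denominators:
  assumes A: "right_ideal A R" and g: "g \<in> rmod_hom R (submod S A) S"
  shows "right_ideal (denominators A g) R"
proof (rule right_idealI)
  show "denominators A g \<subseteq> carrier R" by (auto simp: denominators_def)
  have "g \<zero> = \<zero>"
    using linear_mult[OF g right_ideal_zero[OF A], of \<zero>] linear_closed[OF g right_ideal_zero[OF A]] by simp
  then show "\<zero> \<in> denominators A g"
    by (intro denominatorsI[of \<zero> \<zero> "carrier R"] right_ideal_carrier)
      (use one_neq_zero right_ideal_zero[OF A] in auto)
next
  fix r r' assume "r \<in> denominators A g" "r' \<in> denominators A g"
  obtain s C c where r: "r \<in> carrier R" "s \<in> carrier R" "right_ideal C R" "c \<in> C" "c \<noteq> \<zero>"
    "\<And>x. x \<in> C \<Longrightarrow> r \<otimes> x \<in> A" "\<And>x. x \<in> C \<Longrightarrow> g (r \<otimes> x) = s \<otimes> x"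
    by (rule denominatorsE[OF \<open>r \<in> _\<close>]) (rule that)
  obtain s' C' c' where r': "r' \<in> carrier R" "s' \<in> carrier R" "right_ideal C' R" "c' \<in> C'" "c' \<noteq> \<zero>"
    "\<And>x. x \<in> C' \<Longrightarrow> r' \<otimes> x \<in> A" "\<And>x. x \<in> C' \<Longrightarrow> g (r' \<otimes> x) = s' \<otimes> x"
    by (rule denominatorsE[OF \<open>r' \<in> _\<close>]) (rule that)
  show "r \<oplus> r' \<in> denominators A g"
  proof (rule denominatorsI[of "r \<oplus> r'" "s \<oplus> s'" "C \<inter> C'"])
    show "right_ideal (C \<inter> C') R" by (rule right_ideal_Int[OF r(3) r'(3)])
    show "\<exists>x\<in>C \<inter> C'. x \<noteq> \<zero>" by (rule Int_nonzero[OF r(3-5) r'(3-5)])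
    fix x assume "x \<in> C \<inter> C'"
    then have x: "x \<in> C" "x \<in> C'" "x \<in> carrier R" using right_ideal_mem[OF r(3)] by auto
    have e: "(r \<oplus> r') \<otimes> x = r \<otimes> x \<oplus> r' \<otimes> x" using r(1) r'(1) x(3) by (simp add: l_distr)
    have "g (r \<otimes> x \<oplus> r' \<otimes> x) = g (r \<otimes> x) \<oplus> g (r' \<otimes> x)"
      using rmod_hom_add[OF g, of "r \<otimes> x" "r' \<otimes> x"] r(6) r'(6) x by simp
    then show "(r \<oplus> r') \<otimes> x \<in> A \<and> g ((r \<oplus> r') \<otimes> x) = (s \<oplus> s') \<otimes> x"
      unfolding e using right_ideal_add[OF A r(6)[OF x(1)] r'(6)[OF x(2)]] r(2,7) r'(2,7) x
      by (simp add: l_distr)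
  qed (use r r' in auto)
next
  fix r t assume "r \<in> denominators A g" and t: "t \<in> carrier R"
  obtain s C c where r: "r \<in> carrier R" "s \<in> carrier R" "right_ideal C R" "c \<in> C" "c \<noteq> \<zero>"
    "\<And>x. x \<in> C \<Longrightarrow> r \<otimes> x \<in> A" "\<And>x. x \<in> C \<Longrightarrow> g (r \<otimes> x) = s \<otimes> x"
    by (rule denominatorsE[OF \<open>r \<in> _\<close>]) (rule that)
  show "r \<otimes> t \<in> denominators A g"
  proof (rule denominatorsI[of "r \<otimes> t" "s \<otimes> t" "colon R C t"])
    show "right_ideal (colon R C t) R" by (rule right_ideal_colon[OF r(3) t])
    show "\<exists>x\<in>colon R C t. x \<noteq> \<zero>" by (rule colon_nonzero[OF r(3-5) t])
    fix x assume "x \<in> colon R C t"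
    then have x: "x \<in> carrier R" "t \<otimes> x \<in> C" by (auto simp: colon_def)
    then show "(r \<otimes> t) \<otimes> x \<in> A \<and> g ((r \<otimes> t) \<otimes> x) = (s \<otimes> t) \<otimes> x"
      using r(1,2) r(6,7)[of "t \<otimes> x"] t by (simp add: m_assoc)
  qed (use r t in auto)
qed

text \<open>Another representation \<open>g'\<close> of the same fraction supplies numerators: for
  \<open>r\<close> in its domain the numerator is \<open>g' r\<close>.\<close>

lemma subset_denominators:
  assumes A: "right_ideal A R" "g \<in> rmod_hom R (submod S A) S"
    and A': "right_ideal A' R" "g' \<in> rmod_hom R (submod S A') S"
    and C: "right_ideal C R" "C \<subseteq> A \<inter> A'" "c \<in> C" "c \<noteq> \<zero>" "\<And>x. x \<in> C \<Longrightarrow> g x = g' x"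
  shows "A' \<subseteq> denominators A g"
proof
  fix r assume r: "r \<in> A'"
  have rR: "r \<in> carrier R" using right_ideal_mem[OF A'(1) r] .
  show "r \<in> denominators A g"
  proof (rule denominatorsI[of r "g' r" "colon R C r"])
    show "right_ideal (colon R C r) R" by (rule right_ideal_colon[OF C(1) rR])
    show "\<exists>x\<in>colon R C r. x \<noteq> \<zero>" by (rule colon_nonzero[OF C(1,3,4) rR])
    fix x assume "x \<in> colon R C r"
    then have x: "x \<in> carrier R" "r \<otimes> x \<in> C" by (auto simp: colon_def)
    then show "r \<otimes> x \<in> A \<and> g (r \<otimes> x) = g' r \<otimes> x"
      using C(2) C(5)[OF x(2)] linear_mult[OF A'(2) r x(1)] by auto
  qed (use rR linear_closed[OF A'(2) r] in auto)
qed

text \<open>Equality of germs is equality of classes over some \<open>Z\<close> around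
  \<open>p\<close>. Unwinding it gives agreement of the chosen representatives on a right ideal in
  the filter of \<open>Z\<close>, which is nonzero because \<open>p\<close> lies in
  \<open>Z\<close>.\<close>

lemma germ_eq_agree:
  assumes V: "V \<in> \<B>" "p \<in> V" and W: "W \<in> \<B>" "p \<in> W"
    and s: "s \<in> carrier (loc_ring R V)" "(A, B, f) \<in> s"
    and t: "t \<in> carrier (loc_ring R W)" "(A', B', f') \<in> t"
    and eq: "germ \<B> (loc_ring R) (loc_restrict R) p V s = germ \<B> (loc_ring R) (loc_restrict R) p W t"
  obtains C c where "right_ideal C R" "C \<subseteq> A \<inter> A'" "c \<in> C" "c \<noteq> \<zero>" "\<And>x. x \<in> C \<Longrightarrow> f x = f' x"
proof -
  have "(W, t) \<in> germ \<B> (loc_ring R) (loc_restrict R) p W t"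
    using W t(1) unfolding germ_def by auto
  then have "(W, t) \<in> germ \<B> (loc_ring R) (loc_restrict R) p V s" by (simp only: eq)
  then obtain Z where Z: "Z \<in> \<B>" "p \<in> Z" "Z \<subseteq> V" "Z \<subseteq> W" "loc_restrict R V Z s = loc_restrict R W Z t"
    unfolding germ_def by auto
  let ?r = "fraction_rel R (T Z) S S"
  obtain w where w: "w \<in> fractions R (T W) S S" "t = fraction_rel R (T W) S S `` {w}"
    using t(1) by (auto simp: loc_ring_def quot_End_def quot_hom_def quotient_def)
  have "(w, (A', B', f')) \<in> fraction_rel R (T W) S S" using t(2) w(2) by simp
  then have "(A', B', f') \<in> fractions R (T W) S S" by (auto simp: fraction_rel_def)
  then have "(A', B', f') \<in> fractions R (T Z) S S" by (rule fraction_restrict[OF W(1) Z(1,2,4)])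
  then have "((A', B', f'), (A', B', f')) \<in> ?r" by (rule fraction_rel_refl[OF Z(1,2)])
  then have "(A', B', f') \<in> ?r `` t" using t(2) by auto
  then have "(A', B', f') \<in> ?r `` s"
    using Z(5) by (simp add: loc_restrict_def quot_change_def)
  then obtain u where u: "u \<in> s" "(u, (A', B', f')) \<in> ?r" by auto
  obtain v where v: "v \<in> fractions R (T V) S S" "s = fraction_rel R (T V) S S `` {v}"
    using s(1) by (auto simp: loc_ring_def quot_End_def quot_hom_def quotient_def)
  obtain A0 B0 f0 where v': "v = (A0, B0, f0)" by (cases v)
  obtain A1 B1 f1 where u': "u = (A1, B1, f1)" by (cases u)
  have "(v, (A, B, f)) \<in> fraction_rel R (T V) S S" "(v, u) \<in> fraction_rel R (T V) S S"
    using s(2) u(1) v(2) by simp_all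
  then obtain C0 C1 where C: "C0 \<in> gabriel R (T V)" "C0 \<subseteq> A0 \<inter> A" "\<forall>x\<in>C0. f0 x = f x"
    "C1 \<in> gabriel R (T V)" "C1 \<subseteq> A0 \<inter> A1" "\<forall>x\<in>C1. f0 x = f1 x"
    unfolding v' u' fraction_rel_iff[OF V] by (elim bexE conjE)
  obtain C2 where C2: "C2 \<in> gabriel R (T Z)" "C2 \<subseteq> A1 \<inter> A'" "\<forall>x\<in>C2. f1 x = f' x"
    using u(2) unfolding u' fraction_rel_iff[OF Z(1,2)] by (elim bexE conjE)
  \<comment> \<open>\<open>C0\<close> and \<open>C1\<close> lead from \<open>f\<close> to
    \<open>f1\<close> through the representative \<open>f0\<close> over \<open>V\<close>;
    \<open>C2\<close> leads from \<open>f1\<close> to \<open>f'\<close> over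
    \<open>Z\<close>.\<close>
  let ?C = "C0 \<inter> C1 \<inter> C2"
  have G: "?C \<in> gabriel R (T Z)"
    by (intro gabriel_T_Int[OF Z(1)] gabriel_T_restrict[OF V(1) Z(1,3)] C C2)
  obtain c where "c \<in> ?C" "c \<noteq> \<zero>" using gabriel_T_nonzero[OF Z(1,2) G] by auto
  moreover have "?C \<subseteq> A \<inter> A'" using C C2 by auto
  moreover have "f x = f' x" if "x \<in> ?C" for x
  proof -
    have "x \<in> C0" "x \<in> C1" "x \<in> C2" using that by auto
    then show ?thesis using bspec[OF C(3)] bspec[OF C(6)] bspec[OF C2(3)] by metis
  qed
  ultimately show ?thesis using that[OF gabriel_T_right_ideal[OF Z(1) G]] by simp
qed

lemma spec_cover: "spec_points R = \<Union>\<B>"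
proof -
  have "topspace (InjSpec R :: ('a, 'u) module set topology) = \<Union>\<B>"
    unfolding InjSpec_def by (rule topology_generated_by_topspace)
  then show ?thesis using topspace_InjSpec[OF ring_axioms, where 'u = 'u] by simp
qed

lemma global_section_constant:
  assumes \<sigma>: "\<sigma> \<in> carrier (sheafification \<B> (loc_ring R) (loc_restrict R) (spec_points R))"
  shows "\<exists>a\<in>carrier R. \<forall>p\<in>spec_points R. \<exists>V\<in>\<B>. p \<in> V \<and>
    \<sigma> p = germ \<B> (loc_ring R) (loc_restrict R) p V (mult_class V a)"
proof -
  have "\<forall>p\<in>spec_points R. \<exists>V\<in>\<B>. p \<in> V \<and> V \<subseteq> spec_points R \<and> (\<exists>s\<in>carrier (loc_ring R V).
      \<forall>q\<in>V. \<sigma> q = germ \<B> (loc_ring R) (loc_restrict R) q V s)"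
    using \<sigma> by (simp add: sheafification_def)
  then obtain V s where V: "\<And>p. p \<in> spec_points R \<Longrightarrow> V p \<in> \<B>" "\<And>p. p \<in> spec_points R \<Longrightarrow> p \<in> V p"
    and s: "\<And>p. p \<in> spec_points R \<Longrightarrow> s p \<in> carrier (loc_ring R (V p))"
    and germs: "\<And>p q. p \<in> spec_points R \<Longrightarrow> q \<in> V p \<Longrightarrow>
      \<sigma> q = germ \<B> (loc_ring R) (loc_restrict R) q (V p) (s p)"
    by (metis (no_types, lifting))
  have "\<exists>A f g. (A, {\<zero>}, f) \<in> s p \<and> A \<in> gabriel R (T (V p)) \<and> g \<in> rmod_hom R (submod S A) S \<and>
      (\<forall>x\<in>A. f x = {g x})" if p: "p \<in> spec_points R" for p
  proof -
    obtain A f g where "(A, {\<zero>}, f) \<in> s p" "A \<in> gabriel R (T (V p))" "g \<in> rmod_hom R (submod S A) S"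
      "\<And>x. x \<in> A \<Longrightarrow> f x = {g x}"
      by (rule loc_ring_element[OF V[OF p] s[OF p]]) (rule that)
    then show ?thesis by (intro exI[of _ A] exI[of _ f] exI[of _ g]) simp
  qed
  then obtain A f g where A: "\<And>p. p \<in> spec_points R \<Longrightarrow> (A p, {\<zero>}, f p) \<in> s p"
    "\<And>p. p \<in> spec_points R \<Longrightarrow> A p \<in> gabriel R (T (V p))"
    and g: "\<And>p. p \<in> spec_points R \<Longrightarrow> g p \<in> rmod_hom R (submod S (A p)) S"
    "\<And>p x. p \<in> spec_points R \<Longrightarrow> x \<in> A p \<Longrightarrow> f p x = {g p x}"
    by metis
  note A' = gabriel_T_right_ideal[OF V(1) A(2)]
  \<comment> \<open>The generic point lies in every \<open>V p\<close>, so all local representations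
    can be compared there.\<close>
  obtain \<xi> where \<xi>: "\<xi> \<in> spec_points R" "\<And>V. V \<in> \<B> \<Longrightarrow> V \<noteq> {} \<Longrightarrow> \<xi> \<in> V"
    by (rule generic_point) (rule that)
  have agree: "\<exists>C c. right_ideal C R \<and> C \<subseteq> A \<xi> \<inter> A p \<and> c \<in> C \<and> c \<noteq> \<zero> \<and> (\<forall>x\<in>C. g \<xi> x = g p x)"
    if p: "p \<in> spec_points R" for p
  proof -
    have "\<xi> \<in> V p" using \<xi>(2)[OF V(1)[OF p]] V(2)[OF p] by auto
    then have "germ \<B> (loc_ring R) (loc_restrict R) \<xi> (V \<xi>) (s \<xi>) = germ \<B> (loc_ring R) (loc_restrict R) \<xi> (V p) (s p)"
      using germs[OF \<xi>(1) V(2)[OF \<xi>(1)]] germs[OF p] by simp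
    from germ_eq_agree[OF V(1)[OF \<xi>(1)] V(2)[OF \<xi>(1)] V(1)[OF p] \<open>\<xi> \<in> V p\<close> s[OF \<xi>(1)] A(1)[OF \<xi>(1)]
        s[OF p] A(1)[OF p] this]
    obtain C c where C: "right_ideal C R" "C \<subseteq> A \<xi> \<inter> A p" "c \<in> C" "c \<noteq> \<zero>" "\<And>x. x \<in> C \<Longrightarrow> f \<xi> x = f p x"
      by metis
    have "g \<xi> x = g p x" if "x \<in> C" for x
    proof -
      have "x \<in> A \<xi>" "x \<in> A p" using that C(2) by auto
      then show ?thesis using C(5)[OF that] g(2)[OF \<xi>(1)] g(2)[OF p] by simp
    qed
    then show ?thesis using C by (intro exI[of _ C] exI[of _ c]) simp
  qed
  let ?I = "denominators (A \<xi>) (g \<xi>)"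
  have I: "right_ideal ?I R" by (rule right_ideal_denominators[OF A'[OF \<xi>(1) \<xi>(1)] g(1)[OF \<xi>(1)]])
  have "\<one> \<in> ?I"
  proof (rule ccontr)
    assume "\<one> \<notin> ?I"
    obtain p and E :: "('a, 'u) module" and e where p: "p \<in> spec_points R" "E \<in> p" "e \<in> carrier E"
      "e \<noteq> \<zero>\<^bsub>E\<^esub>" "\<And>a. a \<in> ?I \<Longrightarrow> a \<odot>\<^bsub>E\<^esub> e = \<zero>\<^bsub>E\<^esub>"
      by (rule point_above[OF I \<open>\<one> \<notin> ?I\<close>]) (rule that)
    obtain C c where C: "right_ideal C R" "C \<subseteq> A \<xi> \<inter> A p" "c \<in> C" "c \<noteq> \<zero>" "\<forall>x\<in>C. g \<xi> x = g p x"
      using agree[OF p(1)] by (elim exE conjE)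
    \<comment> \<open>The decisive inclusion: the domain used near \<open>p\<close> consists of
      denominators of the generic fraction.\<close>
    have "A p \<subseteq> ?I"
      using subset_denominators[OF A'[OF \<xi>(1) \<xi>(1)] g(1)[OF \<xi>(1)] A'[OF p(1) p(1)] g(1)[OF p(1)] C(1-4)] C(5)
      by simp
    then have "e = \<zero>\<^bsub>E\<^esub>"
      using gabriel_T_annihilates[OF V(1)[OF p(1)] V(2)[OF p(1)] p(2) A(2)[OF p(1)] p(3)] p(5) by (simp add: subset_iff)
    then show False using p(4) by simp
  qed
  \<comment> \<open>The numerator that belongs to the denominator \<open>\<one>\<close> is the
    element of \<open>R\<close> sought.\<close>
  then obtain a D d where a: "a \<in> carrier R" and D: "right_ideal D R" "d \<in> D" "d \<noteq> \<zero>"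
    "\<And>x. x \<in> D \<Longrightarrow> \<one> \<otimes> x \<in> A \<xi>" "\<And>x. x \<in> D \<Longrightarrow> g \<xi> (\<one> \<otimes> x) = a \<otimes> x"
    by (rule denominatorsE) (rule that)
  have "\<exists>V\<in>\<B>. p \<in> V \<and> \<sigma> p = germ \<B> (loc_ring R) (loc_restrict R) p V (mult_class V a)"
    if p: "p \<in> spec_points R" for p
  proof -
    obtain C c where C: "right_ideal C R" "C \<subseteq> A \<xi> \<inter> A p" "c \<in> C" "c \<noteq> \<zero>" "\<forall>x\<in>C. g \<xi> x = g p x"
      using agree[OF p] by (elim exE conjE)
    obtain x0 where x0: "x0 \<in> C \<inter> D" "x0 \<noteq> \<zero>"
      using Int_nonzero[OF C(1,3,4) D(1-3)] by (elim bexE)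
    have "g p x = a \<otimes> x" if "x \<in> C \<inter> D" for x
      using that C(5) D(5)[of x] right_ideal_mem[OF D(1), of x] by simp
    moreover have "C \<inter> D \<subseteq> A p \<inter> carrier R" using C(2) right_ideal_mem[OF D(1)] by auto
    \<comment> \<open>Agreement on the nonzero right ideal \<open>C \<inter> D\<close> spreads to
      all of \<open>A p\<close> by rigidity.\<close>
    ultimately have "g p x = a \<otimes> x" if "x \<in> A p" for x
      using linear_rigid[OF A'[OF p p] g(1)[OF p] right_ideal_carrier linear_left_mult[OF a right_ideal_carrier]
          right_ideal_Int[OF C(1) D(1)] _ x0 _ that right_ideal_mem[OF A'[OF p p] that]] by simp
    then have "(A p, {\<zero>}, f p) \<in> mult_class (V p) a"
      using A(2)[OF p] g(2)[OF p] by (simp add: mult_class_def)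
    then have "s p = mult_class (V p) a"
      by (rule mult_class_eqI[OF V(1)[OF p] V(2)[OF p] a s[OF p] A(1)[OF p]])
    then show ?thesis using V[OF p] germs[OF p V(2)[OF p]] by (intro bexI[of _ "V p"]) simp_all
  qed
  then show ?thesis using a by (intro bexI[of _ a]) simp_all
qed

lemma rigid_structure_presheaf:
  "rigid_presheaf R \<B> (loc_ring R) (loc_restrict R) (spec_points R) mult_class"
proof (intro rigid_presheaf.intro rigid_presheaf_axioms.intro ring_axioms)
  show "spec_points R = \<Union>\<B>" by (rule spec_cover)
  show "spec_points R \<noteq> ({} :: ('a, 'u) module set set)" by (rule generic_point) auto
qed ((rule basic_opens_Int mult_class_closed mult_class_mult mult_class_add mult_class_one mult_class_zero
    mult_class_restrict mult_class_rigid mult_class_inj global_section_constant; assumption)+)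

lemma global_sections_structure_sheaf:
  "ring (structure_sheaf R (topspace (InjSpec R :: ('a, 'u) module set topology)))"
  "structure_sheaf R (topspace (InjSpec R :: ('a, 'u) module set topology)) \<simeq> R"
  using rigid_presheaf.global_sections[OF rigid_structure_presheaf]
  unfolding structure_sheaf_def topspace_InjSpec[OF ring_axioms] by simp_all

end

theorem theorem2p3:
  fixes R :: "('a, 'r) ring_scheme"
  assumes "noncomm_domain R"
    and "right_noetherian R"
    and "adequate_universe R TYPE('u)"
  shows "let \<Gamma> = structure_sheaf R (topspace (InjSpec R :: ('a, 'u) module set topology))
         in ring \<Gamma> \<and> \<Gamma> \<simeq> R"
proof -
  have "ring R" using assms(1) by (simp add: noncomm_domain_def)
  then have "noetherian_domain R TYPE('u)"
    using assms
    by (intro noetherian_domain.intro universe_ring.intro universe_ring_axioms.intro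
        noetherian_domain_axioms.intro)
  then show ?thesis
    using noetherian_domain.global_sections_structure_sheaf unfolding Let_def by blast
qed

end
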